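(* Let $n\geq 3$. The function $D_0\colon\mathcal{E}_n\to[0,\infty)$ that records area of equidistant $n$-gons is symmetric and continuous on $\mathcal{E}_n$ and smooth on its interior. On the interior it satisfies $$\frac{\partial D_0}{\partial d_i}=\begin{cases}-\sqrt{\frac{1}{\sinh^2J}+\frac{1}{\cosh^2(d_{i_0}/2)}} & i=i_0,\\ \ \ \sqrt{\frac{1}{\sinh^2J}+\frac{1}{\cosh^2(d_i/2)}} & \text{otherwise,}\end{cases}$$ where $d_{i_0}$ is maximal among the $d_i$ and $J=J(d_0,\ldots,d_{n-1})$ is the collar radius. $D_0(d_0,\ldots,d_{n-1})=0$ if and only if $d_{i_0}=\sum_{i\neq i_0}d_i$ for some $i_0$. Moreover $D_0$ extends continuously to $\mathcal{HC}_n$ by the formula $$D_0(d_0,\ldots,d_{n-1})=(n-2)\pi+2\left[\sin^{-1}\left(\frac{1}{\cosh(d_{i_0}/2)}\right)-\sum_{i\neq i_0}\sin^{-1}\left(\frac{1}{\cosh(d_i/2)}\right)\right]$$ for $(d_0,\ldots,d_{n-1})\in\mathcal{HC}_n$ with maximal entry $d_{i_0}$.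
   Context: Define $$\mathcal{E}_n=\Big\{(d_0,\ldots,d_{n-1})\in(0,\infty)^n : \sinh(d_{i_0}/2)>\sum_{i\neq i_0}\sinh(d_i/2)\text{ but } d_{i_0}\leq\sum_{i\neq i_0}d_i,\text{ for some } i_0\Big\},$$ $$\mathcal{HC}_n=\Big\{(d_0,\ldots,d_{n-1})\in(0,\infty)^n : \sinh(d_{i_0}/2)=\sum_{i\neq i_0}\sinh(d_i/2),\text{ where } d_{i_0}=\max_i d_i\Big\}.$$ The interior of $\mathcal{E}_n$ is taken in $(0,\infty)^n$. For $J\geq0$ the $J$-equidistant locus to a geodesic $\gamma$ in the hyperbolic plane $\mathbb{H}^2$ is the set of points at distance $J$ from $\gamma$. A set $\{x_0,\ldots,x_{n-1}\}$ of distinct points on a component $C$ of this locus is an equidistant $n$-gon if for some $i_0$ the sequence $x_{i_0},\ldots,x_{n-1},x_0,\ldots,x_{i_0-1}$ is linearly ordered on $C$: in the orientation that $C$ inherits as a boundary component of the region it bounds with $\gamma$, the compact arc of $C$ bounded by $x_{i-1}$ and $x_i$ points from $x_{i-1}$ to $x_i$ for each $i\neq i_0$ (indices mod $n$). Its collar radius is $J$, the distance from the $x_i$ to $\gamma$, and its side length collection is $(d_0,\ldots,d_{n-1})$ with $d_i=\mathrm{dist}(x_{i-1},x_i)$ for $i>0$ and $d_0=\mathrm{dist}(x_{n-1},x_0)$. The set $\mathcal{E}_n$ is exactly the set of side length collections of equidistant $n$-gons, and an equidistant $n$-gon is determined up to isometry by its side length collection. For $\mathbf{d}\in\mathcal{E}_n$,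 $J(\mathbf{d})$ is the collar radius and $D_0(\mathbf{d})$ is the hyperbolic area of the convex hull of an equidistant $n$-gon with side length collection $\mathbf{d}$. *)

theory Defs
  imports "HOL-Analysis.Analysis"
begin

section \<open>The hyperbolic plane\<close>

text \<open>The upper half-plane model: the metric of constant curvature -1, with the orientation
  of the complex plane.  Its topology is the Euclidean one.\<close>

definition hyp_plane :: "complex set" where
  "hyp_plane = {z. Im z > 0}"

definition hyp_dist :: "complex \<Rightarrow> complex \<Rightarrow> real" where
  "hyp_dist z w = arcosh (1 + (cmod (z - w))\<^sup>2 / (2 * Im z * Im w))"

text \<open>The Riemannian area measure, of area element dx dy / y^2.\<close>

definition hyp_area :: "complex measure" where
  "hyp_area = density lborel (\<lambda>z. ennreal (indicator hyp_plane z / (Im z)\<^sup>2))"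

definition hyp_geodesic :: "complex set \<Rightarrow> bool" where
  "hyp_geodesic G \<longleftrightarrow>
     (\<exists>\<gamma> :: real \<Rightarrow> complex. range \<gamma> = G \<and> G \<subseteq> hyp_plane \<and>
        (\<forall>s t. hyp_dist (\<gamma> s) (\<gamma> t) = \<bar>s - t\<bar>))"

text \<open>The geodesic segment joining two points is their metric interval.\<close>

definition hyp_segment :: "complex \<Rightarrow> complex \<Rightarrow> complex set" where
  "hyp_segment p q = {z \<in> hyp_plane. hyp_dist p z + hyp_dist z q = hyp_dist p q}"

definition hyp_convex :: "complex set \<Rightarrow> bool" where
  "hyp_convex S \<longleftrightarrow> S \<subseteq> hyp_plane \<and> (\<forall>p\<in>S. \<forall>q\<in>S. hyp_segment p q \<subseteq> S)"

section \<open>Equidistant polygons\<close>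

definition hyp_setdist :: "complex \<Rightarrow> complex set \<Rightarrow> real" where
  "hyp_setdist z G = (INF w\<in>G. hyp_dist z w)"

definition equidistant_locus :: "real \<Rightarrow> complex set \<Rightarrow> complex set" where
  "equidistant_locus J G = {z \<in> hyp_plane. hyp_setdist z G = J}"

text \<open>For \<open>J > 0\<close> and a component \<open>C\<close> of the \<open>J\<close>-equidistant locus to the geodesic \<open>G\<close>, there is
  exactly one such \<open>R\<close>; for \<open>J = 0\<close> there is none.\<close>

definition region_between :: "real \<Rightarrow> complex set \<Rightarrow> complex set \<Rightarrow> complex set \<Rightarrow> bool" where
  "region_between J G C R \<longleftrightarrow>
     R \<in> components {z \<in> hyp_plane. 0 < hyp_setdist z G \<and> hyp_setdist z G < J} \<and> C \<subseteq> frontier R"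

text \<open>A regular parametrization of \<open>C\<close> inducing the boundary orientation: the region bounded by \<open>C\<close>
  and \<open>G\<close> lies to the left of \<open>C\<close>, i.e. in the direction of \<open>\<i> * v\<close> for a tangent vector \<open>v\<close>.
  When \<open>J = 0\<close> the region is degenerate and either orientation of \<open>C = G\<close> is admitted.\<close>

definition positive_param :: "real \<Rightarrow> complex set \<Rightarrow> complex set \<Rightarrow> (real \<Rightarrow> complex) \<Rightarrow> bool" where
  "positive_param J G C c \<longleftrightarrow> bij_betw c UNIV C \<and>
     (\<forall>t. \<exists>v. v \<noteq> 0 \<and> (c has_vector_derivative v) (at t) \<and>
        (\<forall>R. region_between J G C R \<longrightarrow>
           (\<forall>\<^sub>F \<epsilon> in at_right 0. c t + complex_of_real \<epsilon> * (\<i> * v) \<in> R)))"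

text \<open>The index set \<open>{0, \<dots>, n - 1}\<close> is a finite linearly ordered type \<open>'n\<close> with \<open>CARD('n) = n\<close>;
  \<open>cyc_pred i\<close> is the index \<open>i - 1\<close> modulo \<open>n\<close>.\<close>

definition cyc_pred :: "'n::{finite,linorder} \<Rightarrow> 'n" where
  "cyc_pred i = (if i = Min UNIV then Max UNIV else Max {j. j < i})"

definition equidistant_ngon :: "real \<Rightarrow> ('n::{finite,linorder} \<Rightarrow> complex) \<Rightarrow> bool" where
  "equidistant_ngon J x \<longleftrightarrow> J \<ge> 0 \<and> inj x \<and>
     (\<exists>G C c t i0. hyp_geodesic G \<and> C \<in> components (equidistant_locus J G) \<and>
        positive_param J G C c \<and> (\<forall>i. x i = c (t i)) \<and>
        (\<forall>i. i \<noteq> i0 \<longrightarrow> t (cyc_pred i) < t i))"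

definition side_lengths :: "('n::{finite,linorder} \<Rightarrow> complex) \<Rightarrow> real ^ 'n::{finite,linorder}" where
  "side_lengths x = (\<chi> i. hyp_dist (x (cyc_pred i)) (x i))"

definition equidistant_set :: "(real ^ 'n::{finite,linorder}) set" where
  "equidistant_set = {d. (\<forall>i. d $ i > 0) \<and>
     (\<exists>i0. sinh (d $ i0 / 2) > (\<Sum>i\<in>UNIV - {i0}. sinh (d $ i / 2)) \<and>
           d $ i0 \<le> (\<Sum>i\<in>UNIV - {i0}. d $ i))}"

definition horocyclic_set :: "(real ^ 'n::{finite,linorder}) set" where
  "horocyclic_set = {d. (\<forall>i. d $ i > 0) \<and>
     (\<exists>i0. (\<forall>i. d $ i \<le> d $ i0) \<and>
           sinh (d $ i0 / 2) = (\<Sum>i\<in>UNIV - {i0}. sinh (d $ i / 2)))}"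

text \<open>Both functions are meaningful on \<open>equidistant_set\<close>.\<close>

definition collar_radius :: "real ^ 'n::{finite,linorder} \<Rightarrow> real" where
  "collar_radius d = (THE J. \<exists>x. equidistant_ngon J x \<and> side_lengths x = d)"

definition equidistant_area :: "real ^ 'n::{finite,linorder} \<Rightarrow> real" where
  "equidistant_area d = (THE a. \<exists>J x. equidistant_ngon J x \<and> side_lengths x = d \<and>
     a = measure hyp_area (hyp_convex hull (range x)))"

section \<open>Smooth functions\<close>

text \<open>Only meant for open sets \<open>S\<close>; \<open>g\<close> is the gradient of \<open>f\<close>.\<close>

fun Ck_on :: "nat \<Rightarrow> ('a::euclidean_space \<Rightarrow> real) \<Rightarrow> 'a set \<Rightarrow> bool" where
  "Ck_on 0 f S \<longleftrightarrow> continuous_on S f"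
| "Ck_on (Suc k) f S \<longleftrightarrow>
     (\<exists>g. (\<forall>x\<in>S. (f has_derivative (\<lambda>h. g x \<bullet> h)) (at x)) \<and>
          (\<forall>b\<in>Basis. Ck_on k (\<lambda>x. g x \<bullet> b) S))"

definition smooth_on :: "('a::euclidean_space \<Rightarrow> real) \<Rightarrow> 'a set \<Rightarrow> bool" where
  "smooth_on f S \<longleftrightarrow> (\<forall>k. Ck_on k f S)"

end

(* Work in the upper half-plane.  The map klein z = Re z + i |z|^2 straightens hyperbolic geodesics to
   Euclidean segments, so hyperbolic convex hulls become Euclidean ones.  The region above the geodesic
   segment pq has area |chord_angle p q|, where chord_angle p q = 2 arctan ((Re q - Re p) / (Im p + Im q));
   hence a triangle has area |chord_angle p q + chord_angle q r + chord_angle r p|, a quantity that is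
   invariant under Moebius maps because the corrections telescope.

   After a Moebius map the geodesic is the imaginary axis and the vertices are e^t (k + i) with |k| = sinh J.
   There a chord of length d has projection l with sinh (d/2) = cosh J sinh (l/2) and chord angle
   A(l) = 2 arctan (sinh J tanh (l/2)) = 2 arcsin (tanh J tanh (d/2)).  Since the longest projection is the
   sum of the others, u = 1 / cosh J is the root of sum_i +-arsinh (u sinh (d_i/2)) = 0 and the area is
   sum_i +-A(l_i), the sign being - at the longest side.  Because arsinh (r sinh x) is strictly subadditive
   for r > 1, the root is unique and the excess changes sign there, which makes u continuous, also up to the
   horocyclic set, where u = 0.  The implicit function theorem gives the derivative of u, and the formula for
   the derivative of the area follows from dA/dJ = - (1 / sinh J) dl/dJ along the constraint. *)

theory Submission
  imports Defs
begin

section \<open>The projective model\<close>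

text \<open>The obstacle is that the closing condition has the trivial root u = 0. On the
  equidistant set the excess starts at 0 with negative slope, stays negative up to the wanted root
  and is positive beyond it, so it is not monotone in u. On the horocyclic set the slope at 0
  vanishes, and the implicit function theorem gives nothing there. Two arguments v < w are therefore
  compared through the maps z -> arsinh (r sinh z) with r = w / v, and continuity is proved from the
  signs of the excess before any derivative is taken.

  The factor 1 / sinh J relating dA and dl is the same for every side, so it acts as a Lagrange
  multiplier: after adding 2 / sinh J times the excess to the area, the dependence on u drops out to
  first order and only the explicit dependence on the side lengths remains. The area formula itself
  uses u and the side lengths instead of J and the projections, because at the horocyclic set sinh J
  becomes infinite while the projections shrink to 0.\<close>

lemma hyp_plane_iff [simp]: "z \<in> hyp_plane \<longleftrightarrow> Im z > 0"
  by (simp add: hyp_plane_def)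

lemma cosh_hyp_dist:
  assumes "Im z > 0" "Im w > 0"
  shows "cosh (hyp_dist z w) = 1 + (cmod (z - w))\<^sup>2 / (2 * Im z * Im w)"
  using assms by (simp add: hyp_dist_def cosh_arcosh_real)

lemma hyp_dist_nonneg:
  assumes "Im z > 0" "Im w > 0"
  shows "hyp_dist z w \<ge> 0"
  using assms by (simp add: hyp_dist_def arcosh_nonneg_real)

lemma sinh_half_hyp_dist:
  assumes "Im z > 0" "Im w > 0"
  shows "sinh (hyp_dist z w / 2) = cmod (z - w) / (2 * sqrt (Im z * Im w))"
proof -
  have "cosh (hyp_dist z w) = 1 + 2 * (sinh (hyp_dist z w / 2))\<^sup>2"
    using cosh_double[of "hyp_dist z w / 2"] cosh_square_eq[of "hyp_dist z w / 2"] by simp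
  then have "(sinh (hyp_dist z w / 2))\<^sup>2 = (cmod (z - w) / (2 * sqrt (Im z * Im w)))\<^sup>2"
    using cosh_hyp_dist[OF assms] assms by (simp add: power_divide power_mult_distrib field_simps)
  then show ?thesis
    using assms hyp_dist_nonneg[OF assms] by (simp add: power2_eq_iff_nonneg)
qed

lemma hyp_dist_eq_0_iff:
  assumes "Im z > 0" "Im w > 0"
  shows "hyp_dist z w = 0 \<longleftrightarrow> z = w"
  using sinh_half_hyp_dist[OF assms] assms by auto

lemma hyp_dist_pos_iff:
  assumes "Im z > 0" "Im w > 0"
  shows "hyp_dist z w > 0 \<longleftrightarrow> z \<noteq> w"
  using hyp_dist_eq_0_iff[OF assms] hyp_dist_nonneg[OF assms] by auto

text \<open>The image of the half-plane is the inside of a parabola: the Klein model with the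
  parabola in place of the circle.\<close>

definition klein :: "complex \<Rightarrow> complex" where
  "klein z = Complex (Re z) ((cmod z)\<^sup>2)"

text \<open>Twice the signed area of the triangle, positive if it is traversed counterclockwise;
  also the determinant of the rows (1, Re, Im).\<close>

definition turn :: "complex \<Rightarrow> complex \<Rightarrow> complex \<Rightarrow> real" where
  "turn P Q R = (Re Q - Re P) * (Im R - Im P) - (Re R - Re P) * (Im Q - Im P)"

text \<open>The Lorentzian bilinear form of the hyperboloid model in the homogeneous coordinates (1,
  X, Y) of \<open>klein z\<close>: the polarization of Y - X^2, which takes the value (Im z)^2 on
  the diagonal.\<close>

definition klein_form :: "complex \<Rightarrow> complex \<Rightarrow> real" where
  "klein_form z w = ((cmod z)\<^sup>2 + (cmod w)\<^sup>2) / 2 - Re z * Re w"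

lemma cosh_hyp_dist_klein_form:
  assumes "Im z > 0" "Im w > 0"
  shows "cosh (hyp_dist z w) = klein_form z w / (Im z * Im w)"
  using assms unfolding cosh_hyp_dist[OF assms] klein_form_def cmod_power2
  by (simp add: field_simps power2_eq_square)

text \<open>The left side is the Gram determinant of three vectors (1, X, Y) for
  \<open>klein_form\<close>. It equals the square of their determinant, which is
  \<open>turn\<close>, times the determinant 1/4 of the form.\<close>

lemma gram_identity:
  "(Im p * Im z * Im q)\<^sup>2 + 2 * klein_form p z * klein_form z q * klein_form p q
     - (Im p * klein_form z q)\<^sup>2 - (Im q * klein_form p z)\<^sup>2 - (Im z * klein_form p q)\<^sup>2
   = (turn (klein p) (klein z) (klein q))\<^sup>2 / 4"
proof -
  define a b c P Z Q where defs: "a = Re p" "b = Re z" "c = Re q"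
    "P = (cmod p)\<^sup>2" "Z = (cmod z)\<^sup>2" "Q = (cmod q)\<^sup>2"
  have im: "(Im p)\<^sup>2 = P - a\<^sup>2" "(Im z)\<^sup>2 = Z - b\<^sup>2" "(Im q)\<^sup>2 = Q - c\<^sup>2"
    by (auto simp: defs cmod_power2)
  show ?thesis
    unfolding klein_form_def turn_def klein_def power_mult_distrib complex.sel defs[symmetric] im
    by (simp add: power2_eq_square field_simps)
qed

text \<open>Additivity of the distances is the cosine law for a straight angle, sinh a sinh b = cosh
  c - cosh a cosh b. Squaring splits it into a sign condition and the vanishing of the Gram
  determinant.\<close>

lemma hyp_dist_add_iff:
  assumes "Im p > 0" "Im z > 0" "Im q > 0"
  shows "hyp_dist p z + hyp_dist z q = hyp_dist p q \<longleftrightarrow>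
    turn (klein p) (klein z) (klein q) = 0 \<and>
    klein_form p z * klein_form z q \<le> klein_form p q * (Im z)\<^sup>2"
proof -
  define a b c where abc: "a = hyp_dist p z" "b = hyp_dist z q" "c = hyp_dist p q"
  have pos: "a \<ge> 0" "b \<ge> 0" "c \<ge> 0"
    using assms by (auto simp: abc hyp_dist_nonneg)
  have ch: "cosh a = klein_form p z / (Im p * Im z)" "cosh b = klein_form z q / (Im z * Im q)"
    "cosh c = klein_form p q / (Im p * Im q)"
    using assms by (auto simp: abc cosh_hyp_dist_klein_form)
  have "a + b = c \<longleftrightarrow> cosh (a + b) = cosh c"
    using pos by (metis add_nonneg_nonneg arcosh_cosh_real)
  also have "\<dots> \<longleftrightarrow> sinh a * sinh b = cosh c - cosh a * cosh b"
    by (auto simp: cosh_add)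
  also have "\<dots> \<longleftrightarrow> cosh c - cosh a * cosh b \<ge> 0 \<and>
      (sinh a * sinh b)\<^sup>2 = (cosh c - cosh a * cosh b)\<^sup>2"
    using pos by (metis mult_nonneg_nonneg power2_eq_iff_nonneg sinh_real_nonneg_iff)
  also have "(sinh a * sinh b)\<^sup>2 = (cosh c - cosh a * cosh b)\<^sup>2 \<longleftrightarrow>
      1 + 2 * cosh a * cosh b * cosh c - (cosh a)\<^sup>2 - (cosh b)\<^sup>2 - (cosh c)\<^sup>2 = 0"
    unfolding power_mult_distrib sinh_square_eq by (auto simp: power2_eq_square algebra_simps)
  also have "1 + 2 * cosh a * cosh b * cosh c - (cosh a)\<^sup>2 - (cosh b)\<^sup>2 - (cosh c)\<^sup>2 =
      (turn (klein p) (klein z) (klein q))\<^sup>2 / (4 * (Im p * Im z * Im q)\<^sup>2)"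
    unfolding ch using gram_identity[of p z q] assms by (simp add: divide_simps) algebra
  also have "cosh c - cosh a * cosh b \<ge> 0 \<longleftrightarrow>
      klein_form p z * klein_form z q \<le> klein_form p q * (Im z)\<^sup>2"
    unfolding ch using assms by (simp add: divide_simps power2_eq_square)
  finally show ?thesis
    using assms by (auto simp: abc)
qed

lemma collinear_param:
  assumes "turn P Z Q = 0" "P \<noteq> Q"
  obtains t where "Z = P + t *\<^sub>R (Q - P)"
proof (cases "Re Q = Re P")
  case True
  with assms have "Im Q \<noteq> Im P" by (auto simp: complex_eq_iff)
  with assms True have "Re Z = Re P" by (auto simp: turn_def)
  have "Z = P + ((Im Z - Im P) / (Im Q - Im P)) *\<^sub>R (Q - P)"
    using \<open>Im Q \<noteq> Im P\<close> True \<open>Re Z = Re P\<close> by (auto simp: complex_eq_iff)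
  then show ?thesis by (rule that)
next
  case False
  have "Z = P + ((Re Z - Re P) / (Re Q - Re P)) *\<^sub>R (Q - P)"
    using False assms(1) by (auto simp: complex_eq_iff turn_def divide_simps)
  then show ?thesis by (rule that)
qed

text \<open>The reversed Cauchy-Schwarz inequality of the Lorentzian form; it is strict because cosh
  exceeds 1 at a positive distance.\<close>

lemma klein_form_sq_gt:
  assumes "Im p > 0" "Im q > 0" "p \<noteq> q"
  shows "(klein_form p q)\<^sup>2 > (Im p * Im q)\<^sup>2"
proof -
  have "cosh (hyp_dist p q) > 1"
    using assms hyp_dist_pos_iff[of p q] cosh_real_strict_mono[of 0 "hyp_dist p q"] by simp
  then have "klein_form p q > Im p * Im q"
    using assms cosh_hyp_dist_klein_form[of p q] by (simp add: divide_simps split: if_splits)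
  then show ?thesis using assms by (intro power_strict_mono) auto
qed

lemma klein_inj:
  assumes "Im p > 0" "Im q > 0" "klein p = klein q"
  shows "p = q"
  using assms by (auto simp: klein_def cmod_power2 complex_eq_iff power2_eq_iff_nonneg)

lemma hyp_segment_klein:
  assumes "Im p > 0" "Im q > 0"
  shows "hyp_segment p q = {z. Im z > 0 \<and> klein z \<in> closed_segment (klein p) (klein q)}"
proof (cases "p = q")
  case True
  have "hyp_dist p z + hyp_dist z p = hyp_dist p p \<longleftrightarrow> z = p" if "Im z > 0" for z
    using assms that hyp_dist_nonneg[of p z] hyp_dist_nonneg[of z p] hyp_dist_eq_0_iff[of p z]
      hyp_dist_eq_0_iff[of p p] by (auto simp: True)
  then show ?thesis
    using True assms klein_inj by (auto simp: hyp_segment_def)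
next
  case False
  with assms klein_inj have ne: "klein p \<noteq> klein q" by blast
  have key: "hyp_dist p z + hyp_dist z q = hyp_dist p q \<longleftrightarrow> t \<in> {0..1}"
    if z: "Im z > 0" and t: "klein z = klein p + t *\<^sub>R (klein q - klein p)" for z t
  proof -
    have re: "Re z = Re p + t * (Re q - Re p)"
      and ab: "(cmod z)\<^sup>2 = (cmod p)\<^sup>2 + t * ((cmod q)\<^sup>2 - (cmod p)\<^sup>2)"
      using t by (auto simp: klein_def complex_eq_iff)
    have im: "(Im z)\<^sup>2 = (cmod z)\<^sup>2 - (Re z)\<^sup>2" "(Im p)\<^sup>2 = (cmod p)\<^sup>2 - (Re p)\<^sup>2"
      "(Im q)\<^sup>2 = (cmod q)\<^sup>2 - (Re q)\<^sup>2"
      by (auto simp: cmod_power2)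
    have 1: "turn (klein p) (klein z) (klein q) = 0"
      unfolding turn_def klein_def complex.sel re ab by algebra
    \<comment> \<open>On the line through the two points the sign condition reduces to t (1 - t) >=
      0, since the other factor is positive by \<open>klein_form_sq_gt\<close>.\<close>
    have 2: "klein_form p q * (Im z)\<^sup>2 - klein_form p z * klein_form z q =
        t * (1 - t) * ((klein_form p q)\<^sup>2 - (Im p * Im q)\<^sup>2)"
    proof -
      have "klein_form p z = (1 - t) * (Im p)\<^sup>2 + t * klein_form p q"
        "klein_form z q = (1 - t) * klein_form p q + t * (Im q)\<^sup>2"
        "(Im z)\<^sup>2 = (1 - t)\<^sup>2 * (Im p)\<^sup>2 + 2 * t * (1 - t) * klein_form p q + t\<^sup>2 * (Im q)\<^sup>2"
        unfolding im klein_form_def re ab by (simp_all add: power2_eq_square field_simps)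
      then show ?thesis unfolding power_mult_distrib by algebra
    qed
    have "klein_form p z * klein_form z q \<le> klein_form p q * (Im z)\<^sup>2 \<longleftrightarrow> t * (1 - t) \<ge> 0"
      using 2 klein_form_sq_gt[OF assms False]
        mult_nonneg_nonneg[of "t * (1 - t)" "(klein_form p q)\<^sup>2 - (Im p * Im q)\<^sup>2"]
        mult_neg_pos[of "t * (1 - t)" "(klein_form p q)\<^sup>2 - (Im p * Im q)\<^sup>2"]
      by (cases "t * (1 - t) \<ge> 0") linarith+
    then show ?thesis
      using 1 hyp_dist_add_iff[of p z q] assms z by (auto simp: zero_le_mult_iff)
  qed
  show ?thesis
  proof (intro set_eqI iffI)
    fix z assume z: "z \<in> hyp_segment p q"
    then have z': "Im z > 0" "hyp_dist p z + hyp_dist z q = hyp_dist p q"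
      by (auto simp: hyp_segment_def)
    then have "turn (klein p) (klein z) (klein q) = 0"
      using hyp_dist_add_iff assms by blast
    then obtain t where t: "klein z = klein p + t *\<^sub>R (klein q - klein p)"
      using ne by (rule collinear_param)
    then have "t \<in> {0..1}" using key z' by blast
    then show "z \<in> {z. Im z > 0 \<and> klein z \<in> closed_segment (klein p) (klein q)}"
      using z' t by (auto simp: closed_segment_image_interval algebra_simps intro!: image_eqI[of _ _ t])
  next
    fix z assume z: "z \<in> {z. Im z > 0 \<and> klein z \<in> closed_segment (klein p) (klein q)}"
    then obtain t where "t \<in> {0..1}" "klein z = klein p + t *\<^sub>R (klein q - klein p)"
      by (auto simp: closed_segment_def algebra_simps)
    then show "z \<in> hyp_segment p q"
      using z key by (auto simp: hyp_segment_def)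
  qed
qed

lemma klein_image: "klein ` hyp_plane = {P. (Re P)\<^sup>2 < Im P}"
proof (intro set_eqI iffI)
  fix P :: complex assume P: "P \<in> {P. (Re P)\<^sup>2 < Im P}"
  then have "P = klein (Complex (Re P) (sqrt (Im P - (Re P)\<^sup>2)))"
    by (auto simp: klein_def complex_eq_iff cmod_power2)
  then show "P \<in> klein ` hyp_plane"
    using P by (intro image_eqI) auto
qed (auto simp: klein_def cmod_power2)

lemma convex_klein_image: "convex {P. (Re P)\<^sup>2 < Im P}"
proof -
  have "convex_on UNIV (\<lambda>x. (Re x)\<^sup>2 - Im x)"
  proof (rule convex_onI)
      fix t :: real and x y :: complex assume t: "0 < t" "t < 1"
      have "(1 - t) * (Re x)\<^sup>2 + t * (Re y)\<^sup>2 - ((1 - t) * Re x + t * Re y)\<^sup>2 = t * (1 - t) * (Re x - Re y)\<^sup>2"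
        by algebra
      moreover have "t * (1 - t) * (Re x - Re y)\<^sup>2 \<ge> 0" using t by simp
      ultimately show "(Re ((1 - t) *\<^sub>R x + t *\<^sub>R y))\<^sup>2 - Im ((1 - t) *\<^sub>R x + t *\<^sub>R y)
          \<le> (1 - t) * ((Re x)\<^sup>2 - Im x) + t * ((Re y)\<^sup>2 - Im y)"
        by (simp add: algebra_simps)
  qed simp
  then have "convex {x. (Re x)\<^sup>2 - Im x < 0}"
    unfolding convex_def using convex_lower[of UNIV "\<lambda>x. (Re x)\<^sup>2 - Im x"]
    by (smt (verit, best) UNIV_I mem_Collect_eq)
  then show ?thesis by simp
qed

text \<open>Minimality of the hull in both models. One direction needs that a Euclidean segment
  between points inside the parabola stays inside it, so that all its points come from the
  half-plane.\<close>

lemma hyp_convex_hull_klein: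
  assumes "S \<subseteq> hyp_plane"
  shows "hyp_convex hull S = {z. Im z > 0 \<and> klein z \<in> convex hull (klein ` S)}" (is "_ = ?H")
proof
  have "hyp_convex ?H"
    unfolding hyp_convex_def
    using convex_contains_segment[of "convex hull (klein ` S)"] convex_convex_hull
    by (fastforce simp: hyp_segment_klein)
  moreover have "S \<subseteq> ?H"
    using assms by (auto intro: hull_inc)
  ultimately show "hyp_convex hull S \<subseteq> ?H"
    by (intro hull_minimal)
next
  show "?H \<subseteq> hyp_convex hull S"
    unfolding hull_def[of hyp_convex S]
  proof (intro Inter_greatest)
    fix T assume "T \<in> {T. hyp_convex T \<and> S \<subseteq> T}"
    then have T: "hyp_convex T" "S \<subseteq> T" "T \<subseteq> hyp_plane" by (auto simp: hyp_convex_def)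
    have "convex (klein ` T)"
      unfolding convex_contains_segment
    proof (intro ballI subsetI)
      fix P Q W assume "P \<in> klein ` T" "Q \<in> klein ` T" and W: "W \<in> closed_segment P Q"
      then obtain p q where pq: "p \<in> T" "q \<in> T" "P = klein p" "Q = klein q" by auto
      have "P \<in> klein ` hyp_plane" "Q \<in> klein ` hyp_plane" using pq T by auto
      then have "W \<in> klein ` hyp_plane"
        using W convex_klein_image unfolding klein_image convex_contains_segment by blast
      then obtain w where w: "Im w > 0" "W = klein w" by auto
      then have "w \<in> hyp_segment p q"
        using W pq T by (subst hyp_segment_klein) auto
      then show "W \<in> klein ` T"
        using T pq w unfolding hyp_convex_def by blast
    qed
    then have "convex hull (klein ` S) \<subseteq> klein ` T"
      using T by (intro hull_minimal) auto
    then show "?H \<subseteq> T"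
      using T(3) klein_inj by (auto simp: subset_iff image_iff)
  qed
qed

section \<open>Areas of triangles\<close>

text \<open>Makes iterated integration over vertical lines available.\<close>

lemma lborel_complex:
  "(lborel :: complex measure) = distr (lborel \<Otimes>\<^sub>M lborel) borel (\<lambda>(x, y). Complex x y)"
proof (rule lborel_eqI)
  fix l u :: complex assume lu: "\<And>b. b \<in> Basis \<Longrightarrow> l \<bullet> b \<le> u \<bullet> b"
  have le: "Re l \<le> Re u" "Im l \<le> Im u"
    using lu[of 1] lu[of \<i>] by (auto simp: Basis_complex_def)
  have "(\<lambda>(x, y). Complex x y) -` box l u = {Re l<..<Re u} \<times> {Im l<..<Im u}"
    by (auto simp: in_box_complex_iff)
  then show "emeasure (distr (lborel \<Otimes>\<^sub>M lborel) borel (\<lambda>(x, y). Complex x y)) (box l u) =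
      ennreal (\<Prod>b\<in>Basis. (u - l) \<bullet> b)"
    using le
    by (subst emeasure_distr)
      (auto simp: borel_prod space_pair_measure lborel.emeasure_pair_measure_Times Basis_complex_def
        ennreal_mult[symmetric] case_prod_unfold Complex_eq
        intro!: borel_measurable_continuous_onI continuous_intros)
qed simp

lemma sets_hyp_area [measurable_cong, simp]: "sets hyp_area = sets borel"
  by (simp add: hyp_area_def)

lemma measurable_hyp_density [measurable]:
  "(\<lambda>z. ennreal (indicator hyp_plane z / (Im z)\<^sup>2)) \<in> borel_measurable borel"
proof (rule measurable_compose[OF _ measurable_ennreal], rule borel_measurable_divide)
  have "hyp_plane \<in> sets borel"
    unfolding hyp_plane_def by (intro borel_open open_halfspace_Im_gt)
  then show "indicat_real hyp_plane \<in> borel_measurable borel"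
    by (rule borel_measurable_indicator)
  show "(\<lambda>z. (Im z)\<^sup>2) \<in> borel_measurable borel"
    by (intro borel_measurable_continuous_onI continuous_intros)
qed

lemma emeasure_hyp_area:
  assumes [measurable]: "S \<in> sets borel"
  shows "emeasure hyp_area S =
    (\<integral>\<^sup>+x. \<integral>\<^sup>+y. ennreal (1 / y\<^sup>2) * indicator {y. 0 < y \<and> Complex x y \<in> S} y \<partial>lborel \<partial>lborel)"
proof -
  have m[measurable]: "(\<lambda>(x, y). Complex x y) \<in> borel_measurable (lborel \<Otimes>\<^sub>M lborel)"
    unfolding borel_prod lborel_prod
    by (auto simp: case_prod_unfold Complex_eq intro!: borel_measurable_continuous_onI continuous_intros)
  have "emeasure hyp_area S = (\<integral>\<^sup>+z. ennreal (indicator hyp_plane z / (Im z)\<^sup>2) * indicator S z \<partial>lborel)"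
    unfolding hyp_area_def by (rule emeasure_density) measurable
  also have "\<dots> = (\<integral>\<^sup>+p. (\<lambda>z. ennreal (indicator hyp_plane z / (Im z)\<^sup>2) * indicator S z)
      ((\<lambda>(x, y). Complex x y) p) \<partial>(lborel \<Otimes>\<^sub>M lborel))"
    by (subst lborel_complex, rule nn_integral_distr) auto
  also have "\<dots> = (\<integral>\<^sup>+x. \<integral>\<^sup>+y. (\<lambda>z. ennreal (indicator hyp_plane z / (Im z)\<^sup>2) * indicator S z)
      ((\<lambda>(x, y). Complex x y) (x, y)) \<partial>lborel \<partial>lborel)"
    by (subst lborel.nn_integral_fst[symmetric]) (auto intro: measurable_compose[OF m])
  also have "\<dots> = (\<integral>\<^sup>+x. \<integral>\<^sup>+y. ennreal (1 / y\<^sup>2) * indicator {y. 0 < y \<and> Complex x y \<in> S} y \<partial>lborel \<partial>lborel)"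
    by (intro nn_integral_cong) (auto split: split_indicator)
  finally show ?thesis .
qed

lemma AE_hyp_area_pos: "AE z in hyp_area. Im z > 0"
  unfolding hyp_area_def
  by (subst AE_density) (use measurable_hyp_density in \<open>auto split: split_indicator\<close>)

text \<open>For b nonzero a vertical line contains at most one such point of the half-plane; for b =
  0 all solutions lie on a single vertical line. The sets covered include all geodesics.\<close>

lemma AE_hyp_area_line:
  assumes "a \<noteq> 0 \<or> b \<noteq> 0"
  shows "AE z in hyp_area. a * Re z + b * (cmod z)\<^sup>2 + c \<noteq> 0"
proof -
  let ?S = "{z. a * Re z + b * (cmod z)\<^sup>2 + c = 0}"
  have S[measurable]: "?S \<in> sets borel"
    by (intro borel_closed closed_Collect_eq continuous_intros)
  have inner: "(\<integral>\<^sup>+y. ennreal (1 / y\<^sup>2) * indicator {y. 0 < y \<and> Complex x y \<in> ?S} y \<partial>lborel) = 0"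
    if "b \<noteq> 0 \<or> x \<noteq> - c / a" for x
  proof -
    have "AE y in lborel. y \<noteq> sqrt (- (a * x + c) / b - x\<^sup>2)"
      by (rule AE_lborel_singleton)
    then have "AE y in lborel. ennreal (1 / y\<^sup>2) * indicator {y. 0 < y \<and> Complex x y \<in> ?S} y = 0"
    proof eventually_elim
      case (elim y)
      have False if "0 < y" "a * x + b * (x\<^sup>2 + y\<^sup>2) + c = 0"
      proof (cases "b = 0")
        case True
        then show ?thesis using that assms \<open>b \<noteq> 0 \<or> x \<noteq> - c / a\<close> by (auto simp: field_simps)
      next
        case False
        then have "y\<^sup>2 = - (a * x + c) / b - x\<^sup>2"
          using that by (auto simp: field_simps)
        then show ?thesis using elim that by (metis less_imp_le real_sqrt_unique)
      qed
      then show ?case by (auto simp: cmod_power2 split: split_indicator)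
    qed
    then show ?thesis
      by (subst nn_integral_cong_AE) auto
  qed
  have "AE x in lborel. x \<noteq> - c / a"
    by (rule AE_lborel_singleton)
  then have "AE x in lborel. (\<integral>\<^sup>+y. ennreal (1 / y\<^sup>2) * indicator {y. 0 < y \<and> Complex x y \<in> ?S} y \<partial>lborel) = 0"
    using inner by auto
  then have "emeasure hyp_area ?S = 0"
    unfolding emeasure_hyp_area[OF S] by (subst nn_integral_cong_AE) auto
  then have "?S \<in> null_sets hyp_area"
    by (auto simp: null_sets_def)
  from AE_not_in[OF this] show ?thesis by simp
qed

lemma AE_Re_neq: "AE z in hyp_area. Re z \<noteq> x"
  using AE_hyp_area_line[of 1 0 "- x"] by auto

text \<open>The signed angle that the geodesic arc subtends at the centre of its circle, in
  half-angle form. It is the integral of dx / y along the arc, and 0 for vertical geodesics.\<close>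

definition chord_angle :: "complex \<Rightarrow> complex \<Rightarrow> real" where
  "chord_angle p q = 2 * arctan ((Re q - Re p) / (Im p + Im q))"

definition above_chord :: "complex \<Rightarrow> complex \<Rightarrow> complex set" where
  "above_chord p q = {z. Re p \<le> Re z \<and> Re z \<le> Re q \<and> turn (klein p) (klein q) (klein z) > 0}"

lemma sets_above_chord [measurable]: "above_chord p q \<in> sets borel"
proof -
  have "above_chord p q = {z. Re p \<le> Re z} \<inter> {z. Re z \<le> Re q} \<inter> {z. turn (klein p) (klein q) (klein z) > 0}"
    by (auto simp: above_chord_def)
  moreover have "open {z. turn (klein p) (klein q) (klein z) > 0}"
    unfolding turn_def klein_def complex.sel
    by (intro open_Collect_less continuous_intros)
  ultimately show ?thesis
    by (auto intro!: sets.Int borel_closed closed_halfspace_Re_ge closed_halfspace_Re_le)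
qed

lemma emeasure_above_chord:
  assumes p: "Im p > 0" and q: "Im q > 0" and le: "Re p \<le> Re q"
  shows "emeasure hyp_area (above_chord p q) = ennreal (chord_angle p q)"
proof (cases "Re p = Re q")
  case True
  have "AE z in hyp_area. z \<notin> above_chord p q"
    using AE_Re_neq[of "Re q"] by (auto simp: above_chord_def True elim!: eventually_mono)
  then have "above_chord p q \<in> null_sets hyp_area"
    by (subst (asm) AE_iff_null_sets[symmetric]) auto
  then show ?thesis by (simp add: null_sets_def chord_angle_def True)
next
  case False
  with le have lt: "Re p < Re q" by simp
  \<comment> \<open>The geodesic through the two points is the line of slope \<open>s\<close> in the
    projective model; \<open>h x\<close> is the square of its height over \<open>x\<close>.\<close>
  define s where "s = ((cmod q)\<^sup>2 - (cmod p)\<^sup>2) / (Re q - Re p)"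
  define h where "h = (\<lambda>x. (cmod p)\<^sup>2 + s * (x - Re p) - x\<^sup>2)"
  have slope: "(Re q - Re p) * s = (cmod q)\<^sup>2 - (cmod p)\<^sup>2" using lt by (simp add: s_def)
  have hp: "h (Re p) = (Im p)\<^sup>2" by (simp add: h_def cmod_power2)
  have hq: "h (Re q) = (Im q)\<^sup>2" using lt by (simp add: h_def s_def cmod_power2)
  have hpos: "h x > 0" if "x \<in> {Re p..Re q}" for x
  proof -
    \<comment> \<open>Concavity of \<open>h\<close>: the last term measures its excess over the
      linear interpolation of its end values.\<close>
    have "(Re q - Re p) * h x = (Re q - x) * (Im p)\<^sup>2 + (x - Re p) * (Im q)\<^sup>2
        + (Re q - Re p) * ((x - Re p) * (Re q - x))"
    proof -
      have "(Re q - Re p) * h x = (Re q - Re p) * ((cmod p)\<^sup>2 - x\<^sup>2) + ((Re q - Re p) * s) * (x - Re p)"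
        by (simp add: h_def algebra_simps)
      also have "\<dots> = (Re q - x) * (Im p)\<^sup>2 + (x - Re p) * (Im q)\<^sup>2 + (Re q - Re p) * ((x - Re p) * (Re q - x))"
        unfolding slope cmod_power2 by (simp add: power2_eq_square algebra_simps)
      finally show ?thesis .
    qed
    also have "\<dots> > 0"
    proof (cases "x = Re p")
      case True
      then show ?thesis using lt p by simp
    next
      case False
      then show ?thesis using that lt p q
        by (intro add_pos_nonneg add_nonneg_pos mult_nonneg_nonneg mult_pos_pos) auto
    qed
    finally show ?thesis using lt by (simp add: zero_less_mult_iff)
  qed
  \<comment> \<open>The chord angle of the part of the arc from \<open>p\<close> to the point over
    \<open>x\<close>, which serves as the antiderivative.\<close>
  define \<Phi> where "\<Phi> = (\<lambda>x. 2 * arctan ((x - Re p) / (Im p + sqrt (h x))))"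
  have inner: "(\<integral>\<^sup>+y. ennreal (1 / y\<^sup>2) * indicator {y. 0 < y \<and> Complex x y \<in> above_chord p q} y \<partial>lborel)
      = ennreal (1 / sqrt (h x)) * indicator {Re p..Re q} x" for x
  proof (cases "x \<in> {Re p..Re q}")
    case True
    have *: "Complex x y \<in> above_chord p q \<longleftrightarrow> sqrt (h x) < y" if "y > 0" for y
    proof -
      have "turn (klein p) (klein q) (klein (Complex x y)) =
          (Re q - Re p) * ((x\<^sup>2 + y\<^sup>2) - (cmod p)\<^sup>2) - (x - Re p) * ((cmod q)\<^sup>2 - (cmod p)\<^sup>2)"
        by (simp add: turn_def klein_def cmod_power2[of "Complex x y"])
      also have "\<dots> = (Re q - Re p) * (y\<^sup>2 - h x)"
        unfolding slope[symmetric] by (simp add: h_def algebra_simps)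
      finally have "turn (klein p) (klein q) (klein (Complex x y)) = (Re q - Re p) * (y\<^sup>2 - h x)" .
      then have "Complex x y \<in> above_chord p q \<longleftrightarrow> h x < y\<^sup>2"
        using True lt by (auto simp: above_chord_def zero_less_mult_iff)
      also have "\<dots> \<longleftrightarrow> sqrt (h x) < y"
        using that real_sqrt_less_iff[of "h x" "y\<^sup>2"] by simp
      finally show ?thesis .
    qed
    have pos: "y > 0" if "sqrt (h x) \<le> y" for y
      using that hpos[OF True] by (auto simp: less_le_trans[of 0 "sqrt (h x)"])
    have "AE y in lborel. y \<noteq> sqrt (h x)" by (rule AE_lborel_singleton)
    then have "(\<integral>\<^sup>+y. ennreal (1 / y\<^sup>2) * indicator {y. 0 < y \<and> Complex x y \<in> above_chord p q} y \<partial>lborel) =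
        (\<integral>\<^sup>+y. ennreal (1 / y\<^sup>2) * indicator {sqrt (h x)..} y \<partial>lborel)"
      by (intro nn_integral_cong_AE) (auto split: split_indicator simp: * pos elim!: eventually_mono)
    also have "\<dots> = ennreal (0 - (- 1 / sqrt (h x)))"
    proof (rule nn_integral_FTC_atLeast)
      show "((\<lambda>y. - 1 / y :: real) \<longlongrightarrow> 0) at_top"
        by (intro tendsto_divide_0[OF tendsto_const] filterlim_at_top_imp_at_infinity filterlim_ident)
      fix y assume "sqrt (h x) \<le> y"
      then have "y > 0" by (rule pos)
      then show "((\<lambda>y. - 1 / y) has_real_derivative 1 / y\<^sup>2) (at y)"
        by (auto intro!: derivative_eq_intros simp: power2_eq_square)
    qed auto
    finally show ?thesis using True by simp
  next
    case False
    then have "{y. 0 < y \<and> Complex x y \<in> above_chord p q} = {}"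
      by (auto simp: above_chord_def)
    then show ?thesis using False by simp
  qed
  have "emeasure hyp_area (above_chord p q) = (\<integral>\<^sup>+x. ennreal (1 / sqrt (h x)) * indicator {Re p..Re q} x \<partial>lborel)"
    unfolding emeasure_hyp_area[OF sets_above_chord] inner ..
  also have "\<dots> = ennreal (\<Phi> (Re q) - \<Phi> (Re p))"
  proof (rule nn_integral_FTC_Icc)
    show "(\<lambda>x. 1 / sqrt (h x)) \<in> borel_measurable borel"
      unfolding h_def by measurable
    fix x assume "x \<in> {Re p..Re q}"
    then have hx: "h x > 0" by (rule hpos)
    define y where "y = sqrt (h x)"
    have y: "y > 0" "y\<^sup>2 = h x" using hx by (auto simp: y_def)
    have dh: "(h has_real_derivative s - 2 * x) (at x)"
      unfolding h_def by (auto intro!: derivative_eq_intros)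
    define N D where "N = x - Re p" and "D = Im p + y"
    have D: "D > 0" using p y by (simp add: D_def)
    \<comment> \<open>Both \<open>p\<close> and the point at height \<open>y\<close> over
      \<open>x\<close> lie on the circle centred at s/2; this relation makes the derivative of
      \<Phi> collapse to 1 / y.\<close>
    have eq: "D\<^sup>2 + N\<^sup>2 = 2 * y * D - N * (s - 2 * x)"
    proof -
      have "y * y = Re p * Re p + Im p * Im p + s * (x - Re p) - x * x"
        using y(2) unfolding h_def cmod_power2 by (simp add: power2_eq_square)
      then show ?thesis unfolding D_def N_def by (simp add: power2_eq_square algebra_simps)
    qed
    have ne: "D\<^sup>2 + N\<^sup>2 > 0" using D by (simp add: add_pos_nonneg)
    have D': "D = Im p + sqrt (h x)" by (simp add: D_def y_def)
    with D have nz: "Im p + sqrt (h x) \<noteq> 0" by simp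
    have dN: "((\<lambda>x. x - Re p) has_real_derivative 1) (at x)"
      by (auto intro!: derivative_eq_intros)
    have "((\<lambda>x. sqrt (h x)) has_real_derivative inverse y / 2 * (s - 2 * x)) (at x)"
      using DERIV_chain2[OF DERIV_real_sqrt[OF hx] dh] by (simp add: y_def)
    then have dD: "((\<lambda>x. Im p + sqrt (h x)) has_real_derivative (s - 2 * x) * (inverse y / 2)) (at x)"
      using DERIV_add[OF DERIV_const] by (fastforce simp: mult.commute)
    have "((\<lambda>x. (x - Re p) / (Im p + sqrt (h x))) has_real_derivative
        (1 * D - N * ((s - 2 * x) * (inverse y / 2))) / (D * D)) (at x)"
      by (rule DERIV_cong[OF DERIV_divide[OF dN dD nz]]) (simp only: D_def N_def y_def)
    note 1 = DERIV_cmult[OF DERIV_chain2[where f = arctan, OF DERIV_arctan this], of 2, folded D' N_def]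
    have "(\<Phi> has_real_derivative 2 * ((1 * D - N * ((s - 2 * x) * (inverse y / 2))) / (D * D) / (1 + (N / D)\<^sup>2))) (at x)"
      unfolding \<Phi>_def by (rule DERIV_cong[OF 1]) (simp only: divide_inverse mult_ac)
    moreover have "2 * ((1 * D - N * ((s - 2 * x) * (inverse y / 2))) / (D * D) / (1 + (N / D)\<^sup>2)) = 1 / y"
    proof -
      have "2 * (1 * D - N * ((s - 2 * x) * (inverse y / 2))) = (D\<^sup>2 + N\<^sup>2) / y"
        unfolding eq using y by (simp add: field_simps)
      moreover have "D * D * (1 + (N / D)\<^sup>2) = D\<^sup>2 + N\<^sup>2"
        using D by (simp add: field_simps power2_eq_square)
      ultimately have "2 * ((1 * D - N * ((s - 2 * x) * (inverse y / 2))) / (D * D) / (1 + (N / D)\<^sup>2))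
          = (D\<^sup>2 + N\<^sup>2) / y / (D\<^sup>2 + N\<^sup>2)"
        by (metis divide_divide_eq_left times_divide_eq_right)
      then show ?thesis using D by simp
    qed
    ultimately show "(\<Phi> has_real_derivative 1 / sqrt (h x)) (at x)" by (simp add: y_def)
    show "0 \<le> 1 / sqrt (h x)" using hx by simp
  qed (use lt in auto)
  also have "\<Phi> (Re q) - \<Phi> (Re p) = chord_angle p q"
    using q by (simp add: \<Phi>_def hq chord_angle_def)
  finally show ?thesis .
qed


section \<open>Barycentric coordinates and the area of a triangle\<close>

lemma turn_cycle: "turn B C A = turn A B C"
  by (simp add: turn_def algebra_simps)

lemma turn_swap: "turn B A C = - turn A B C"
  by (simp add: turn_def algebra_simps)

lemma turn_degenerate [simp]: "turn A B A = 0" "turn A B B = 0" "turn A A B = 0"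
  by (simp_all add: turn_def)

lemma turn_affine:
  assumes "u + v = 1"
  shows "turn A B (u *\<^sub>R P + v *\<^sub>R Q) = u * turn A B P + v * turn A B Q"
proof -
  have u: "u = 1 - v" using assms by simp
  show ?thesis unfolding u turn_def by (simp add: algebra_simps)
qed

lemma turn_sum: "turn A B P + turn B C P + turn C A P = turn A B C"
  by (simp add: turn_def algebra_simps)

text \<open>Cramer's rule: the three turns are the unnormalized barycentric coordinates of
  \<open>P\<close>.\<close>

lemma turn_barycentric:
  "turn B C P * Re A + turn C A P * Re B + turn A B P * Re C = turn A B C * Re P"
  "turn B C P * Im A + turn C A P * Im B + turn A B P * Im C = turn A B C * Im P"
  unfolding turn_def by algebra+

lemma in_triangle_iff:
  assumes D: "turn A B C > 0"
  shows "P \<in> convex hull {A, B, C} \<longleftrightarrow> turn A B P \<ge> 0 \<and> turn B C P \<ge> 0 \<and> turn C A P \<ge> 0"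
proof
  assume "P \<in> convex hull {A, B, C}"
  then obtain u v w where uvw: "0 \<le> u" "0 \<le> v" "0 \<le> w" "u + v + w = 1"
    "P = u *\<^sub>R A + v *\<^sub>R B + w *\<^sub>R C"
    by (auto simp: convex_hull_3)
  have u: "u = 1 - v - w" using uvw by simp
  have "turn A B P = w * turn A B C" "turn B C P = u * turn A B C" "turn C A P = v * turn A B C"
    unfolding uvw(5) u turn_def by (simp_all, algebra+)
  then show "turn A B P \<ge> 0 \<and> turn B C P \<ge> 0 \<and> turn C A P \<ge> 0"
    using uvw D by simp
next
  assume P: "turn A B P \<ge> 0 \<and> turn B C P \<ge> 0 \<and> turn C A P \<ge> 0"
  let ?D = "turn A B C"
  have "P = (turn B C P / ?D) *\<^sub>R A + (turn C A P / ?D) *\<^sub>R B + (turn A B P / ?D) *\<^sub>R C"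
    using D turn_barycentric[of B C P A] by (simp add: complex_eq_iff field_simps)
  moreover have "turn B C P / ?D + turn C A P / ?D + turn A B P / ?D = 1"
    using D turn_sum[of A B P C] by (simp add: field_simps)
  ultimately show "P \<in> convex hull {A, B, C}"
    using P D unfolding convex_hull_3
    by (intro CollectI exI[of _ "turn B C P / ?D"] exI[of _ "turn C A P / ?D"] exI[of _ "turn A B P / ?D"]) auto
qed

lemma AE_turn_nonzero:
  assumes "A \<noteq> B"
  shows "AE z in hyp_area. turn A B (klein z) \<noteq> 0"
proof -
  have "Im A - Im B \<noteq> 0 \<or> Re B - Re A \<noteq> 0"
    using assms by (auto simp: complex_eq_iff)
  from AE_hyp_area_line[OF this, of "Re A * (Im B - Im A) - Im A * (Re B - Re A)"]
  show ?thesis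
    by (auto simp: turn_def klein_def algebra_simps elim!: eventually_mono)
qed

text \<open>For subsets of the half-plane this is the hyperbolic convex hull, by
  \<open>hyp_convex_hull_klein\<close>; in this form measurability and cutting are
  Euclidean.\<close>

definition hyp_hull :: "complex set \<Rightarrow> complex set" where
  "hyp_hull S = {z. Im z > 0 \<and> klein z \<in> convex hull (klein ` S)}"

lemma continuous_klein: "continuous_on A klein"
  unfolding klein_def Complex_eq by (intro continuous_intros)

lemma sets_hyp_hull [measurable]:
  assumes "finite S"
  shows "hyp_hull S \<in> sets borel"
proof -
  have "closed (klein -` (convex hull (klein ` S)))"
    using assms continuous_klein
    by (intro closed_vimage compact_imp_closed finite_imp_compact_convex_hull) auto
  moreover have "hyp_hull S = {z. Im z > 0} \<inter> klein -` (convex hull (klein ` S))"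
    by (auto simp: hyp_hull_def)
  ultimately show ?thesis
    by (auto intro!: sets.Int borel_closed borel_open open_halfspace_Im_gt)
qed

text \<open>With \<open>P, Q, R\<close> the signed horizontal offsets of the vertices of a triangle from a point and
  \<open>a, b, c\<close> the barycentric weights of that point, the two lemmas count the regions above the sides
  that contain the point.\<close>

lemma count_above_sides_lower:
  fixes a b c P Q R :: real
  assumes "a + b + c > 0" and sum: "b * P + c * Q + a * R = 0"
    and nz: "a \<noteq> 0" "b \<noteq> 0" "c \<noteq> 0" "P \<noteq> 0" "Q \<noteq> 0" "R \<noteq> 0" and "P \<le> Q" "Q \<le> R"
  shows "of_bool (a > 0 \<and> b > 0 \<and> c > 0) + of_bool (P \<le> 0 \<and> 0 \<le> R \<and> c < 0) =
    (of_bool (P \<le> 0 \<and> 0 \<le> Q \<and> a > 0) + of_bool (Q \<le> 0 \<and> 0 \<le> R \<and> b > 0) :: nat)"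
proof -
  \<comment> \<open>Only the signs of the three products matter: they sum to zero, so they cannot
    all agree.\<close>
  define k l m where klm: "k = b * P" "l = c * Q" "m = a * R"
  have "k > 0 \<longleftrightarrow> (b > 0 \<longleftrightarrow> P > 0)" "l > 0 \<longleftrightarrow> (c > 0 \<longleftrightarrow> Q > 0)" "m > 0 \<longleftrightarrow> (a > 0 \<longleftrightarrow> R > 0)"
    "k \<noteq> 0" "l \<noteq> 0" "m \<noteq> 0" "k + l + m = 0"
    using nz sum by (auto simp: zero_less_mult_iff klm)
  with assms(1,3-) show ?thesis
    unfolding of_nat_eq_iff[where 'a = int, symmetric] of_nat_add of_nat_of_bool of_bool_def
    by (smt (verit))
qed

lemma count_above_sides_upper:
  fixes a b c P Q R :: real
  assumes "a + b + c > 0" and sum: "b * P + c * Q + a * R = 0"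
    and nz: "a \<noteq> 0" "b \<noteq> 0" "c \<noteq> 0" "P \<noteq> 0" "Q \<noteq> 0" "R \<noteq> 0" and "P \<le> R" "R \<le> Q"
  shows "of_bool (a > 0 \<and> b > 0 \<and> c > 0) + of_bool (P \<le> 0 \<and> 0 \<le> R \<and> c < 0) +
    of_bool (R \<le> 0 \<and> 0 \<le> Q \<and> b < 0) = (of_bool (P \<le> 0 \<and> 0 \<le> Q \<and> a > 0) :: nat)"
proof -
  define k l m where klm: "k = b * P" "l = c * Q" "m = a * R"
  have "k > 0 \<longleftrightarrow> (b > 0 \<longleftrightarrow> P > 0)" "l > 0 \<longleftrightarrow> (c > 0 \<longleftrightarrow> Q > 0)" "m > 0 \<longleftrightarrow> (a > 0 \<longleftrightarrow> R > 0)"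
    "k \<noteq> 0" "l \<noteq> 0" "m \<noteq> 0" "k + l + m = 0"
    using nz sum by (auto simp: zero_less_mult_iff klm)
  note facts = this assms(1,3-)
  consider "P > 0" | "P < 0" "R > 0" | "R < 0" "Q > 0" | "Q < 0"
    using nz by linarith
  then show ?thesis
  proof cases
    case 1
    then have "R > 0" "Q > 0" using facts by auto
    with 1 have "\<not> (a > 0 \<and> b > 0 \<and> c > 0)" using facts by auto
    with 1 \<open>R > 0\<close> show ?thesis by simp
  next
    case 2
    then have "Q > 0" using facts by auto
    have "a > 0 \<and> b > 0 \<and> c > 0 \<or> c < 0 \<longleftrightarrow> a > 0"
      using facts 2 \<open>Q > 0\<close> by (smt (verit))
    with 2 \<open>Q > 0\<close> show ?thesis by auto
  next
    case 3
    then have "P < 0" using facts by auto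
    have "a > 0 \<and> b > 0 \<and> c > 0 \<or> b < 0 \<longleftrightarrow> a > 0"
      using facts 3 \<open>P < 0\<close> by (smt (verit))
    with 3 \<open>P < 0\<close> show ?thesis by auto
  next
    case 4
    then have "R < 0" "P < 0" using facts by auto
    with 4 have "\<not> (a > 0 \<and> b > 0 \<and> c > 0)" using facts by auto
    with 4 \<open>R < 0\<close> show ?thesis by simp
  qed
qed

lemma indicator_of_bool: "indicator S z = (of_nat (of_bool (z \<in> S)) :: ennreal)"
  by (auto split: split_indicator)

text \<open>Off the null set formed by the lines through the sides and the verticals through the
  vertices no quantity vanishes, so weak and strict inequalities agree. The existential names the
  turns so that the counting lemmas apply to them.\<close>

lemma AE_triangle:
  assumes "turn (klein p) (klein q) (klein r) > 0"
  shows "AE z in hyp_area. \<exists>a b c. a = turn (klein p) (klein q) (klein z) \<and> b = turn (klein q) (klein r) (klein z) \<and>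
    c = turn (klein r) (klein p) (klein z) \<and> a + b + c > 0 \<and>
    b * (Re p - Re z) + c * (Re q - Re z) + a * (Re r - Re z) = 0 \<and>
    a \<noteq> 0 \<and> b \<noteq> 0 \<and> c \<noteq> 0 \<and> Re p - Re z \<noteq> 0 \<and> Re q - Re z \<noteq> 0 \<and> Re r - Re z \<noteq> 0 \<and>
    (z \<in> hyp_hull {p, q, r} \<longleftrightarrow> a > 0 \<and> b > 0 \<and> c > 0)"
proof -
  have ne: "klein p \<noteq> klein q" "klein q \<noteq> klein r" "klein r \<noteq> klein p"
    using assms by (auto simp: turn_def)
  show ?thesis
    using AE_turn_nonzero[OF ne(1)] AE_turn_nonzero[OF ne(2)] AE_turn_nonzero[OF ne(3)]
      AE_Re_neq[of "Re p"] AE_Re_neq[of "Re q"] AE_Re_neq[of "Re r"]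
      AE_hyp_area_pos
  proof eventually_elim
    case (elim z)
    have sum: "turn (klein p) (klein q) (klein z) + turn (klein q) (klein r) (klein z) +
        turn (klein r) (klein p) (klein z) = turn (klein p) (klein q) (klein r)"
      by (rule turn_sum)
    have bary: "turn (klein q) (klein r) (klein z) * (Re p - Re z) +
        turn (klein r) (klein p) (klein z) * (Re q - Re z) +
        turn (klein p) (klein q) (klein z) * (Re r - Re z) = 0"
      using turn_barycentric(1)[of "klein q" "klein r" "klein z" "klein p"]
      unfolding sum[symmetric] by (simp add: klein_def algebra_simps)
    have hull: "z \<in> hyp_hull {p, q, r} \<longleftrightarrow> turn (klein p) (klein q) (klein z) \<ge> 0 \<and>
        turn (klein q) (klein r) (klein z) \<ge> 0 \<and> turn (klein r) (klein p) (klein z) \<ge> 0"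
      using elim by (simp add: hyp_hull_def in_triangle_iff[OF assms])
    have *: "\<exists>a' b' c'. a' = a \<and> b' = b \<and> c' = c \<and> a' + b' + c' > 0 \<and> b' * x + c' * y + a' * w = 0 \<and>
        a' \<noteq> 0 \<and> b' \<noteq> 0 \<and> c' \<noteq> 0 \<and> x \<noteq> 0 \<and> y \<noteq> 0 \<and> w \<noteq> 0 \<and> (P \<longleftrightarrow> a' > 0 \<and> b' > 0 \<and> c' > 0)"
      if "a + b + c = D" "D > 0" "b * x + c * y + a * w = 0" "a \<noteq> 0" "b \<noteq> 0" "c \<noteq> 0" "x \<noteq> 0" "y \<noteq> 0" "w \<noteq> 0"
        "P \<longleftrightarrow> a \<ge> 0 \<and> b \<ge> 0 \<and> c \<ge> 0" for a b c x y w D :: real and P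
      using that by (simp add: less_le)
    show ?case
      by (rule *[OF sum assms bary _ _ _ _ _ _ hull]) (use elim in auto)
  qed
qed

text \<open>Stated as an equation of sums because finiteness of the measures is not yet known and
  differences would be unreliable in \<open>ennreal\<close>.\<close>

lemma emeasure_eq_via_counts:
  assumes "AE z in M. of_bool (z \<in> A) + of_bool (z \<in> B) = (of_bool (z \<in> C) + of_bool (z \<in> D) :: nat)"
    and [measurable]: "A \<in> sets M" "B \<in> sets M" "C \<in> sets M" "D \<in> sets M"
  shows "emeasure M A + emeasure M B = emeasure M C + emeasure M D"
proof -
  have "(\<integral>\<^sup>+z. indicator A z + indicator B z \<partial>M) = (\<integral>\<^sup>+z. indicator C z + indicator D z \<partial>M)"
    using assms(1) unfolding indicator_of_bool of_nat_add[symmetric]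
    by (intro nn_integral_cong_AE, elim eventually_mono) simp
  then show ?thesis by (simp add: nn_integral_add)
qed

lemma emeasure_eq_via_counts3:
  assumes "AE z in M. of_bool (z \<in> A) + of_bool (z \<in> B) + of_bool (z \<in> C) = (of_bool (z \<in> D) :: nat)"
    and [measurable]: "A \<in> sets M" "B \<in> sets M" "C \<in> sets M" "D \<in> sets M"
  shows "emeasure M A + emeasure M B + emeasure M C = emeasure M D"
proof -
  have "(\<integral>\<^sup>+z. indicator A z + indicator B z + indicator C z \<partial>M) = (\<integral>\<^sup>+z. indicator D z \<partial>M)"
    using assms(1) unfolding indicator_of_bool of_nat_add[symmetric]
    by (intro nn_integral_cong_AE, elim eventually_mono) simp
  then show ?thesis by (simp add: nn_integral_add)
qed

lemma chord_angle_swap: "chord_angle q p = - chord_angle p q"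
proof -
  have "(Re p - Re q) / (Im q + Im p) = - ((Re q - Re p) / (Im p + Im q))"
    by (simp add: add.commute minus_divide_left)
  then show ?thesis by (simp only: chord_angle_def arctan_minus)
qed

lemma chord_angle_nonneg:
  assumes "Im p > 0" "Im q > 0" "Re p \<le> Re q"
  shows "chord_angle p q \<ge> 0"
  using assms by (simp add: chord_angle_def)

definition triangle_angle :: "complex \<Rightarrow> complex \<Rightarrow> complex \<Rightarrow> real" where
  "triangle_angle p q r = chord_angle p q + chord_angle q r + chord_angle r p"

text \<open>The triangle is counterclockwise and \<open>p\<close> is leftmost. If \<open>q\<close>
  comes next, it lies below the chord from \<open>p\<close> to \<open>r\<close>; otherwise
  \<open>r\<close> lies above the chord from \<open>p\<close> to \<open>q\<close>. Either way the
  triangle is the region above its lower boundary minus the region above its upper boundary.\<close>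

lemma measure_hyp_triangle_leftmost:
  assumes pos: "Im p > 0" "Im q > 0" "Im r > 0"
    and D: "turn (klein p) (klein q) (klein r) > 0" and le: "Re p \<le> Re q" "Re p \<le> Re r"
  shows "emeasure hyp_area (hyp_hull {p, q, r}) \<noteq> \<infinity> \<and>
    measure hyp_area (hyp_hull {p, q, r}) = triangle_angle p q r"
proof (cases "Re q \<le> Re r")
  case True
  have "emeasure hyp_area (hyp_hull {p, q, r}) + emeasure hyp_area (above_chord p r) =
      emeasure hyp_area (above_chord p q) + emeasure hyp_area (above_chord q r)"
  proof (rule emeasure_eq_via_counts)
    show "AE z in hyp_area. of_bool (z \<in> hyp_hull {p, q, r}) + of_bool (z \<in> above_chord p r) =
        (of_bool (z \<in> above_chord p q) + of_bool (z \<in> above_chord q r) :: nat)"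
      using AE_triangle[OF D]
    proof eventually_elim
      case (elim z)
      then obtain a b c where abc: "a = turn (klein p) (klein q) (klein z)" "b = turn (klein q) (klein r) (klein z)"
        "c = turn (klein r) (klein p) (klein z)" and *: "a + b + c > 0"
        "b * (Re p - Re z) + c * (Re q - Re z) + a * (Re r - Re z) = 0"
        "a \<noteq> 0" "b \<noteq> 0" "c \<noteq> 0" "Re p - Re z \<noteq> 0" "Re q - Re z \<noteq> 0" "Re r - Re z \<noteq> 0"
        and hull: "z \<in> hyp_hull {p, q, r} \<longleftrightarrow> a > 0 \<and> b > 0 \<and> c > 0" by blast
      show ?case
        using count_above_sides_lower[OF *] le True
        unfolding hull above_chord_def mem_Collect_eq abc(1,2)[symmetric]
          turn_swap[of "klein p" "klein r"] abc(3)[symmetric] by simp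
    qed
  qed auto
  then have "emeasure hyp_area (hyp_hull {p, q, r}) + ennreal (chord_angle p r) =
      ennreal (chord_angle p q + chord_angle q r)"
    using pos le True by (simp add: emeasure_above_chord chord_angle_nonneg)
  \<comment> \<open>Finiteness is read off the equation, whose right side is finite.\<close>
  moreover have "emeasure hyp_area (hyp_hull {p, q, r}) \<noteq> \<infinity>"
    using calculation by (metis ennreal_add_eq_top ennreal_neq_top infinity_ennreal_def)
  ultimately have "measure hyp_area (hyp_hull {p, q, r}) + chord_angle p r = chord_angle p q + chord_angle q r"
    using pos le True
    by (simp add: emeasure_eq_ennreal_measure chord_angle_nonneg flip: ennreal_plus)
  then show ?thesis
    using \<open>emeasure hyp_area (hyp_hull {p, q, r}) \<noteq> \<infinity>\<close> chord_angle_swap[of r p]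
    by (simp add: triangle_angle_def)
next
  case False
  then have le': "Re r \<le> Re q" by simp
  have "emeasure hyp_area (hyp_hull {p, q, r}) + emeasure hyp_area (above_chord p r) +
      emeasure hyp_area (above_chord r q) = emeasure hyp_area (above_chord p q)"
  proof (rule emeasure_eq_via_counts3)
    show "AE z in hyp_area. of_bool (z \<in> hyp_hull {p, q, r}) + of_bool (z \<in> above_chord p r) +
        of_bool (z \<in> above_chord r q) = (of_bool (z \<in> above_chord p q) :: nat)"
      using AE_triangle[OF D]
    proof eventually_elim
      case (elim z)
      then obtain a b c where abc: "a = turn (klein p) (klein q) (klein z)" "b = turn (klein q) (klein r) (klein z)"
        "c = turn (klein r) (klein p) (klein z)" and *: "a + b + c > 0"
        "b * (Re p - Re z) + c * (Re q - Re z) + a * (Re r - Re z) = 0"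
        "a \<noteq> 0" "b \<noteq> 0" "c \<noteq> 0" "Re p - Re z \<noteq> 0" "Re q - Re z \<noteq> 0" "Re r - Re z \<noteq> 0"
        and hull: "z \<in> hyp_hull {p, q, r} \<longleftrightarrow> a > 0 \<and> b > 0 \<and> c > 0" by blast
      show ?case
        using count_above_sides_upper[OF *] le le'
        unfolding hull above_chord_def mem_Collect_eq abc(1)[symmetric]
          turn_swap[of "klein p" "klein r"] turn_swap[of "klein r" "klein q"] abc(2,3)[symmetric] by simp
    qed
  qed auto
  then have "emeasure hyp_area (hyp_hull {p, q, r}) + ennreal (chord_angle p r + chord_angle r q) =
      ennreal (chord_angle p q)"
    using pos le le' by (simp add: emeasure_above_chord chord_angle_nonneg add.assoc)
  moreover have "emeasure hyp_area (hyp_hull {p, q, r}) \<noteq> \<infinity>"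
    using calculation by (metis ennreal_add_eq_top ennreal_neq_top infinity_ennreal_def)
  ultimately have "measure hyp_area (hyp_hull {p, q, r}) + (chord_angle p r + chord_angle r q) = chord_angle p q"
    using pos le le'
    by (simp add: emeasure_eq_ennreal_measure chord_angle_nonneg flip: ennreal_plus)
  then show ?thesis
    using \<open>emeasure hyp_area (hyp_hull {p, q, r}) \<noteq> \<infinity>\<close> chord_angle_swap[of r p] chord_angle_swap[of r q]
    by (simp add: triangle_angle_def)
qed

lemma measure_hyp_triangle:
  assumes pos: "Im p > 0" "Im q > 0" "Im r > 0" and D: "turn (klein p) (klein q) (klein r) > 0"
  shows "emeasure hyp_area (hyp_hull {p, q, r}) \<noteq> \<infinity> \<and>
    measure hyp_area (hyp_hull {p, q, r}) = triangle_angle p q r"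
proof -
  have sets: "{q, r, p} = {p, q, r}" "{r, p, q} = {p, q, r}" by auto
  have angle: "triangle_angle q r p = triangle_angle p q r" "triangle_angle r p q = triangle_angle p q r"
    by (simp_all add: triangle_angle_def)
  have D': "turn (klein q) (klein r) (klein p) > 0" "turn (klein r) (klein p) (klein q) > 0"
    using D by (metis turn_cycle)+
  consider "Re p \<le> Re q \<and> Re p \<le> Re r" | "Re q \<le> Re r \<and> Re q \<le> Re p" | "Re r \<le> Re p \<and> Re r \<le> Re q"
    by linarith
  then show ?thesis
    using measure_hyp_triangle_leftmost[of p q r] measure_hyp_triangle_leftmost[of q r p]
      measure_hyp_triangle_leftmost[of r p q] pos D D' unfolding sets angle by cases auto
qed

section \<open>Moebius maps and areas of polygons\<close>

text \<open>The determinant is only required to be positive and is not normalized to 1, so that maps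
  can be given by explicit coefficients.\<close>

definition mobius_map :: "real \<Rightarrow> real \<Rightarrow> real \<Rightarrow> real \<Rightarrow> complex \<Rightarrow> complex" where
  "mobius_map a b c d z = (of_real a * z + of_real b) / (of_real c * z + of_real d)"

lemma mobius_map_denom_nonzero:
  assumes "a * d - b * c > 0" "Im z \<noteq> 0"
  shows "of_real c * z + of_real d \<noteq> (0::complex)"
  using assms by (cases "c = 0") (auto simp: complex_eq_iff)

text \<open>The hypotheses admit negative imaginary parts so that the identity also applies to
  conjugates; with w = cnj z it yields \<open>Im_mobius_map\<close>.\<close>

lemma mobius_map_diff:
  assumes "a * d - b * c > 0" "Im z \<noteq> 0" "Im w \<noteq> 0"
  shows "mobius_map a b c d z - mobius_map a b c d w =
    of_real (a * d - b * c) * (z - w) / ((of_real c * z + of_real d) * (of_real c * w + of_real d))"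
proof -
  note nz = mobius_map_denom_nonzero[OF assms(1)]
  show ?thesis
    unfolding mobius_map_def diff_frac_eq[OF nz[OF assms(2)] nz[OF assms(3)]]
    by (simp add: algebra_simps)
qed

lemma mobius_map_cnj: "mobius_map a b c d (cnj z) = cnj (mobius_map a b c d z)"
  by (simp add: mobius_map_def)

lemma Im_mobius_map:
  assumes "a * d - b * c > 0" "Im z > 0"
  shows "Im (mobius_map a b c d z) = (a * d - b * c) * Im z / (cmod (of_real c * z + of_real d))\<^sup>2"
proof -
  let ?D = "of_real c * z + of_real d"
  have "?D * (of_real c * cnj z + of_real d) = of_real ((cmod ?D)\<^sup>2)"
    by (subst complex_norm_square) simp
  moreover have "mobius_map a b c d z - cnj (mobius_map a b c d z) =
      of_real (a * d - b * c) * (z - cnj z) / (?D * (of_real c * cnj z + of_real d))"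
    unfolding mobius_map_cnj[symmetric] using assms by (intro mobius_map_diff) auto
  ultimately have "of_real (2 * Im (mobius_map a b c d z)) * \<i> =
      of_real ((a * d - b * c) * (2 * Im z) / (cmod ?D)\<^sup>2) * \<i>"
    unfolding complex_diff_cnj by simp
  then have "2 * Im (mobius_map a b c d z) = (a * d - b * c) * (2 * Im z) / (cmod ?D)\<^sup>2"
    by (simp only: mult_right_cancel[OF complex_i_not_zero] of_real_eq_iff)
  then have "2 * Im (mobius_map a b c d z) = 2 * ((a * d - b * c) * Im z / (cmod ?D)\<^sup>2)"
    by (simp only: mult.left_commute[of _ 2] times_divide_eq_right)
  then show ?thesis by (simp only: mult_cancel_left) simp
qed

lemma Im_mobius_map_pos:
  assumes "a * d - b * c > 0" "Im z > 0"
  shows "Im (mobius_map a b c d z) > 0"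
  using assms mobius_map_denom_nonzero[OF assms(1), of z] by (simp add: Im_mobius_map)

lemma hyp_dist_mobius_map:
  assumes "a * d - b * c > 0" "Im z > 0" "Im w > 0"
  shows "hyp_dist (mobius_map a b c d z) (mobius_map a b c d w) = hyp_dist z w"
proof -
  define A B \<Delta> where "A = cmod (of_real c * z + of_real d)" and "B = cmod (of_real c * w + of_real d)"
    and "\<Delta> = a * d - b * c"
  have pos: "A > 0" "B > 0" "\<Delta> > 0"
    using assms mobius_map_denom_nonzero[OF assms(1)] by (auto simp: A_def B_def \<Delta>_def)
  have "cmod (mobius_map a b c d z - mobius_map a b c d w) = \<Delta> * cmod (z - w) / (A * B)"
    using assms pos by (simp add: mobius_map_diff norm_divide norm_mult A_def B_def flip: \<Delta>_def)
  moreover have "Im (mobius_map a b c d z) = \<Delta> * Im z / A\<^sup>2" "Im (mobius_map a b c d w) = \<Delta> * Im w / B\<^sup>2"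
    using assms by (simp_all add: Im_mobius_map A_def B_def \<Delta>_def)
  moreover have "(\<Delta> * X / (A * B))\<^sup>2 / (2 * (\<Delta> * y / A\<^sup>2) * (\<Delta> * v / B\<^sup>2)) = X\<^sup>2 / (2 * y * v)"
    if "y > 0" "v > 0" for X y v
    using that pos by (simp add: field_simps power2_eq_square)
  ultimately show ?thesis
    unfolding hyp_dist_def using assms by simp
qed

lemma continuous_on_mobius_map:
  assumes "a * d - b * c > 0"
  shows "continuous_on hyp_plane (mobius_map a b c d)"
  unfolding mobius_map_def using assms mobius_map_denom_nonzero[OF assms]
  by (intro continuous_intros) auto

text \<open>The argument has real part Im p + Im q and imaginary part Re q - Re p. In this form the
  difference cnj q - p is transformed by \<open>mobius_map_diff\<close>.\<close>

lemma chord_angle_eq_Arg: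
  assumes "Im p > 0" "Im q > 0"
  shows "chord_angle p q = 2 * Arg (\<i> * (cnj q - p))"
  using assms by (simp add: chord_angle_def arg_conv_arctan add.commute)

text \<open>Each vertex of a closed polygon contributes the argument of its denominator once with each
  sign, so the signed area \<open>chord_angle p q + chord_angle q r + \<dots>\<close> is invariant.\<close>

lemma chord_angle_mobius_map:
  assumes \<Delta>: "a * d - b * c > 0" and pos: "Im p > 0" "Im q > 0"
  shows "chord_angle (mobius_map a b c d p) (mobius_map a b c d q) =
    chord_angle p q + 2 * (Arg (of_real c * q + of_real d) - Arg (of_real c * p + of_real d))"
proof -
  define M where "M = mobius_map a b c d"
  define D where "D = (\<lambda>z. of_real c * z + of_real d :: complex)"
  define W where "W = \<i> * (cnj q - p)"
  define W' where "W' = \<i> * (cnj (M q) - M p)"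
  have D0: "D p \<noteq> 0" "D q \<noteq> 0"
    using mobius_map_denom_nonzero[OF \<Delta>] pos by (auto simp: D_def)
  have "Re W > 0" using pos by (simp add: W_def)
  have "Re W' > 0"
    using add_pos_pos[OF Im_mobius_map_pos[OF \<Delta> pos(1)] Im_mobius_map_pos[OF \<Delta> pos(2)]]
    by (simp add: W'_def M_def)
  have "cnj (M q) - M p = of_real (a * d - b * c) * (cnj q - p) / (D (cnj q) * D p)"
    unfolding M_def D_def mobius_map_cnj[symmetric] using assms by (intro mobius_map_diff) auto
  moreover have "D (cnj q) = cnj (D q)" by (simp add: D_def)
  ultimately have "W' = of_real (a * d - b * c) * W / (cnj (D q) * D p)"
    by (simp add: W_def W'_def)
  then have eq: "W' * (cnj (D q) * D p) = of_real (a * d - b * c) * W"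
    using D0 by simp
  have "sgn W' * (cnj (sgn (D q)) * sgn (D p)) = sgn W"
  proof -
    have "sgn (W' * (cnj (D q) * D p)) = sgn W"
      unfolding eq sgn_mult using \<Delta> by (simp add: sgn_of_real del: of_real_diff of_real_mult)
    moreover have "cnj (sgn (D q)) = sgn (cnj (D q))" by (simp add: sgn_eq)
    ultimately show ?thesis by (simp only: sgn_mult)
  qed
  moreover have "W \<noteq> 0" "W' \<noteq> 0" using \<open>Re W > 0\<close> \<open>Re W' > 0\<close> by auto
  ultimately have "cis (Arg W') * (cnj (cis (Arg (D q))) * cis (Arg (D p))) = cis (Arg W)"
    using D0 cis_Arg[of W] cis_Arg[of W'] cis_Arg[of "D p"] cis_Arg[of "D q"] by metis
  then have "cis (Arg W' + Arg (D p) - Arg (D q)) = cis (Arg W)"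
    by (simp add: cis_cnj cis_mult add_diff_eq)
  then have "\<exists>n::int. Arg W' + Arg (D p) - Arg (D q) = Arg W + 2 * pi * n"
    using sin_cos_eq_iff[of "Arg W' + Arg (D p) - Arg (D q)" "Arg W"] by (simp add: complex_eq_iff)
  then obtain n :: int where n: "Arg W' + Arg (D p) - Arg (D q) = Arg W + 2 * pi * n" ..
  \<comment> \<open>So far the equation holds modulo 2 pi; these bounds and the next one leave only
    n = 0.\<close>
  have bound: "\<bar>Arg W\<bar> < pi / 2" "\<bar>Arg W'\<bar> < pi / 2"
    using \<open>Re W > 0\<close> \<open>Re W' > 0\<close> arctan_bounded[of "Im W / Re W"] arctan_bounded[of "Im W' / Re W'"]
    unfolding arg_conv_arctan[OF \<open>Re W > 0\<close>] arg_conv_arctan[OF \<open>Re W' > 0\<close>] by linarith+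
  \<comment> \<open>Both denominators lie strictly on the same side of the real axis, given by the
    sign of \<open>c\<close>, or coincide when c = 0.\<close>
  have "\<bar>Arg (D p) - Arg (D q)\<bar> < pi"
  proof -
    have Im: "Im (D p) = c * Im p" "Im (D q) = c * Im q" by (auto simp: D_def)
    consider "c > 0" | "c = 0" | "c < 0" by linarith
    then show ?thesis
    proof cases
      case 1
      then have "0 < Arg (D p)" "Arg (D p) < pi" "0 < Arg (D q)" "Arg (D q) < pi"
        using Arg_lt_pi[of "D p"] Arg_lt_pi[of "D q"] Im pos by (auto simp: D_def)
      then show ?thesis by linarith
    next
      case 2
      then show ?thesis by (simp add: D_def)
    next
      case 3
      then have "Arg (D p) < 0" "Arg (D q) < 0"
        using Arg_neg_iff[of "D p"] Arg_neg_iff[of "D q"] Im pos by (auto simp: mult_neg_pos)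
      then show ?thesis using mpi_less_Arg[of "D p"] mpi_less_Arg[of "D q"] by linarith
    qed
  qed
  then have "\<bar>2 * pi * n\<bar> < 2 * pi" using n bound by linarith
  then have "\<bar>real_of_int n\<bar> < 1" by (simp add: abs_mult)
  then have "n = 0" by linarith
  then show ?thesis
    using n pos Im_mobius_map_pos[OF \<Delta>] 
    by (simp add: chord_angle_eq_Arg flip: M_def D_def W_def W'_def)
      (simp add: D_def)
qed

text \<open>A Moebius map acts projectively on the coordinates (1, X, Y). Its matrix, with rows
  \<open>N\<close>, \<open>R\<close>, \<open>S\<close>, is the symmetric square of the coefficient
  matrix and has determinant (ad - bc)^3; the values of \<open>N\<close> at the three points are the
  positive denominators.\<close>

lemma turn_mobius_map:
  assumes \<Delta>: "a * d - b * c > 0" and pos: "Im p > 0" "Im q > 0" "Im r > 0"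
  shows "\<exists>k>0. turn (klein (mobius_map a b c d p)) (klein (mobius_map a b c d q)) (klein (mobius_map a b c d r)) =
    k * turn (klein p) (klein q) (klein r)"
proof -
  define N where "N = (\<lambda>X Y. c\<^sup>2 * Y + 2 * c * d * X + d\<^sup>2)"
  define R where "R = (\<lambda>X Y. a * c * Y + (a * d + b * c) * X + b * d)"
  define S where "S = (\<lambda>X Y. a\<^sup>2 * Y + 2 * a * b * X + b\<^sup>2)"
  have N: "(cmod (of_real c * z + of_real d))\<^sup>2 = N (Re z) ((cmod z)\<^sup>2)" for z
    unfolding cmod_power2 N_def by (simp add: power2_eq_square algebra_simps)
  have N0: "N (Re z) ((cmod z)\<^sup>2) > 0" if "Im z > 0" for z
    using mobius_map_denom_nonzero[OF \<Delta>, of z] that unfolding N[symmetric] by simp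
  have num: "Re (of_real a * z + of_real b) * Re (of_real c * z + of_real d) +
      Im (of_real a * z + of_real b) * Im (of_real c * z + of_real d) = R (Re z) ((cmod z)\<^sup>2)"
    "(cmod (of_real a * z + of_real b))\<^sup>2 = S (Re z) ((cmod z)\<^sup>2)" for z
    unfolding cmod_power2 R_def S_def by (simp_all add: power2_eq_square algebra_simps)
  have M: "Re (mobius_map a b c d z) = R (Re z) ((cmod z)\<^sup>2) / N (Re z) ((cmod z)\<^sup>2)"
    "(cmod (mobius_map a b c d z))\<^sup>2 = S (Re z) ((cmod z)\<^sup>2) / N (Re z) ((cmod z)\<^sup>2)" for z
    unfolding mobius_map_def norm_divide power_divide N Re_divide' num by simp_all
  define x y n where "x = Re" and "y = (\<lambda>z. (cmod z)\<^sup>2)" and "n = (\<lambda>z. N (Re z) ((cmod z)\<^sup>2))"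
  have frac: "(r2 / n2 - r1 / n1) * (s3 / n3 - s1 / n1) - (r3 / n3 - r1 / n1) * (s2 / n2 - s1 / n1) =
     (n1 * (r2 * s3 - r3 * s2) - n2 * (r1 * s3 - r3 * s1) + n3 * (r1 * s2 - r2 * s1)) / (n1 * n2 * n3)"
    if "n1 > 0" "n2 > 0" "n3 > 0" for r1 r2 r3 s1 s2 s3 n1 n2 n3 :: real
    using that by (simp add: divide_simps) (simp add: algebra_simps)
  have "turn (klein (mobius_map a b c d p)) (klein (mobius_map a b c d q)) (klein (mobius_map a b c d r)) =
     (a * d - b * c) ^ 3 / (n p * n q * n r) * turn (klein p) (klein q) (klein r)"
    unfolding turn_def klein_def complex.sel M frac[OF N0[OF pos(1)] N0[OF pos(2)] N0[OF pos(3)]]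
      n_def times_divide_eq_left
    by (rule arg_cong[where f = "\<lambda>t. t / _"])
      (simp only: N_def R_def S_def x_def[symmetric] y_def[symmetric], algebra)
  moreover have "(a * d - b * c) ^ 3 / (n p * n q * n r) > 0"
    using \<Delta> N0 pos by (simp add: n_def)
  ultimately show ?thesis by blast
qed


section \<open>Areas of convex polygons\<close>

lemma sets_hyp_line: "{z. turn A B (klein z) = 0} \<in> sets hyp_area"
  unfolding turn_def klein_def complex.sel sets_hyp_area
  by (intro borel_closed closed_Collect_eq continuous_intros)

lemma hyp_line_null:
  assumes "A \<noteq> B"
  shows "{z. turn A B (klein z) = 0} \<in> null_sets hyp_area"
  using AE_turn_nonzero[OF assms] sets_hyp_line[of A B] by (subst AE_iff_null_sets) auto

lemma hyp_hull_collinear_null: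
  assumes "finite S" "A \<noteq> B" "\<And>p. p \<in> S \<Longrightarrow> turn A B (klein p) = 0"
  shows "hyp_hull S \<in> null_sets hyp_area"
proof (rule null_sets_subset[OF hyp_line_null[OF assms(2)]])
  have "convex {P. turn A B P = 0}"
    by (auto simp: convex_def turn_affine)
  then have "convex hull (klein ` S) \<subseteq> {P. turn A B P = 0}"
    using assms(3) by (intro hull_minimal) auto
  then show "hyp_hull S \<subseteq> {z. turn A B (klein z) = 0}"
    by (auto simp: hyp_hull_def)
qed (use assms in auto)

lemma convex_turn_halfplane: "convex {X. turn A B X \<le> 0}" "convex {X. 0 \<le> turn A B X}"
  by (auto simp: convex_def turn_affine intro!: add_nonpos_nonpos mult_nonneg_nonpos)

lemma convex_chain_below:
  fixes P :: "nat \<Rightarrow> complex"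
  assumes chain: "\<And>i j k. i < j \<Longrightarrow> j < k \<Longrightarrow> k \<le> m \<Longrightarrow> turn (P i) (P j) (P k) > 0"
    and X: "X \<in> convex hull (P ` {..m})"
  shows "turn (P 0) (P m) X \<le> 0"
proof -
  have "turn (P 0) (P m) (P i) \<le> 0" if "i \<le> m" for i
  proof (cases "i = 0 \<or> i = m")
    case False
    then have "0 < i" "i < m" using that by auto
    then have "turn (P 0) (P i) (P m) > 0" using chain[of 0 i m] by simp
    then show ?thesis by (simp add: turn_def algebra_simps)
  qed auto
  then have "convex hull (P ` {..m}) \<subseteq> {X. turn (P 0) (P m) X \<le> 0}"
    using convex_turn_halfplane by (intro hull_minimal) auto
  then show ?thesis using X by auto
qed

text \<open>The new vertex adds only the triangle over the closing chord. A point of the large hull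
  on the new vertex's side of this chord satisfies all three half-plane conditions of the triangle.
  A point on the other side lies on a segment from the new vertex to a point \<open>h\<close> of the
  old hull, beyond the place where that segment crosses the chord.\<close>

lemma convex_chain_hull:
  fixes P :: "nat \<Rightarrow> complex"
  assumes chain: "\<And>i j k. i < j \<Longrightarrow> j < k \<Longrightarrow> k \<le> Suc m \<Longrightarrow> turn (P i) (P j) (P k) > 0" and "m \<ge> 1"
  shows "convex hull (P ` {..Suc m}) = convex hull (P ` {..m}) \<union> convex hull {P 0, P m, P (Suc m)}"
proof
  let ?H = "convex hull (P ` {..m})" and ?T = "convex hull {P 0, P m, P (Suc m)}"
  let ?r = "P (Suc m)"
  show "?H \<union> ?T \<subseteq> convex hull (P ` {..Suc m})"
    by (intro Un_least hull_mono) auto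
  show "convex hull (P ` {..Suc m}) \<subseteq> ?H \<union> ?T"
  proof
    fix x assume x: "x \<in> convex hull (P ` {..Suc m})"
    have D: "turn (P 0) (P m) ?r > 0" using chain[of 0 m "Suc m"] \<open>m \<ge> 1\<close> by auto
    have "0 \<le> turn (P m) ?r (P i) \<and> 0 \<le> turn ?r (P 0) (P i)" if "i \<le> Suc m" for i
    proof -
      have "0 \<le> turn (P i) (P m) ?r"
        using chain[of i m "Suc m"] that by (cases "i = m"; cases "i = Suc m") (auto simp: turn_def)
      moreover have "0 \<le> turn (P 0) (P i) ?r"
        using chain[of 0 i "Suc m"] that by (cases "i = 0"; cases "i = Suc m") (auto simp: turn_def)
      ultimately show ?thesis
        using turn_cycle[of "P m" ?r "P i"] turn_cycle[of ?r "P 0" "P i"] turn_cycle[of "P i" ?r "P 0"]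
        by simp
    qed
    then have "convex hull (P ` {..Suc m}) \<subseteq> {X. 0 \<le> turn (P m) ?r X} \<inter> {X. 0 \<le> turn ?r (P 0) X}"
      using convex_turn_halfplane by (intro hull_minimal convex_Int) auto
    then have sides: "0 \<le> turn (P m) ?r X" "0 \<le> turn ?r (P 0) X" if "X \<in> convex hull (P ` {..Suc m})" for X
      using that by auto
    show "x \<in> ?H \<union> ?T"
    proof (cases "turn (P 0) (P m) x \<ge> 0")
      case True
      then show ?thesis using in_triangle_iff[OF D] sides[OF x] by auto
    next
      case False
      have "convex hull (P ` {..Suc m}) = convex hull (insert ?r (P ` {..m}))"
        by (simp add: atMost_Suc)
      with x obtain h u v where h: "h \<in> ?H" "u \<ge> 0" "v \<ge> 0" "u + v = 1" "x = u *\<^sub>R ?r + v *\<^sub>R h"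
        by (subst (asm) convex_hull_insert) auto
      have hneg: "turn (P 0) (P m) h \<le> 0"
        using convex_chain_below[OF chain h(1)] by auto
      have hin: "h \<in> convex hull (P ` {..Suc m})"
        using h(1) hull_mono[of "P ` {..m}" "P ` {..Suc m}" convex] by fastforce
      define a b where "a = turn (P 0) (P m) ?r" and "b = - turn (P 0) (P m) h"
      have ab: "a > 0" "b \<ge> 0" using D hneg by (auto simp: a_def b_def)
      have xlt: "u * a < v * b"
        using False h turn_affine[OF h(4), of "P 0" "P m" ?r h] by (simp add: a_def b_def)
      then have "v > 0" using h ab by (metis less_eq_real_def mult_nonneg_nonneg mult_zero_left not_less)
      \<comment> \<open>Chosen so that \<open>c\<close> is the crossing point: the turn is affine
        along the segment, with value \<open>a\<close> at the new vertex and \<open>- b\<close> at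
        \<open>h\<close>.\<close>
      define t where "t = b / (a + b)"
      have t: "t \<ge> 0" "1 - t \<ge> 0" using ab by (auto simp: t_def field_simps)
      define c where "c = t *\<^sub>R ?r + (1 - t) *\<^sub>R h"
      have cin: "c \<in> convex hull (P ` {..Suc m})"
        unfolding c_def using t hin by (intro convexD[OF convex_convex_hull]) (auto intro: hull_inc)
      have c0: "turn (P 0) (P m) c = 0"
      proof -
        have "turn (P 0) (P m) c = t * a - (1 - t) * b"
          unfolding c_def using turn_affine[of t "1 - t" "P 0" "P m" ?r h] by (simp add: a_def b_def)
        also have "\<dots> = 0" using ab by (simp add: t_def field_simps)
        finally show ?thesis .
      qed
      \<comment> \<open>The two remaining side conditions bound the parameter of \<open>c\<close> on
        the chord by 0 and 1.\<close>
      have cT: "c \<in> closed_segment (P 0) (P m)"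
      proof -
        have "P 0 \<noteq> P m" using D by (auto simp: turn_def)
        moreover have "turn (P 0) c (P m) = 0" using c0 by (simp add: turn_def algebra_simps)
        ultimately obtain s where s: "c = P 0 + s *\<^sub>R (P m - P 0)" by (metis collinear_param)
        then have c': "c = (1 - s) *\<^sub>R P 0 + s *\<^sub>R P m" by (simp add: algebra_simps)
        have "turn (P m) ?r c = (1 - s) * a" "turn ?r (P 0) c = s * a"
          unfolding c' a_def
          using turn_affine[of "1 - s" s] turn_cycle[of "P m" ?r "P 0"] turn_cycle[of ?r "P 0" "P m"]
          by simp_all
        then have "0 \<le> s" "s \<le> 1" using sides[OF cin] ab by (auto simp: zero_le_mult_iff)
        then show ?thesis using c' by (auto simp: closed_segment_def)
      qed
      moreover have "P 0 \<in> ?H" "P m \<in> ?H" by (auto intro: hull_inc)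
      ultimately have cH: "c \<in> ?H"
        using convex_contains_segment[of ?H] convex_convex_hull by blast
      have "u \<le> t"
      proof -
        have "v = 1 - u" using h(4) by simp
        then have "u * a < (1 - u) * b" using xlt by simp
        then show ?thesis using ab by (simp add: t_def field_simps)
      qed
      have "x \<in> ?H"
      proof (cases "t = 0")
        case True
        then have "u = 0" using \<open>u \<le> t\<close> h by auto
        then show ?thesis using h by simp
      next
        case False
        with t have "t > 0" by simp
        have "x = (u / t) *\<^sub>R c + (1 - u / t) *\<^sub>R h"
          unfolding c_def h(5) using \<open>t > 0\<close> h(4)
          by (simp add: algebra_simps scaleR_left_distrib[symmetric] diff_divide_distrib)
        moreover have "0 \<le> u / t" "u / t \<le> 1" using \<open>t > 0\<close> \<open>u \<le> t\<close> h by auto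
        ultimately show ?thesis
          using cH h(1) convexD[OF convex_convex_hull, of c "P ` {..m}" h "u / t" "1 - u / t"] by auto
      qed
      then show ?thesis ..
    qed
  qed
qed

lemma fmeasurable_triangle:
  assumes "Im p > 0" "Im q > 0" "Im r > 0" "turn (klein p) (klein q) (klein r) > 0"
  shows "hyp_hull {p, q, r} \<in> fmeasurable hyp_area"
  using measure_hyp_triangle[OF assms] by (intro fmeasurableI) (auto simp: less_top)

text \<open>Cut into a fan of triangles at \<open>p 0\<close>: the angle of each inner chord occurs
  once with each sign, and overlaps lie on a null line. Distinctness of the first two points serves
  the base case, where the hull is a segment and there is no turn.\<close>

lemma hyp_hull_area_chain:
  fixes p :: "nat \<Rightarrow> complex"
  assumes "m \<ge> 1" "\<And>i. i \<le> m \<Longrightarrow> Im (p i) > 0" "klein (p 0) \<noteq> klein (p 1)"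
    and "\<And>i j k. i < j \<Longrightarrow> j < k \<Longrightarrow> k \<le> m \<Longrightarrow> turn (klein (p i)) (klein (p j)) (klein (p k)) > 0"
  shows "hyp_hull (p ` {..m}) \<in> fmeasurable hyp_area \<and>
    measure hyp_area (hyp_hull (p ` {..m})) = (\<Sum>j<m. chord_angle (p j) (p (Suc j))) - chord_angle (p 0) (p m)"
  using assms
proof (induction m rule: nat_induct_at_least)
  case base
  have "hyp_hull (p ` {..1}) \<in> null_sets hyp_area"
    by (rule hyp_hull_collinear_null[OF _ base(2)]) (auto simp: atMost_Suc le_Suc_eq)
  then show ?case
    by (auto simp: fmeasurable_def null_sets_def measure_def)
next
  case (Suc m)
  let ?H = "hyp_hull (p ` {..m})" and ?T = "hyp_hull {p 0, p m, p (Suc m)}"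
  have IH: "?H \<in> fmeasurable hyp_area"
    "measure hyp_area ?H = (\<Sum>j<m. chord_angle (p j) (p (Suc j))) - chord_angle (p 0) (p m)"
    using Suc by auto
  have D: "turn (klein (p 0)) (klein (p m)) (klein (p (Suc m))) > 0"
    using Suc by auto
  have T: "?T \<in> fmeasurable hyp_area"
    using Suc D by (intro fmeasurable_triangle) auto
  have mT: "measure hyp_area ?T = triangle_angle (p 0) (p m) (p (Suc m))"
    using Suc D measure_hyp_triangle by auto
  have "convex hull ((\<lambda>i. klein (p i)) ` {..Suc m}) = convex hull ((\<lambda>i. klein (p i)) ` {..m}) \<union>
      convex hull {klein (p 0), klein (p m), klein (p (Suc m))}"
    using Suc by (intro convex_chain_hull) auto
  then have Un: "hyp_hull (p ` {..Suc m}) = ?H \<union> ?T"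
    by (auto simp: hyp_hull_def image_image)
  have "?H \<inter> ?T \<subseteq> {z. turn (klein (p 0)) (klein (p m)) (klein z) = 0}"
  proof
    fix z assume z: "z \<in> ?H \<inter> ?T"
    have "turn (klein (p 0)) (klein (p m)) (klein z) \<le> 0"
      using z Suc by (intro convex_chain_below[of m "\<lambda>i. klein (p i)"]) (auto simp: hyp_hull_def image_image)
    moreover have "turn (klein (p 0)) (klein (p m)) (klein z) \<ge> 0"
      using z in_triangle_iff[OF D] by (auto simp: hyp_hull_def)
    ultimately show "z \<in> {z. turn (klein (p 0)) (klein (p m)) (klein z) = 0}" by simp
  qed
  moreover have "klein (p 0) \<noteq> klein (p m)" using D by (auto simp: turn_def)
  ultimately have "?H \<inter> ?T \<in> null_sets hyp_area"
    using null_sets_subset[OF hyp_line_null] by auto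
  then have "measure hyp_area (?H \<inter> ?T) = 0" by (simp add: measure_def null_sets_def)
  then have "measure hyp_area (?H \<union> ?T) = measure hyp_area ?H + measure hyp_area ?T"
    using measure_Un3[OF IH(1) T] by simp
  then show ?case
    unfolding Un IH(2) mT using IH(1) T chord_angle_swap[of "p (Suc m)" "p 0"]
    by (auto simp: triangle_angle_def)
qed

text \<open>With |\<kappa>| = sinh J these are the points at distance J from the imaginary axis on
  the side given by the sign of \<kappa>. The foot of the perpendicular has height cosh J exp
  \<tau>, so \<tau> is arc length along the axis up to a shift.\<close>

definition ray_point :: "real \<Rightarrow> real \<Rightarrow> complex" where
  "ray_point \<kappa> \<tau> = Complex (\<kappa> * exp \<tau>) (exp \<tau>)"

lemma ray_point_sel [simp]: "Re (ray_point \<kappa> \<tau>) = \<kappa> * exp \<tau>" "Im (ray_point \<kappa> \<tau>) = exp \<tau>"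
  by (simp_all add: ray_point_def)

lemma exp_diff_over_sum: "(exp t - exp s) / (exp t + exp s) = tanh ((t - s) / 2 :: real)"
proof -
  have "exp t - exp s = exp ((t + s) / 2) * (exp ((t - s) / 2) - exp (- ((t - s) / 2)))"
    "exp t + exp s = exp ((t + s) / 2) * (exp ((t - s) / 2) + exp (- ((t - s) / 2)))"
    by (simp_all add: algebra_simps mult_exp_exp add_divide_distrib[symmetric] diff_divide_distrib[symmetric])
  then show ?thesis by (simp add: tanh_altdef)
qed

lemma chord_angle_ray: "chord_angle (ray_point \<kappa> s) (ray_point \<kappa> t) = 2 * arctan (\<kappa> * tanh ((t - s) / 2))"
proof -
  have "(\<kappa> * exp t - \<kappa> * exp s) / (exp s + exp t) = \<kappa> * ((exp t - exp s) / (exp t + exp s))"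
    by (simp add: right_diff_distrib add.commute)
  then show ?thesis
    by (simp add: chord_angle_def exp_diff_over_sum)
qed

text \<open>A Vandermonde determinant, the \<open>klein\<close> coordinates being multiples of exp
  \<tau> and exp (2 \<tau>). Points in monotone order thus always turn the same way, or are
  collinear if \<kappa> = 0.\<close>

lemma turn_ray: "turn (klein (ray_point \<kappa> r)) (klein (ray_point \<kappa> s)) (klein (ray_point \<kappa> t)) =
    \<kappa> * (1 + \<kappa>\<^sup>2) * ((exp s - exp r) * (exp t - exp r) * (exp t - exp s))"
  unfolding turn_def klein_def cmod_power2 complex.sel ray_point_sel by algebra

lemma sinh_half_hyp_dist_ray:
  "sinh (hyp_dist (ray_point \<kappa> s) (ray_point \<kappa> t) / 2) = sqrt (1 + \<kappa>\<^sup>2) * sinh (\<bar>t - s\<bar> / 2)"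
proof -
  have wlog: "sinh (hyp_dist (ray_point \<kappa> s) (ray_point \<kappa> t) / 2) = sqrt (1 + \<kappa>\<^sup>2) * sinh ((t - s) / 2)"
    if "s \<le> t" for s t
  proof -
    have e: "exp t - exp s = 2 * exp ((s + t) / 2) * sinh ((t - s) / 2)"
      by (simp add: sinh_field_def algebra_simps mult_exp_exp add_divide_distrib[symmetric] diff_divide_distrib[symmetric])
    have "cmod (ray_point \<kappa> s - ray_point \<kappa> t) = sqrt ((1 + \<kappa>\<^sup>2) * (exp t - exp s)\<^sup>2)"
      by (simp add: cmod_def) (simp add: power2_eq_square algebra_simps)
    also have "\<dots> = sqrt (1 + \<kappa>\<^sup>2) * (exp t - exp s)"
      using that by (simp add: real_sqrt_mult)
    finally have "cmod (ray_point \<kappa> s - ray_point \<kappa> t) = sqrt (1 + \<kappa>\<^sup>2) * (exp t - exp s)" .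
    moreover have "sqrt (exp s * exp t) = exp ((s + t) / 2)"
      by (rule real_sqrt_unique) (simp_all add: power2_eq_square mult_exp_exp)
    ultimately show ?thesis
      by (subst sinh_half_hyp_dist) (simp_all add: e)
  qed
  show ?thesis
    using wlog[of s t] wlog[of t s] by (cases "s \<le> t") (auto simp: hyp_dist_def norm_minus_commute mult_ac)
qed

text \<open>All turns of the chain share one sign. If it is positive, the chain formula applies
  directly; if it is negative, it applies to the reversed chain; if \<kappa> = 0, the hull is null.
  The absolute value covers these cases at once.\<close>

lemma area_ray_polygon:
  fixes p :: "nat \<Rightarrow> complex"
  assumes \<Delta>: "a * d - b * c > 0" and m: "m \<ge> 1" and pos: "\<And>i. i \<le> m \<Longrightarrow> Im (p i) > 0"
    and ray: "\<And>i. i \<le> m \<Longrightarrow> mobius_map a b c d (p i) = ray_point \<kappa> (\<tau> i)"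
    and mono: "(\<forall>i j. i < j \<longrightarrow> j \<le> m \<longrightarrow> \<tau> i < \<tau> j) \<or> (\<forall>i j. i < j \<longrightarrow> j \<le> m \<longrightarrow> \<tau> j < \<tau> i)"
  shows "measure hyp_area (hyp_hull (p ` {..m})) =
    \<bar>(\<Sum>j<m. 2 * arctan (\<kappa> * tanh ((\<tau> (Suc j) - \<tau> j) / 2))) - 2 * arctan (\<kappa> * tanh ((\<tau> m - \<tau> 0) / 2))\<bar>"
proof -
  let ?M = "mobius_map a b c d"
  define s where "s = (\<Sum>j<m. chord_angle (p j) (p (Suc j))) - chord_angle (p 0) (p m)"
  have s: "(\<Sum>j<m. 2 * arctan (\<kappa> * tanh ((\<tau> (Suc j) - \<tau> j) / 2))) - 2 * arctan (\<kappa> * tanh ((\<tau> m - \<tau> 0) / 2)) = s"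
  proof -
    define \<theta> where "\<theta> = (\<lambda>i. Arg (of_real c * p i + of_real d))"
    have eq: "2 * arctan (\<kappa> * tanh ((\<tau> j - \<tau> i) / 2)) = chord_angle (p i) (p j) + 2 * (\<theta> j - \<theta> i)"
      if "i \<le> m" "j \<le> m" for i j
      using chord_angle_mobius_map[OF \<Delta> pos[OF that(1)] pos[OF that(2)]] ray that
      by (simp add: chord_angle_ray \<theta>_def)
    have "(\<Sum>j<m. 2 * arctan (\<kappa> * tanh ((\<tau> (Suc j) - \<tau> j) / 2))) =
        (\<Sum>j<m. chord_angle (p j) (p (Suc j)) + 2 * (\<theta> (Suc j) - \<theta> j))"
      by (intro sum.cong) (auto simp: eq)
    also have "\<dots> = (\<Sum>j<m. chord_angle (p j) (p (Suc j))) + 2 * (\<theta> m - \<theta> 0)"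
      unfolding sum.distrib sum_distrib_left[symmetric] sum_lessThan_telescope ..
    finally show ?thesis using eq[of 0 m] by (simp add: s_def)
  qed
  have turn: "\<exists>k>0. turn (klein (p i)) (klein (p j)) (klein (p l)) =
      k * (\<kappa> * ((exp (\<tau> j) - exp (\<tau> i)) * (exp (\<tau> l) - exp (\<tau> i)) * (exp (\<tau> l) - exp (\<tau> j))))"
    if "i \<le> m" "j \<le> m" "l \<le> m" for i j l
  proof -
    from turn_mobius_map[OF \<Delta> pos[OF that(1)] pos[OF that(2)] pos[OF that(3)]]
    obtain k where k: "k > 0" "turn (klein (?M (p i))) (klein (?M (p j))) (klein (?M (p l))) =
        k * turn (klein (p i)) (klein (p j)) (klein (p l))" by blast
    have "1 + \<kappa>\<^sup>2 > 0" by (simp add: add_pos_nonneg)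
    with k show ?thesis
      using that by (intro exI[of _ "(1 + \<kappa>\<^sup>2) / k"]) (simp add: ray turn_ray field_simps)
  qed
  have ne: "klein (p i) \<noteq> klein (p j)" if "i < j" "j \<le> m" for i j
  proof
    assume "klein (p i) = klein (p j)"
    then have "p i = p j" using klein_inj pos that by auto
    then have "ray_point \<kappa> (\<tau> i) = ray_point \<kappa> (\<tau> j)" using ray[of i] ray[of j] that by auto
    then have "\<tau> i = \<tau> j" by (simp add: ray_point_def)
    then show False using mono that by (metis less_irrefl)
  qed
  define f where "f = (\<lambda>i j l. \<kappa> * ((exp (\<tau> j) - exp (\<tau> i)) * (exp (\<tau> l) - exp (\<tau> i)) * (exp (\<tau> l) - exp (\<tau> j))))"
  have turnf: "\<exists>k>0. turn (klein (p i)) (klein (p j)) (klein (p l)) = k * f i j l"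
    if "i \<le> m" "j \<le> m" "l \<le> m" for i j l
    using turn[OF that] unfolding f_def .
  consider "\<kappa> = 0" | "\<forall>i j l. i < j \<longrightarrow> j < l \<longrightarrow> l \<le> m \<longrightarrow> f i j l > 0"
    | "\<forall>i j l. i < j \<longrightarrow> j < l \<longrightarrow> l \<le> m \<longrightarrow> f i j l < 0"
  proof -
    have f: "f i j l > 0 \<longleftrightarrow> (\<kappa> > 0 \<longleftrightarrow> (\<forall>i j. i < j \<longrightarrow> j \<le> m \<longrightarrow> \<tau> i < \<tau> j))"
      "f i j l < 0 \<longleftrightarrow> \<not> (\<kappa> > 0 \<longleftrightarrow> (\<forall>i j. i < j \<longrightarrow> j \<le> m \<longrightarrow> \<tau> i < \<tau> j))"
      if "\<kappa> \<noteq> 0" "i < j" "j < l" "l \<le> m" for i j l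
    proof -
      let ?g = "(exp (\<tau> j) - exp (\<tau> i)) * (exp (\<tau> l) - exp (\<tau> i)) * (exp (\<tau> l) - exp (\<tau> j))"
      have l: "i < l" "j \<le> m" using that by auto
      have "if (\<forall>i j. i < j \<longrightarrow> j \<le> m \<longrightarrow> \<tau> i < \<tau> j) then ?g > 0 else ?g < 0"
        using mono that l
        by (auto intro!: mult_pos_pos mult_pos_neg mult_neg_neg)
      then show "f i j l > 0 \<longleftrightarrow> (\<kappa> > 0 \<longleftrightarrow> (\<forall>i j. i < j \<longrightarrow> j \<le> m \<longrightarrow> \<tau> i < \<tau> j))"
        "f i j l < 0 \<longleftrightarrow> \<not> (\<kappa> > 0 \<longleftrightarrow> (\<forall>i j. i < j \<longrightarrow> j \<le> m \<longrightarrow> \<tau> i < \<tau> j))"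
        using that(1) unfolding f_def by (auto simp: zero_less_mult_iff mult_less_0_iff split: if_splits)
    qed
    show ?thesis
    proof (cases "\<kappa> = 0")
      case False
      then show ?thesis
      proof (cases "\<kappa> > 0 \<longleftrightarrow> (\<forall>i j. i < j \<longrightarrow> j \<le> m \<longrightarrow> \<tau> i < \<tau> j)")
        case True
        then show ?thesis using f(1)[OF False] by (intro that(2)) simp
      next
        case neq: False
        then show ?thesis using f(2)[OF False] by (intro that(3)) simp
      qed
    qed (rule that(1))
  qed
  then show ?thesis
  proof cases
    case 1
    have "turn (klein (p 0)) (klein (p 1)) (klein q) = 0" if q: "q \<in> p ` {..m}" for q
    proof -
      obtain i where "i \<le> m" "q = p i" using q by auto
      then show ?thesis using turn[of 0 1 i] m 1 by auto
    qed
    then have "hyp_hull (p ` {..m}) \<in> null_sets hyp_area"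
      using ne[of 0 1] m by (intro hyp_hull_collinear_null[of _ "klein (p 0)" "klein (p 1)"]) auto
    then show ?thesis using s 1 by (simp add: measure_def null_sets_def)
  next
    case 2
    have "turn (klein (p i)) (klein (p j)) (klein (p l)) > 0" if "i < j" "j < l" "l \<le> m" for i j l
    proof -
      have "f i j l > 0" "i \<le> m" "j \<le> m" using 2 that by auto
      then show ?thesis using turnf[of i j l] that by (auto intro: mult_pos_pos)
    qed
    then have "measure hyp_area (hyp_hull (p ` {..m})) = s"
      unfolding s_def using hyp_hull_area_chain[of m p] m pos ne[of 0 1] by auto
    then show ?thesis unfolding s using measure_nonneg[of hyp_area "hyp_hull (p ` {..m})"] by linarith
  next
    case 3
    \<comment> \<open>Reversing the chain makes it turn left and negates every chord angle.\<close>
    define q where "q = (\<lambda>i. p (m - i))"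
    have neg': "turn (klein (p i)) (klein (p j)) (klein (p l)) < 0" if "i < j" "j < l" "l \<le> m" for i j l
    proof -
      have "f i j l < 0" "i \<le> m" "j \<le> m" using 3 that by auto
      then show ?thesis using turnf[of i j l] that by (auto intro: mult_pos_neg)
    qed
    have neg: "turn (klein (p l)) (klein (p j)) (klein (p i)) > 0" if "i < j" "j < l" "l \<le> m" for i j l
      using turn_swap[of "klein (p j)" "klein (p l)" "klein (p i)"] turn_cycle[of "klein (p j)" "klein (p l)" "klein (p i)"] neg'[OF that]
      by linarith
    have img: "q ` {..m} = p ` {..m}"
    proof -
      have "(\<lambda>i. m - i) ` {..m} = {..m}"
      proof (intro equalityI subsetI)
        fix i assume "i \<in> {..m}"
        then show "i \<in> (\<lambda>i. m - i) ` {..m}" by (intro image_eqI[of _ _ "m - i"]) auto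
      qed auto
      then show ?thesis unfolding q_def by (metis image_image)
    qed
    have "measure hyp_area (hyp_hull (q ` {..m})) = (\<Sum>j<m. chord_angle (q j) (q (Suc j))) - chord_angle (q 0) (q m)"
    proof (rule hyp_hull_area_chain[THEN conjunct2])
      show "klein (q 0) \<noteq> klein (q 1)" using ne[of "m - 1" m] m by (simp add: q_def)
      show "turn (klein (q i)) (klein (q j)) (klein (q k)) > 0" if "i < j" "j < k" "k \<le> m" for i j k
        unfolding q_def using that by (intro neg) auto
    qed (use m pos q_def in auto)
    also have "(\<Sum>j<m. chord_angle (q j) (q (Suc j))) = (\<Sum>j<m. - chord_angle (p j) (p (Suc j)))"
    proof -
      have "(\<Sum>j<m. - chord_angle (p j) (p (Suc j))) = (\<Sum>j<m. - chord_angle (p (m - Suc j)) (p (Suc (m - Suc j))))"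
        by (rule sum.nat_diff_reindex[symmetric])
      also have "\<dots> = (\<Sum>j<m. chord_angle (q j) (q (Suc j)))"
        by (intro sum.cong refl) (auto simp: q_def Suc_diff_Suc chord_angle_swap[symmetric])
      finally show ?thesis ..
    qed
    also have "chord_angle (q 0) (q m) = - chord_angle (p 0) (p m)"
      using chord_angle_swap[of "p m" "p 0"] by (simp add: q_def)
    finally have "measure hyp_area (hyp_hull (p ` {..m})) = - s"
      unfolding img by (simp add: s_def sum_negf)
    then show ?thesis unfolding s using measure_nonneg[of hyp_area "hyp_hull (p ` {..m})"] by linarith
  qed
qed

section \<open>Normal form of equidistant polygons\<close>

definition hyp_axis :: "complex set" where
  "hyp_axis = {z. Re z = 0 \<and> Im z > 0}"

lemma hyp_dist_ray_0: "hyp_dist (ray_point 0 s) (ray_point 0 t) = \<bar>t - s\<bar>"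
  using sinh_half_hyp_dist_ray[of 0 s t] by simp

lemma axis_eq_ray: "z \<in> hyp_axis \<Longrightarrow> z = ray_point 0 (ln (Im z))"
  by (auto simp: hyp_axis_def complex_eq_iff)

text \<open>The geodesic satisfies |z|^2 = s Re z + m, so its ideal end points are the roots (s -
  e)/2 and (s + e)/2 of x^2 = s x + m. The map sends the first to 0 and the second to infinity; its
  determinant is \<open>e\<close>. A vertical geodesic is merely translated.\<close>

lemma mobius_map_to_axis:
  assumes "Im p > 0" "Im q > 0" "p \<noteq> q"
  obtains a b c d where "a * d - b * c > 0" "Re (mobius_map a b c d p) = 0" "Re (mobius_map a b c d q) = 0"
proof (cases "Re p = Re q")
  case True
  then show ?thesis by (intro that[of 1 1 "- Re p" 0]) (auto simp: mobius_map_def)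
next
  case False
  define s where "s = ((cmod q)\<^sup>2 - (cmod p)\<^sup>2) / (Re q - Re p)"
  define m where "m = (cmod p)\<^sup>2 - s * Re p"
  define e where "e = sqrt (s\<^sup>2 + 4 * m)"
  have line: "(cmod p)\<^sup>2 = s * Re p + m" "(cmod q)\<^sup>2 = s * Re q + m"
  proof -
    have "(Re q - Re p) * s = (cmod q)\<^sup>2 - (cmod p)\<^sup>2" using False by (simp add: s_def)
    then show "(cmod p)\<^sup>2 = s * Re p + m" "(cmod q)\<^sup>2 = s * Re q + m"
      by (simp_all add: m_def algebra_simps)
  qed
  have "s\<^sup>2 + 4 * m = (2 * Re p - s)\<^sup>2 + 4 * (Im p)\<^sup>2"
    using line(1) unfolding cmod_power2 by (simp add: power2_eq_square algebra_simps)
  then have disc: "s\<^sup>2 + 4 * m > 0" using assms by (simp add: add_nonneg_pos)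
  then have e: "e > 0" "e\<^sup>2 = s\<^sup>2 + 4 * m" by (auto simp: e_def)
  have zero: "Re (mobius_map 1 (- ((s - e) / 2)) (-1) ((s + e) / 2) z) = 0"
    if z: "(cmod z)\<^sup>2 = s * Re z + m" for z
  proof -
    have "Re (of_real 1 * z + of_real (- ((s - e) / 2))) * Re (of_real (- 1) * z + of_real ((s + e) / 2)) +
        Im (of_real 1 * z + of_real (- ((s - e) / 2))) * Im (of_real (- 1) * z + of_real ((s + e) / 2)) =
        s * Re z - (cmod z)\<^sup>2 + (e\<^sup>2 - s\<^sup>2) / 4"
      unfolding cmod_power2 by (simp add: power2_eq_square field_simps)
    also have "\<dots> = 0" using e z by simp
    finally show ?thesis unfolding mobius_map_def Re_divide' by simp
  qed
  show ?thesis
    using e zero[OF line(1)] zero[OF line(2)]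
    by (intro that[of 1 "(s + e) / 2" "- ((s - e) / 2)" "-1"]) auto
qed

text \<open>Each of y - f 0 and f 0 - y is sent to \<open>y\<close> or to its mirror image 2 f 0 -
  y, and distinct points cannot both go to the latter.\<close>

lemma isometry_real_surj:
  fixes f :: "real \<Rightarrow> real"
  assumes iso: "\<And>s t. \<bar>f s - f t\<bar> = \<bar>s - t\<bar>"
  shows "surj f"
proof -
  have "f (y - f 0) = y \<or> f (f 0 - y) = y" for y
    using iso[of "y - f 0" 0] iso[of "f 0 - y" 0] iso[of "y - f 0" "f 0 - y"]
    by (auto simp: abs_if split: if_splits)
  then show ?thesis unfolding surj_def by metis
qed

text \<open>The definition only supplies an isometric copy of the real line. Equality in the
  triangle inequality puts all of it on the line through two of its points, and surjectivity of
  isometries of the real line gives the whole axis.\<close>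

lemma geodesic_normal_form:
  assumes "hyp_geodesic G"
  obtains a b c d where "a * d - b * c > 0" "mobius_map a b c d ` G = hyp_axis" "G \<subseteq> hyp_plane"
proof -
  obtain \<gamma> :: "real \<Rightarrow> complex" where \<gamma>: "range \<gamma> = G" "G \<subseteq> hyp_plane" "\<And>s t. hyp_dist (\<gamma> s) (\<gamma> t) = \<bar>s - t\<bar>"
    using assms by (auto simp: hyp_geodesic_def)
  have pos: "Im (\<gamma> t) > 0" for t using \<gamma>(1) subsetD[OF \<gamma>(2), of "\<gamma> t"] by auto
  have ne: "\<gamma> 0 \<noteq> \<gamma> 1" using \<gamma>(3)[of 0 1] hyp_dist_eq_0_iff[OF pos pos, of 0 1] by auto
  obtain a b c d where \<Delta>: "a * d - b * c > 0" and re: "Re (mobius_map a b c d (\<gamma> 0)) = 0"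
      "Re (mobius_map a b c d (\<gamma> 1)) = 0"
    by (rule mobius_map_to_axis[OF pos pos ne])
  define \<mu> where "\<mu> = (\<lambda>t. mobius_map a b c d (\<gamma> t))"
  have \<mu>pos: "Im (\<mu> t) > 0" for t using Im_mobius_map_pos[OF \<Delta> pos] by (simp add: \<mu>_def)
  have iso: "hyp_dist (\<mu> s) (\<mu> t) = \<bar>s - t\<bar>" for s t
    using hyp_dist_mobius_map[OF \<Delta> pos pos] \<gamma>(3) by (simp add: \<mu>_def)
  have on_line: "Re (\<mu> t) = 0" for t
  proof -
    have sum: "hyp_dist (\<mu> r) (\<mu> s) + hyp_dist (\<mu> s) (\<mu> u) = hyp_dist (\<mu> r) (\<mu> u) \<Longrightarrow>
        turn (klein (\<mu> r)) (klein (\<mu> s)) (klein (\<mu> u)) = 0" for r s u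
      using hyp_dist_add_iff \<mu>pos by blast
    consider "t \<le> 0" | "0 \<le> t" "t \<le> 1" | "1 \<le> t" by linarith
    then have "turn (klein (\<mu> 0)) (klein (\<mu> 1)) (klein (\<mu> t)) = 0"
    proof cases
      case 1
      then show ?thesis using sum[of t 0 1] turn_cycle[of "klein (\<mu> 0)" "klein (\<mu> 1)" "klein (\<mu> t)"] by (simp add: iso)
    next
      case 2
      then show ?thesis using sum[of 0 t 1] by (simp add: iso turn_def algebra_simps)
    next
      case 3
      then show ?thesis using sum[of 0 1 t] by (simp add: iso)
    qed
    then have "Re (\<mu> t) * ((cmod (\<mu> 1))\<^sup>2 - (cmod (\<mu> 0))\<^sup>2) = 0"
      using re by (auto simp: turn_def klein_def \<mu>_def algebra_simps)
    moreover have "(cmod (\<mu> 1))\<^sup>2 \<noteq> (cmod (\<mu> 0))\<^sup>2"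
    proof
      assume "(cmod (\<mu> 1))\<^sup>2 = (cmod (\<mu> 0))\<^sup>2"
      then have "klein (\<mu> 1) = klein (\<mu> 0)" using re by (simp add: klein_def \<mu>_def)
      then have "\<mu> 1 = \<mu> 0" using klein_inj \<mu>pos by blast
      then show False using iso[of 1 0] hyp_dist_eq_0_iff[OF \<mu>pos \<mu>pos, of 1 0] by simp
    qed
    ultimately show ?thesis by simp
  qed
  have \<mu>_axis: "\<mu> t = ray_point 0 (ln (Im (\<mu> t)))" for t
    using axis_eq_ray[of "\<mu> t"] on_line \<mu>pos by (simp add: hyp_axis_def)
  have "\<bar>ln (Im (\<mu> s)) - ln (Im (\<mu> t))\<bar> = \<bar>s - t\<bar>" for s t
    using iso[of s t] hyp_dist_ray_0[of "ln (Im (\<mu> s))" "ln (Im (\<mu> t))"] \<mu>_axis by simp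
  then have surj: "surj (\<lambda>t. ln (Im (\<mu> t)))" by (rule isometry_real_surj)
  have "mobius_map a b c d ` G = range \<mu>" unfolding \<gamma>(1)[symmetric] \<mu>_def by auto
  also have "\<dots> = hyp_axis"
  proof (intro equalityI subsetI)
    fix z assume z: "z \<in> hyp_axis"
    from surjD[OF surj, of "ln (Im z)"] obtain t where t: "ln (Im z) = ln (Im (\<mu> t))" by blast
    have "z = ray_point 0 (ln (Im z))" by (rule axis_eq_ray[OF z])
    also have "\<dots> = \<mu> t" unfolding t by (rule \<mu>_axis[symmetric])
    finally show "z \<in> range \<mu>" by simp
  qed (use on_line \<mu>pos in \<open>auto simp: hyp_axis_def\<close>)
  finally show ?thesis by (rule that[OF \<Delta> _ \<gamma>(2)])
qed

section \<open>Equidistant loci of the imaginary axis\<close>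

lemma hyp_setdist_mobius_map:
  assumes "a * d - b * c > 0" "G \<subseteq> hyp_plane" "Im z > 0"
  shows "hyp_setdist (mobius_map a b c d z) (mobius_map a b c d ` G) = hyp_setdist z G"
  unfolding hyp_setdist_def image_image using assms
  by (intro arg_cong[where f = Inf] image_cong refl hyp_dist_mobius_map) auto

text \<open>The nearest point of the axis is the one at height |z|; its minimality is the inequality
  of arithmetic and geometric means.\<close>

lemma sinh_hyp_setdist_axis:
  assumes z: "Im z > 0"
  shows "hyp_setdist z hyp_axis \<ge> 0 \<and> sinh (hyp_setdist z hyp_axis) = \<bar>Re z\<bar> / Im z"
proof -
  have z0: "cmod z > 0" using z by auto
  define r where "r = arcosh (cmod z / Im z)"
  have ge1: "cmod z / Im z \<ge> 1" using z abs_Im_le_cmod[of z] by simp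
  then have r: "r \<ge> 0" "cosh r = cmod z / Im z" by (auto simp: r_def cosh_arcosh_real)
  have ch: "cosh (hyp_dist z (Complex 0 s)) = ((cmod z)\<^sup>2 + s\<^sup>2) / (2 * Im z * s)" if "s > 0" for s
    using z that by (subst cosh_hyp_dist_klein_form) (auto simp: klein_form_def cmod_power2)
  have "hyp_dist z (Complex 0 (cmod z)) = r"
  proof -
    have "cosh (hyp_dist z (Complex 0 (cmod z))) = cosh r"
      using z z0 by (simp add: ch r power2_eq_square)
    then show ?thesis using r hyp_dist_nonneg z z0 by (metis arcosh_cosh_real complex.sel(2))
  qed
  moreover have "r \<le> hyp_dist z w" if "w \<in> hyp_axis" for w
  proof -
    have w: "w = Complex 0 (Im w)" "Im w > 0" using that by (auto simp: hyp_axis_def complex_eq_iff)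
    have "2 * cmod z * Im w \<le> (cmod z)\<^sup>2 + (Im w)\<^sup>2" by (rule sum_squares_bound)
    then have "cosh r \<le> cosh (hyp_dist z (Complex 0 (Im w)))"
      using z w(2) by (simp add: ch r divide_simps) 
    then have "cosh r \<le> cosh (hyp_dist z w)" using w(1) by simp
    then show ?thesis using cosh_real_nonneg_le_iff[OF r(1), of "hyp_dist z w"] hyp_dist_nonneg[of z w] z w by simp
  qed
  moreover have "Complex 0 (cmod z) \<in> hyp_axis" using z0 by (simp add: hyp_axis_def)
  ultimately have eq: "hyp_setdist z hyp_axis = r"
    unfolding hyp_setdist_def by (intro cInf_eq_minimum) auto
  have "(sinh r)\<^sup>2 = (\<bar>Re z\<bar> / Im z)\<^sup>2"
    unfolding sinh_square_eq r(2) using z by (simp add: power_divide cmod_power2 field_simps)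
  then have "sinh r = \<bar>Re z\<bar> / Im z" using r z by (simp add: power2_eq_iff_nonneg)
  with eq r show ?thesis by simp
qed

lemma hyp_setdist_axis_iff:
  assumes "Im z > 0"
  shows "hyp_setdist z hyp_axis = J \<longleftrightarrow> J \<ge> 0 \<and> \<bar>Re z\<bar> = sinh J * Im z"
    and "hyp_setdist z hyp_axis < J \<longleftrightarrow> \<bar>Re z\<bar> < sinh J * Im z"
    and "0 < hyp_setdist z hyp_axis \<longleftrightarrow> Re z \<noteq> 0"
proof -
  note s = sinh_hyp_setdist_axis[OF assms]
  have "hyp_setdist z hyp_axis = J \<longleftrightarrow> sinh (hyp_setdist z hyp_axis) = sinh J" by simp
  then show "hyp_setdist z hyp_axis = J \<longleftrightarrow> J \<ge> 0 \<and> \<bar>Re z\<bar> = sinh J * Im z"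
    using s assms by (auto simp: field_simps)
  have "hyp_setdist z hyp_axis < J \<longleftrightarrow> sinh (hyp_setdist z hyp_axis) < sinh J" by simp
  then show "hyp_setdist z hyp_axis < J \<longleftrightarrow> \<bar>Re z\<bar> < sinh J * Im z"
    using s assms by (simp add: divide_less_eq)
  have "0 < hyp_setdist z hyp_axis \<longleftrightarrow> 0 < sinh (hyp_setdist z hyp_axis)" by simp
  then show "0 < hyp_setdist z hyp_axis \<longleftrightarrow> Re z \<noteq> 0"
    using s assms by (simp add: zero_less_divide_iff)
qed

text \<open>For positive \<open>k\<close> the imaginary axis separates the two rays. This is all
  that is needed about components, so they need not be listed.\<close>

lemma connected_in_double_ray:
  assumes "connected T" "T \<subseteq> {z. Im z > 0 \<and> \<bar>Re z\<bar> = k * Im z}"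
  shows "\<exists>\<kappa>. \<bar>\<kappa>\<bar> = \<bar>k\<bar> \<and> (\<forall>z\<in>T. Re z = \<kappa> * Im z)"
proof (cases "k > 0")
  case False
  have "Re z = 0 \<and> k = 0" if "z \<in> T" for z
  proof -
    have z: "Im z > 0" "\<bar>Re z\<bar> = k * Im z" using assms(2) that by auto
    then have "k * Im z \<ge> 0" by linarith
    then have "k = 0" using z(1) False by (simp add: zero_le_mult_iff)
    then show ?thesis using z by simp
  qed
  then show ?thesis by (intro exI[of _ k]) auto
next
  case True
  have "T \<subseteq> {z. Re z > 0} \<union> {z. Re z < 0}"
  proof
    fix z assume "z \<in> T"
    with assms(2) True have "\<bar>Re z\<bar> > 0" by (auto simp: subset_iff)
    then show "z \<in> {z. Re z > 0} \<union> {z. Re z < 0}" by auto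
  qed
  then have "{z. Re z > 0} \<inter> T = {} \<or> {z. Re z < 0} \<inter> T = {}"
    by (intro connectedD[OF assms(1) open_halfspace_Re_gt open_halfspace_Re_lt]) auto
  then show ?thesis
  proof
    assume "{z. Re z > 0} \<inter> T = {}"
    then have "Re z \<le> 0" if "z \<in> T" for z using that by (auto simp: not_less[symmetric])
    then show ?thesis using assms(2) by (intro exI[of _ "- k"]) (force simp: abs_if subset_iff split: if_splits)
  next
    assume "{z. Re z < 0} \<inter> T = {}"
    then have "Re z \<ge> 0" if "z \<in> T" for z using that by (auto simp: not_less[symmetric])
    then show ?thesis using assms(2) by (intro exI[of _ "k"]) (force simp: abs_if subset_iff split: if_splits)
  qed
qed

text \<open>In logarithmic height the parametrization of the component becomes a continuous
  injection of the real line, hence strictly monotone. Its direction is left open by the final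
  disjunction.\<close>

lemma ngon_normal_form:
  fixes x :: "'n::{finite,linorder} \<Rightarrow> complex"
  assumes "equidistant_ngon J x"
  obtains a b c d \<kappa> \<tau> i0 where "a * d - b * c > 0" "J \<ge> 0" "\<bar>\<kappa>\<bar> = sinh J" "\<And>i. Im (x i) > 0"
    "\<And>i. mobius_map a b c d (x i) = ray_point \<kappa> (\<tau> i)"
    "(\<forall>i. i \<noteq> i0 \<longrightarrow> \<tau> (cyc_pred i) < \<tau> i) \<or> (\<forall>i. i \<noteq> i0 \<longrightarrow> \<tau> i < \<tau> (cyc_pred i))"
proof -
  obtain G C \<phi> t i0 where G: "hyp_geodesic G" and C: "C \<in> components (equidistant_locus J G)"
    and \<phi>: "positive_param J G C \<phi>" and x: "\<And>i. x i = \<phi> (t i)" and t: "\<And>i. i \<noteq> i0 \<Longrightarrow> t (cyc_pred i) < t i"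
    using assms unfolding equidistant_ngon_def by blast
  have J: "J \<ge> 0" using assms by (simp add: equidistant_ngon_def)
  obtain a b c d where \<Delta>: "a * d - b * c > 0" and MG: "mobius_map a b c d ` G = hyp_axis" "G \<subseteq> hyp_plane"
    by (rule geodesic_normal_form[OF G])
  let ?M = "mobius_map a b c d"
  have Csub: "C \<subseteq> equidistant_locus J G" "connected C"
    using C by (auto simp: in_components_subset in_components_connected)
  then have Cpos: "C \<subseteq> hyp_plane" by (auto simp: equidistant_locus_def)
  have sub: "?M ` C \<subseteq> {z. Im z > 0 \<and> \<bar>Re z\<bar> = sinh J * Im z}"
  proof
    fix w assume "w \<in> ?M ` C"
    then obtain z where z: "z \<in> C" "w = ?M z" by auto
    then have "Im z > 0" "hyp_setdist z G = J" using Csub by (auto simp: equidistant_locus_def)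
    then have "Im w > 0" "hyp_setdist w hyp_axis = J"
      using z hyp_setdist_mobius_map[OF \<Delta> MG(2), of z] MG Im_mobius_map_pos[OF \<Delta>, of z] by auto
    then show "w \<in> {z. Im z > 0 \<and> \<bar>Re z\<bar> = sinh J * Im z}" using hyp_setdist_axis_iff(1) by auto
  qed
  have conn: "connected (?M ` C)"
    using connected_continuous_image[OF continuous_on_subset[OF continuous_on_mobius_map[OF \<Delta>] Cpos] Csub(2)] .
  from connected_in_double_ray[OF conn sub]
  obtain \<kappa> where \<kappa>: "\<bar>\<kappa>\<bar> = \<bar>sinh J\<bar>" "\<forall>z\<in>?M ` C. Re z = \<kappa> * Im z" by (elim exE conjE)
  define g where "g = (\<lambda>s. ln (Im (?M (\<phi> s))))"
  have bij: "bij_betw \<phi> UNIV C" using \<phi> by (simp add: positive_param_def)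
  then have in_C: "\<phi> s \<in> C" for s by (auto simp: bij_betw_def)
  have Im\<phi>: "Im (\<phi> s) > 0" for s using subsetD[OF Cpos in_C, of s] by simp
  have ray: "?M (\<phi> s) = ray_point \<kappa> (g s)" for s
    using bspec[OF \<kappa>(2), of "?M (\<phi> s)"] in_C Im_mobius_map_pos[OF \<Delta> Im\<phi>, of s]
    by (simp add: complex_eq_iff g_def)
  have "continuous_on UNIV \<phi>"
    using \<phi> unfolding positive_param_def
    by (auto intro!: continuous_at_imp_continuous_on dest: has_vector_derivative_continuous)
  then have "continuous_on UNIV (\<lambda>s. ?M (\<phi> s))"
    by (intro continuous_on_compose2[OF continuous_on_mobius_map[OF \<Delta>]]) (use Im\<phi> in auto)
  then have "continuous_on UNIV g"
    unfolding g_def using Im_mobius_map_pos[OF \<Delta> Im\<phi>] by (intro continuous_intros) (auto simp: less_le)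
  moreover have "inj g"
  proof (rule injI)
    fix s s' assume "g s = g s'"
    then have "hyp_dist (?M (\<phi> s)) (?M (\<phi> s')) = 0"
      unfolding ray using sinh_half_hyp_dist_ray[of \<kappa> "g s" "g s"] by simp
    then have "hyp_dist (\<phi> s) (\<phi> s') = 0" using hyp_dist_mobius_map[OF \<Delta> Im\<phi> Im\<phi>] by simp
    then have "\<phi> s = \<phi> s'" using hyp_dist_eq_0_iff[OF Im\<phi> Im\<phi>] by simp
    then show "s = s'" using bij by (auto simp: bij_betw_def inj_def)
  qed
  ultimately have "strict_mono_on UNIV g \<or> strict_antimono_on UNIV g"
    using injective_eq_monotone_map[of UNIV g] by auto
  then have "(\<forall>i. i \<noteq> i0 \<longrightarrow> g (t (cyc_pred i)) < g (t i)) \<or> (\<forall>i. i \<noteq> i0 \<longrightarrow> g (t i) < g (t (cyc_pred i)))"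
    using t by (auto simp: monotone_on_def)
  then show ?thesis
    using \<kappa>(1) J Im\<phi> ray x by (intro that[OF \<Delta> J, of \<kappa> "\<lambda>i. g (t i)" i0]) auto
qed

section \<open>Polygons with prescribed projections\<close>

lemma cyc_pred_enum:
  fixes i0 :: "'n::{finite,linorder}"
  obtains e :: "nat \<Rightarrow> 'n" where "bij_betw e {..<CARD('n)} UNIV" "e 0 = i0"
    "\<forall>k. Suc k < CARD('n) \<longrightarrow> cyc_pred (e (Suc k)) = e k" "cyc_pred i0 = e (CARD('n) - 1)"
proof -
  define n where "n = CARD('n)"
  define xs where "xs = sorted_list_of_set (UNIV :: 'n set)"
  have xs: "length xs = n" "set xs = UNIV" "distinct xs" "sorted_wrt (<) xs"
    by (auto simp: xs_def n_def)
  have n: "n > 0" by (simp add: n_def)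
  have less_iff: "xs ! i < xs ! j \<longleftrightarrow> i < j" if "i < n" "j < n" for i j
    using that xs sorted_wrt_nth_less[OF xs(4)] by (metis less_asym linorder_neqE_nat order_less_irrefl)
  have nth: "\<exists>k<n. xs ! k = i" for i
    using xs by (metis UNIV_I in_set_conv_nth)
  have min: "Min UNIV = xs ! 0"
  proof (rule Min_eqI)
    fix y :: 'n
    obtain k where "k < n" "xs ! k = y" using nth by blast
    then show "xs ! 0 \<le> y" using less_iff[of k 0] n by (metis not_less not_less0)
  qed auto
  have max: "Max UNIV = xs ! (n - 1)"
  proof (rule Max_eqI)
    fix y :: 'n
    obtain k where "k < n" "xs ! k = y" using nth by blast
    then show "y \<le> xs ! (n - 1)" using less_iff[of "n - 1" k] n by (metis diff_less less_one not_less Suc_diff_1 less_Suc_eq_le)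
  qed auto
  have pred_Suc: "cyc_pred (xs ! Suc k) = xs ! k" if "Suc k < n" for k
  proof -
    have "xs ! Suc k \<noteq> Min UNIV" using that less_iff[of 0 "Suc k"] n by (auto simp: min)
    moreover have "Max {j. j < xs ! Suc k} = xs ! k"
    proof (rule Max_eqI)
      fix y assume "y \<in> {j. j < xs ! Suc k}"
      moreover obtain l where "l < n" "xs ! l = y" using nth by blast
      ultimately show "y \<le> xs ! k"
        using less_iff[of l "Suc k"] less_iff[of k l] that by (auto simp: not_less[symmetric])
    qed (use that less_iff[of k "Suc k"] in auto)
    ultimately show ?thesis by (simp add: cyc_pred_def)
  qed
  have pred_0: "cyc_pred (xs ! 0) = xs ! (n - 1)" by (simp add: cyc_pred_def min max)
  have pred_mod: "cyc_pred (xs ! (Suc k mod n)) = xs ! (k mod n)" for k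
  proof (cases "Suc (k mod n) = n")
    case True
    then have "k mod n = n - 1" by simp
    then show ?thesis using pred_0 True by (simp add: mod_Suc)
  next
    case False
    then have "Suc (k mod n) < n" using n by (metis Suc_lessI mod_less_divisor)
    then show ?thesis using pred_Suc False by (simp add: mod_Suc)
  qed
  obtain a where a: "a < n" "xs ! a = i0" using nth by blast
  \<comment> \<open>The sorted enumeration rotated to start at \<open>i0\<close>, so that the one
    step that may fail to follow the linear order closes the cycle.\<close>
  define e where "e = (\<lambda>k. xs ! ((a + k) mod n))"
  have "i \<in> e ` {..<n}" for i
  proof -
    obtain k where k: "k < n" "xs ! k = i" using nth by blast
    have "(a + (k + n - a) mod n) mod n = (a + (k + n - a)) mod n" by (rule mod_add_right_eq)
    also have "\<dots> = k" using a k by simp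
    finally show ?thesis using k n by (intro image_eqI[of _ _ "(k + n - a) mod n"]) (auto simp: e_def)
  qed
  then have surj: "e ` {..<n} = UNIV" by auto
  then have "inj_on e {..<n}" by (intro eq_card_imp_inj_on) (auto simp: n_def)
  with surj have "bij_betw e {..<n} UNIV" by (simp add: bij_betw_def)
  moreover have "e 0 = i0" using a by (simp add: e_def)
  moreover have "cyc_pred (e (Suc k)) = e k" for k using pred_mod[of "a + k"] by (simp add: e_def)
  moreover have "cyc_pred i0 = e (n - 1)"
  proof -
    have "e n = i0" using a by (simp add: e_def)
    then show ?thesis using \<open>cyc_pred (e (Suc (n - 1))) = e (n - 1)\<close> n by simp
  qed
  ultimately show ?thesis using that n_def by simp
qed

lemma chain_less:
  fixes \<tau> :: "nat \<Rightarrow> real"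
  assumes "\<And>k. k < m \<Longrightarrow> \<tau> k < \<tau> (Suc k)" "i < j" "j \<le> m"
  shows "\<tau> i < \<tau> j"
  using assms(2,3)
proof (induction j)
  case (Suc j)
  then have "\<tau> j < \<tau> (Suc j)" using assms(1) by simp
  with Suc show ?case by (cases "i = j") auto
qed simp

text \<open>\<open>l i\<close> is the length of the projection of side i to the geodesic. The side
  at \<open>i0\<close> closes the chain, so its projection is the sum of the others. The direction
  of traversal \<rho> and the side \<sigma> of the geodesic only affect a sign, which the absolute
  value removes.\<close>

lemma ngon_geometry:
  fixes x :: "'n::{finite,linorder} \<Rightarrow> complex"
  assumes ngon: "equidistant_ngon J x" and n: "CARD('n) \<ge> 2"
  obtains i0 l where "\<And>i. l i > 0" "l i0 = (\<Sum>i\<in>UNIV - {i0}. l i)"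
    "\<And>i. sinh (side_lengths x $ i / 2) = cosh J * sinh (l i / 2)"
    "measure hyp_area (hyp_convex hull (range x)) =
      \<bar>(\<Sum>i\<in>UNIV - {i0}. 2 * arctan (sinh J * tanh (l i / 2))) - 2 * arctan (sinh J * tanh (l i0 / 2))\<bar>"
proof -
  obtain a b c d \<kappa> \<tau> i0 where \<Delta>: "a * d - b * c > 0" and J: "J \<ge> 0" and \<kappa>: "\<bar>\<kappa>\<bar> = sinh J"
    and pos: "\<And>i. Im (x i) > 0" and ray: "\<And>i. mobius_map a b c d (x i) = ray_point \<kappa> (\<tau> i)"
    and mono: "(\<forall>i. i \<noteq> i0 \<longrightarrow> \<tau> (cyc_pred i) < \<tau> i) \<or> (\<forall>i. i \<noteq> i0 \<longrightarrow> \<tau> i < \<tau> (cyc_pred i))"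
    using ngon_normal_form[OF ngon] by metis
  obtain e where e: "bij_betw e {..<CARD('n)} UNIV" "e 0 = i0"
    "\<forall>k. Suc k < CARD('n) \<longrightarrow> cyc_pred (e (Suc k)) = e k" "cyc_pred i0 = e (CARD('n) - 1)"
    by (rule cyc_pred_enum[of i0])
  define m where "m = CARD('n) - 1"
  have m: "m \<ge> 1" "CARD('n) = Suc m" using n by (auto simp: m_def)
  have e_ne: "e (Suc k) \<noteq> i0" if "k < m" for k
    using e(1,2) m that inj_onD[of e "{..<CARD('n)}" "Suc k" 0] by (auto simp: bij_betw_def)
  have bij: "bij_betw (\<lambda>k. e (Suc k)) {..<m} (UNIV - {i0})"
  proof -
    have 1: "bij_betw e ({..<Suc m} - {0}) (UNIV - {e 0})"
      using e(1) m by (intro bij_betw_DiffI) (auto simp: bij_betw_def)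
    have 2: "bij_betw Suc {..<m} ({..<Suc m} - {0})"
      by (rule bij_betw_imageI) (auto simp: image_Suc_lessThan)
    show ?thesis using bij_betw_trans[OF 2 1] e(2) by (simp add: comp_def)
  qed
  define l where "l = (\<lambda>i. \<bar>\<tau> i - \<tau> (cyc_pred i)\<bar>)"
  have "\<exists>\<rho>. (\<rho> = 1 \<or> \<rho> = -1) \<and> (\<forall>i. i \<noteq> i0 \<longrightarrow> \<rho> * (\<tau> i - \<tau> (cyc_pred i)) > 0)"
    using mono by (auto intro: exI[of _ 1] exI[of _ "-1"])
  then obtain \<rho> :: real where \<rho>: "\<rho> = 1 \<or> \<rho> = -1" "\<And>i. i \<noteq> i0 \<Longrightarrow> \<rho> * (\<tau> i - \<tau> (cyc_pred i)) > 0" by blast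
  obtain \<sigma> :: real where \<sigma>: "\<sigma> = 1 \<or> \<sigma> = -1" "\<kappa> = \<sigma> * sinh J"
    using \<kappa> by (cases "\<kappa> \<ge> 0") (auto intro: that[of 1] that[of "-1"])
  have l_ne: "l i = \<rho> * (\<tau> i - \<tau> (cyc_pred i))" if "i \<noteq> i0" for i
    using \<rho>(1) \<rho>(2)[OF that] by (auto simp: l_def)
  have pred: "cyc_pred (e (Suc k)) = e k" if "k < m" for k using e(3) m that by simp
  have step: "l (e (Suc k)) = \<rho> * (\<tau> (e (Suc k)) - \<tau> (e k))" if "k < m" for k
    using l_ne[OF e_ne[OF that]] pred[OF that] by simp
  have sum_l: "(\<Sum>i\<in>UNIV - {i0}. l i) = \<rho> * (\<tau> (e m) - \<tau> (e 0))"
  proof -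
    have "(\<Sum>i\<in>UNIV - {i0}. l i) = (\<Sum>k<m. l (e (Suc k)))"
      using sum.reindex_bij_betw[OF bij] by (rule sym)
    also have "\<dots> = \<rho> * (\<Sum>k<m. \<tau> (e (Suc k)) - \<tau> (e k))"
      by (simp add: step sum_distrib_left)
    finally show ?thesis using sum_lessThan_telescope[of "\<tau> \<circ> e" m] by simp
  qed
  have sum_pos: "(\<Sum>i\<in>UNIV - {i0}. l i) > 0"
    by (rule sum_pos) (use \<rho>(2) l_ne e_ne[of 0] m in auto)
  have l0: "l i0 = (\<Sum>i\<in>UNIV - {i0}. l i)"
  proof -
    have "l i0 = \<bar>\<rho> * (\<tau> (e m) - \<tau> (e 0))\<bar>"
    proof -
      have "cyc_pred i0 = e m" using e(4) m(2) by simp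
      then show ?thesis using \<rho>(1) e(2) by (auto simp: l_def)
    qed
    then show ?thesis using sum_l sum_pos by simp
  qed
  have lpos: "l i > 0" for i
    using l0 sum_pos l_ne \<rho>(2) by (cases "i = i0") auto
  have side: "sinh (side_lengths x $ i / 2) = cosh J * sinh (l i / 2)" for i
  proof -
    have "side_lengths x $ i = hyp_dist (ray_point \<kappa> (\<tau> (cyc_pred i))) (ray_point \<kappa> (\<tau> i))"
      unfolding side_lengths_def ray[symmetric] by (simp add: hyp_dist_mobius_map[OF \<Delta> pos pos])
    moreover have "sqrt (1 + \<kappa>\<^sup>2) = cosh J"
    proof -
      have "\<kappa>\<^sup>2 = (sinh J)\<^sup>2" using \<kappa> by (metis power2_abs)
      then have "1 + \<kappa>\<^sup>2 = (cosh J)\<^sup>2" by (simp add: cosh_square_eq)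
      then show ?thesis by simp
    qed
    ultimately show ?thesis by (simp add: sinh_half_hyp_dist_ray l_def)
  qed
  define A where "A = (\<lambda>t. 2 * arctan (sinh J * tanh (t / 2)))"
  \<comment> \<open>Since \<open>A\<close> is odd, both signs come out as one common factor.\<close>
  have A: "2 * arctan (\<kappa> * tanh (r / 2)) = \<sigma> * \<rho> * A (\<rho> * r)" for r
    using \<sigma> \<rho>(1) by (auto simp: A_def arctan_minus)
  have range: "range x = (x \<circ> e) ` {..m}"
    using e(1) m unfolding bij_betw_def by (metis image_comp lessThan_Suc_atMost)
  have "measure hyp_area (hyp_hull ((x \<circ> e) ` {..m})) =
    \<bar>(\<Sum>j<m. 2 * arctan (\<kappa> * tanh (((\<tau> \<circ> e) (Suc j) - (\<tau> \<circ> e) j) / 2))) -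
      2 * arctan (\<kappa> * tanh (((\<tau> \<circ> e) m - (\<tau> \<circ> e) 0) / 2))\<bar>"
  proof (rule area_ray_polygon[OF \<Delta> m(1)])
    consider "\<rho> = 1" | "\<rho> = -1" using \<rho>(1) by auto
    then show "(\<forall>i j. i < j \<longrightarrow> j \<le> m \<longrightarrow> (\<tau> \<circ> e) i < (\<tau> \<circ> e) j) \<or>
        (\<forall>i j. i < j \<longrightarrow> j \<le> m \<longrightarrow> (\<tau> \<circ> e) j < (\<tau> \<circ> e) i)"
    proof cases
      case 1
      have "(\<tau> \<circ> e) i < (\<tau> \<circ> e) j" if "i < j" "j \<le> m" for i j
        by (rule chain_less[OF _ that]) (use 1 \<rho>(2)[OF e_ne] pred in auto)
      then show ?thesis by blast
    next
      case 2
      have "- (\<tau> \<circ> e) i < - (\<tau> \<circ> e) j" if "i < j" "j \<le> m" for i j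
        by (rule chain_less[OF _ that]) (use 2 \<rho>(2)[OF e_ne] pred in auto)
      then show ?thesis by auto
    qed
  qed (use pos ray in auto)
  also have "(\<Sum>j<m. 2 * arctan (\<kappa> * tanh (((\<tau> \<circ> e) (Suc j) - (\<tau> \<circ> e) j) / 2))) =
      (\<Sum>j<m. \<sigma> * \<rho> * A (l (e (Suc j))))"
    by (intro sum.cong refl) (simp add: A step)
  also have "\<dots> = \<sigma> * \<rho> * (\<Sum>i\<in>UNIV - {i0}. A (l i))"
    using sum.reindex_bij_betw[OF bij, of "\<lambda>i. A (l i)"] by (simp add: sum_distrib_left[symmetric])
  also have "2 * arctan (\<kappa> * tanh (((\<tau> \<circ> e) m - (\<tau> \<circ> e) 0) / 2)) = \<sigma> * \<rho> * A (l i0)"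
    unfolding A l0 sum_l by simp
  also have "\<bar>\<sigma> * \<rho> * (\<Sum>i\<in>UNIV - {i0}. A (l i)) - \<sigma> * \<rho> * A (l i0)\<bar> = \<bar>(\<Sum>i\<in>UNIV - {i0}. A (l i)) - A (l i0)\<bar>"
    using \<sigma>(1) \<rho>(1) by auto
  finally have "measure hyp_area (hyp_hull (range x)) = \<bar>(\<Sum>i\<in>UNIV - {i0}. A (l i)) - A (l i0)\<bar>"
    unfolding range .
  moreover have "hyp_convex hull (range x) = hyp_hull (range x)"
    unfolding hyp_hull_def using pos by (intro hyp_convex_hull_klein) auto
  ultimately show ?thesis
    using lpos l0 side by (intro that[of l i0]) (auto simp: A_def)
qed

section \<open>Construction of polygons in normal position\<close>

lemma hyp_geodesic_axis: "hyp_geodesic hyp_axis"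
  unfolding hyp_geodesic_def
proof (intro exI conjI allI)
  show "range (ray_point 0) = hyp_axis"
  proof (intro equalityI subsetI)
    fix z assume "z \<in> hyp_axis"
    then show "z \<in> range (ray_point 0)" using axis_eq_ray by blast
  qed (auto simp: hyp_axis_def)
  show "hyp_axis \<subseteq> hyp_plane" by (auto simp: hyp_axis_def)
  show "hyp_dist (ray_point 0 s) (ray_point 0 t) = \<bar>s - t\<bar>" for s t
    by (simp add: hyp_dist_ray_0)
qed

lemma range_ray_point: "range (ray_point \<kappa>) = {z. Im z > 0 \<and> Re z = \<kappa> * Im z}"
proof (intro equalityI subsetI)
  fix z assume "z \<in> {z. Im z > 0 \<and> Re z = \<kappa> * Im z}"
  then have "z = ray_point \<kappa> (ln (Im z))" by (simp add: complex_eq_iff)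
  then show "z \<in> range (ray_point \<kappa>)" by blast
qed auto

lemma ray_point_has_derivative:
  "(ray_point \<kappa> has_vector_derivative ray_point \<kappa> t) (at t)"
proof -
  have "ray_point \<kappa> = (\<lambda>t. exp t *\<^sub>R Complex \<kappa> 1)"
    by (auto simp: complex_eq_iff)
  moreover have "((\<lambda>t. exp t *\<^sub>R Complex \<kappa> 1) has_vector_derivative exp t *\<^sub>R Complex \<kappa> 1) (at t)"
    by (auto intro!: derivative_eq_intros)
  ultimately show ?thesis by (metis ext)
qed

lemma ray_component:
  assumes J: "J \<ge> 0"
  shows "range (ray_point (sinh J)) \<in> components (equidistant_locus J hyp_axis)"
proof -
  have locus: "equidistant_locus J hyp_axis = {z. Im z > 0 \<and> \<bar>Re z\<bar> = sinh J * Im z}"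
    using J by (auto simp: equidistant_locus_def hyp_setdist_axis_iff(1) simp del: split_paired_All) (use hyp_setdist_axis_iff(1) in blast)
  have "continuous_on UNIV (ray_point (sinh J))"
    using ray_point_has_derivative by (auto intro!: continuous_at_imp_continuous_on dest: has_vector_derivative_continuous)
  then have conn: "connected (range (ray_point (sinh J)))"
    by (intro connected_continuous_image) auto
  have sub: "range (ray_point (sinh J)) \<subseteq> equidistant_locus J hyp_axis"
    unfolding locus range_ray_point using J by (auto simp: abs_mult)
  have maximal: "T = range (ray_point (sinh J))"
    if T: "range (ray_point (sinh J)) \<subseteq> T" "T \<subseteq> equidistant_locus J hyp_axis" "connected T" for T
  proof -
    from connected_in_double_ray[OF T(3) T(2)[unfolded locus]] obtain \<kappa> where \<kappa>: "\<forall>z\<in>T. Re z = \<kappa> * Im z" by blast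
    have "Re (ray_point (sinh J) 0) = \<kappa> * Im (ray_point (sinh J) 0)" using \<kappa> T(1) by blast
    then have "\<kappa> = sinh J" by simp
    then have "T \<subseteq> range (ray_point (sinh J))"
      unfolding range_ray_point using \<kappa> T(2) locus by auto
    with T(1) show ?thesis by blast
  qed
  show ?thesis
    unfolding in_components_maximal using conn sub maximal by auto
qed

text \<open>Going up the right-hand ray, the left normal points into the wedge \<open>W\<close>
  between the axis and the ray, and \<open>W\<close> lies in every admissible region.\<close>

lemma ray_positive_param:
  assumes J: "J \<ge> 0"
  shows "positive_param J hyp_axis (range (ray_point (sinh J))) (ray_point (sinh J))"
  unfolding positive_param_def
proof (intro conjI allI)
  let ?k = "sinh J"
  show "bij_betw (ray_point ?k) UNIV (range (ray_point ?k))"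
    by (auto simp: bij_betw_def inj_def ray_point_def)
  fix t
  have "\<forall>\<^sub>F \<epsilon> in at_right 0. ray_point ?k t + complex_of_real \<epsilon> * (\<i> * ray_point ?k t) \<in> R"
    if R: "region_between J hyp_axis (range (ray_point ?k)) R" for R
  proof -
    let ?S = "{z \<in> hyp_plane. 0 < hyp_setdist z hyp_axis \<and> hyp_setdist z hyp_axis < J}"
    have S: "?S = {z. Im z > 0 \<and> Re z \<noteq> 0 \<and> \<bar>Re z\<bar> < ?k * Im z}"
      by (auto simp: hyp_setdist_axis_iff)
    have R_comp: "R \<in> components ?S" and fr: "range (ray_point ?k) \<subseteq> frontier R"
      using R by (auto simp: region_between_def)
    have R_sub: "R \<subseteq> ?S" and R_conn: "connected R" and R_ne: "R \<noteq> {}"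
      using R_comp in_components_subset in_components_connected in_components_nonempty by blast+
    \<comment> \<open>A region exists only for positive collar radius; J = 0 is thereby
      excluded.\<close>
    have k: "?k > 0"
    proof -
      obtain z where "z \<in> R" using R_ne by blast
      then have "Im z > 0" "?k * Im z > 0" using R_sub unfolding S by auto
      then show ?thesis by (simp add: zero_less_mult_iff)
    qed
    define W where "W = {z. Im z > 0 \<and> 0 < Re z \<and> Re z < ?k * Im z}"
    \<comment> \<open>Otherwise the closure of \<open>R\<close> would stay in the left half and miss
      the ray. Having met \<open>W\<close>, the component contains it because \<open>W\<close> is
      connected.\<close>
    have "{z. Re z > 0} \<inter> R \<noteq> {}"
    proof
      assume "{z. Re z > 0} \<inter> R = {}"
      then have "R \<subseteq> {z. Re z \<le> 0}" by (auto simp: not_less[symmetric])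
      then have "closure R \<subseteq> {z. Re z \<le> 0}" by (rule closure_minimal[OF _ closed_halfspace_Re_le])
      moreover have "ray_point ?k 0 \<in> closure R" using fr by (auto simp: frontier_def)
      ultimately have "ray_point ?k 0 \<in> {z. Re z \<le> 0}" by blast
      then show False using k by simp
    qed
    then obtain z where "z \<in> R" "Re z > 0" by auto
    then have "z \<in> R \<inter> W" using R_sub unfolding S W_def by auto
    then have "R \<inter> W \<noteq> {}" by blast
    moreover have "convex W"
    proof -
      have "W = {z. Im z > 0} \<inter> {z. Re z > 0} \<inter> {z. inner (Complex 1 (- ?k)) z < 0}"
        by (auto simp: W_def inner_complex_def)
      then show ?thesis
        by (auto intro!: convex_Int convex_halfspace_Im_gt convex_halfspace_Re_gt convex_halfspace_lt)
    qed
    moreover have "W \<subseteq> ?S" unfolding S W_def by auto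
    ultimately have W_R: "W \<subseteq> R"
      using R_comp components_maximal convex_connected by blast
    have "\<forall>\<^sub>F \<epsilon> in at_right 0. 0 < \<epsilon> \<and> \<epsilon> < ?k"
      using k by (auto simp: eventually_at_right_field intro!: exI[of _ ?k])
    then show ?thesis
    proof eventually_elim
      case (elim \<epsilon>)
      have "Re (ray_point ?k t + complex_of_real \<epsilon> * (\<i> * ray_point ?k t)) = (?k - \<epsilon>) * exp t"
        "Im (ray_point ?k t + complex_of_real \<epsilon> * (\<i> * ray_point ?k t)) = (1 + \<epsilon> * ?k) * exp t"
        by (simp_all add: algebra_simps)
      moreover have "?k - \<epsilon> < ?k * (1 + \<epsilon> * ?k)"
      proof -
        have "0 < \<epsilon>" "0 \<le> ?k * (\<epsilon> * ?k)" using elim k by auto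
        then show ?thesis by (simp add: algebra_simps add_pos_nonneg)
      qed
      moreover have "1 + \<epsilon> * ?k > 0" using elim k by (simp add: add_pos_pos)
      ultimately have "ray_point ?k t + complex_of_real \<epsilon> * (\<i> * ray_point ?k t) \<in> W"
        using elim unfolding W_def by (simp flip: mult.assoc)
      then show ?case using W_R by blast
    qed
  qed
  moreover have "ray_point ?k t \<noteq> 0" by (simp add: complex_eq_iff)
  ultimately show "\<exists>v. v \<noteq> 0 \<and> (ray_point ?k has_vector_derivative v) (at t) \<and>
      (\<forall>R. region_between J hyp_axis (range (ray_point ?k)) R \<longrightarrow>
        (\<forall>\<^sub>F \<epsilon> in at_right 0. ray_point ?k t + complex_of_real \<epsilon> * (\<i> * v) \<in> R))"
    using ray_point_has_derivative by blast
qed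

text \<open>The vanishing total covers the wraparound: before the least index comes the greatest,
  whose partial sum is the full sum 0.\<close>

lemma cyclic_partial_sums:
  fixes l :: "'n::{finite,linorder} \<Rightarrow> real"
  assumes "(\<Sum>i\<in>UNIV. l i) = 0"
  shows "(\<Sum>j\<in>{..i}. l j) - (\<Sum>j\<in>{..cyc_pred i}. l j) = l i"
proof (cases "i = Min UNIV")
  case True
  have "{..i} = {i}" by (auto simp: True intro: antisym)
  moreover have "{..cyc_pred i} = UNIV" by (auto simp: True cyc_pred_def)
  ultimately show ?thesis using assms by simp
next
  case False
  then have "{j. j < i} \<noteq> {}"
    using Min_le[of UNIV i] Min_in[of "UNIV :: 'n set"] by (auto simp: le_less)
  then have "Max {j. j < i} < i" and "\<And>j. j < i \<Longrightarrow> j \<le> Max {j. j < i}"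
    using Max_in[of "{j. j < i}"] by auto
  then have "{..i} = insert i {..Max {j. j < i}}" and "i \<notin> {..Max {j. j < i}}"
    by (auto simp: le_less not_le dest: le_less_trans)
  then show ?thesis using False by (simp add: cyc_pred_def)
qed

lemma ngon_exists:
  fixes l :: "'n::{finite,linorder} \<Rightarrow> real"
  assumes J: "J \<ge> 0" and n: "CARD('n) \<ge> 2" and l: "\<And>i. l i > 0" "l i0 = (\<Sum>i\<in>UNIV - {i0}. l i)"
  obtains x :: "'n \<Rightarrow> complex" where "equidistant_ngon J x"
    "\<And>i. sinh (side_lengths x $ i / 2) = cosh J * sinh (l i / 2)"
proof -
  \<comment> \<open>The longest projection runs backwards, so the signed steps sum to 0 and their
    partial sums are the positions of the vertices.\<close>
  define l' where "l' = (\<lambda>i. if i = i0 then - l i else l i)"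
  define \<tau> where "\<tau> = (\<lambda>i. \<Sum>j\<in>{..i}. l' j)"
  have "(\<Sum>i\<in>UNIV. l' i) = l' i0 + (\<Sum>i\<in>UNIV - {i0}. l' i)" by (simp add: sum.remove)
  also have "\<dots> = 0" using l(2) by (simp add: l'_def)
  finally have diff: "\<tau> i - \<tau> (cyc_pred i) = l' i" for i
    unfolding \<tau>_def by (rule cyclic_partial_sums)
  have step: "\<tau> (cyc_pred i) < \<tau> i" if "i \<noteq> i0" for i
    using diff[of i] l(1)[of i] that by (simp add: l'_def)
  define x where "x = (\<lambda>i. ray_point (sinh J) (\<tau> i))"
  have "inj \<tau>"
  proof -
    obtain e where e: "bij_betw e {..<CARD('n)} UNIV" "e 0 = i0"
      "\<forall>k. Suc k < CARD('n) \<longrightarrow> cyc_pred (e (Suc k)) = e k" "cyc_pred i0 = e (CARD('n) - 1)"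
      by (rule cyc_pred_enum[of i0])
    define m where "m = CARD('n) - 1"
    have m: "m \<ge> 1" "CARD('n) = Suc m" using n by (auto simp: m_def)
    have e_ne: "e (Suc k) \<noteq> i0" if "k < m" for k
      using e(1,2) m that inj_onD[of e "{..<CARD('n)}" "Suc k" 0] by (auto simp: bij_betw_def)
    have less: "(\<tau> \<circ> e) i < (\<tau> \<circ> e) j" if "i < j" "j \<le> m" for i j
    proof (rule chain_less[OF _ that])
      fix k assume k: "k < m"
      then have "cyc_pred (e (Suc k)) = e k" using e(3) m by simp
      then show "(\<tau> \<circ> e) k < (\<tau> \<circ> e) (Suc k)" using step[OF e_ne[OF k]] by simp
    qed
    have "inj_on (\<tau> \<circ> e) {..<Suc m}"
      by (rule linorder_inj_onI) (use less in \<open>force+\<close>)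
    then have "inj_on \<tau> (e ` {..<Suc m})" by (rule inj_on_imageI)
    then show ?thesis using e(1) m by (simp add: bij_betw_def)
  qed
  then have "inj x" by (auto simp: inj_def x_def ray_point_def)
  then have "equidistant_ngon J x"
    unfolding equidistant_ngon_def
    using J hyp_geodesic_axis ray_component[OF J] ray_positive_param[OF J] step x_def by blast
  moreover have "sinh (side_lengths x $ i / 2) = cosh J * sinh (l i / 2)" for i
  proof -
    have "1 + (sinh J)\<^sup>2 = (cosh J)\<^sup>2" by (simp add: cosh_square_eq)
    then have "sqrt (1 + (sinh J)\<^sup>2) = cosh J" by simp
    moreover have "\<bar>\<tau> i - \<tau> (cyc_pred i)\<bar> = l i" using diff[of i] l(1)[of i] by (auto simp: l'_def)
    ultimately show ?thesis by (simp add: side_lengths_def x_def sinh_half_hyp_dist_ray)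
  qed
  ultimately show ?thesis by (rule that)
qed

section \<open>Calculus\<close>

text \<open>Trades the gradient of the definition for derivative maps, to which the usual derivative
  rules apply; its coordinates are their values on the basis.\<close>

lemma Ck_on_SucI:
  fixes f :: "'a::euclidean_space \<Rightarrow> real"
  assumes "\<And>x. x \<in> S \<Longrightarrow> (f has_derivative f' x) (at x)"
    and "\<And>b. b \<in> Basis \<Longrightarrow> Ck_on k (\<lambda>x. f' x b) S"
  shows "Ck_on (Suc k) f S"
proof -
  define g where "g = (\<lambda>x. \<Sum>b\<in>Basis. f' x b *\<^sub>R b)"
  have gb: "g x \<bullet> b = f' x b" if "b \<in> Basis" for x b
    using that by (simp add: g_def inner_sum_left inner_Basis if_distrib sum.If_cases cong: if_cong)
  have "(f has_derivative (\<lambda>h. g x \<bullet> h)) (at x)" if "x \<in> S" for x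
  proof -
    have "linear (f' x)" using assms(1)[OF that] by (rule has_derivative_linear)
    moreover have "linear (\<lambda>h. g x \<bullet> h)" by (intro bounded_linear.linear bounded_linear_inner_right)
    ultimately have "(\<lambda>h. g x \<bullet> h) = f' x" using gb by (intro linear_eq_stdbasis) auto
    then show ?thesis using assms(1)[OF that] by simp
  qed
  moreover have "Ck_on k (\<lambda>x. g x \<bullet> b) S" if "b \<in> Basis" for b
    using assms(2)[OF that] by (simp add: gb[OF that])
  ultimately show ?thesis by auto
qed

lemma Ck_on_SucE:
  assumes "Ck_on (Suc k) f S"
  obtains f' where "\<And>x. x \<in> S \<Longrightarrow> (f has_derivative f' x) (at x)"
    "\<And>b. b \<in> Basis \<Longrightarrow> Ck_on k (\<lambda>x. f' x b) S"
proof -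
  obtain g where "\<forall>x\<in>S. (f has_derivative (\<lambda>h. g x \<bullet> h)) (at x)" "\<forall>b\<in>Basis. Ck_on k (\<lambda>x. g x \<bullet> b) S"
    using assms by auto
  then show ?thesis by (intro that[of "\<lambda>x h. g x \<bullet> h"]) auto
qed

lemma Ck_on_imp_continuous:
  assumes "Ck_on k f S"
  shows "continuous_on S f"
proof (cases k)
  case (Suc j)
  then show ?thesis
    using assms by (auto intro!: continuous_at_imp_continuous_on dest: has_derivative_continuous)
qed (use assms in simp)

lemma Ck_on_SucD: "Ck_on (Suc k) f S \<Longrightarrow> Ck_on k f S"
proof (induction k arbitrary: f)
  case 0
  then show ?case using Ck_on_imp_continuous by fastforce
next
  case (Suc k)
  from Suc.prems obtain f' where f': "\<And>x. x \<in> S \<Longrightarrow> (f has_derivative f' x) (at x)"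
    "\<And>b. b \<in> Basis \<Longrightarrow> Ck_on (Suc k) (\<lambda>x. f' x b) S" by (rule Ck_on_SucE) blast
  then show ?case using Suc.IH by (intro Ck_on_SucI[of S f f' k]) auto
qed

lemma Ck_on_const: "Ck_on k (\<lambda>x. c) S"
proof (induction k arbitrary: c)
  case (Suc k)
  show ?case by (rule Ck_on_SucI[of S _ "\<lambda>_ _. 0"]) (use Suc in auto)
qed simp

text \<open>Meant for the signs \<open>side_sign (top_index d) i\<close>, which jump in general but
  are locally constant near the side lengths considered.\<close>

lemma Ck_on_locally_const:
  assumes "open S" "\<And>x. x \<in> S \<Longrightarrow> \<forall>\<^sub>F y in nhds x. f y = f x"
  shows "Ck_on k f S"
proof -
  have der: "(f has_derivative (\<lambda>_. 0)) (at x)" if "x \<in> S" for x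
  proof -
    have "\<forall>\<^sub>F y in nhds x. f x = f y" using assms(2)[OF that] by (rule eventually_mono) simp
    then show ?thesis
      using has_derivative_transform_eventually[OF has_derivative_const[of "f x" "at x"], of f]
      by (simp add: eventually_nhds_conv_at)
  qed
  then show ?thesis
  proof (cases k)
    case 0
    then show ?thesis using der by (auto intro!: continuous_at_imp_continuous_on dest: has_derivative_continuous)
  next
    case (Suc j)
    then show ?thesis using der Ck_on_const by (auto simp del: Ck_on.simps intro!: Ck_on_SucI[of S f "\<lambda>_ _. 0"])
  qed
qed

lemma Ck_on_component: "Ck_on k (\<lambda>x :: real ^ 'n. x $ i) S"
proof (cases k)
  case (Suc j)
  show ?thesis unfolding Suc
    by (rule Ck_on_SucI[of S _ "\<lambda>_ h. h $ i"])
      (auto intro!: Ck_on_const bounded_linear_imp_has_derivative bounded_linear_vec_nth)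
qed (simp add: continuous_on_component)

lemma Ck_on_add:
  assumes "Ck_on k f S" "Ck_on k g S"
  shows "Ck_on k (\<lambda>x. f x + g x) S"
  using assms
proof (induction k arbitrary: f g)
  case 0
  then show ?case by (auto intro: continuous_intros)
next
  case (Suc k)
  from Suc.prems(1) obtain f' where f': "\<And>x. x \<in> S \<Longrightarrow> (f has_derivative f' x) (at x)"
    "\<And>b. b \<in> Basis \<Longrightarrow> Ck_on k (\<lambda>x. f' x b) S" by (rule Ck_on_SucE) blast
  from Suc.prems(2) obtain g' where g': "\<And>x. x \<in> S \<Longrightarrow> (g has_derivative g' x) (at x)"
    "\<And>b. b \<in> Basis \<Longrightarrow> Ck_on k (\<lambda>x. g' x b) S" by (rule Ck_on_SucE) blast
  show ?case
    by (rule Ck_on_SucI[of S _ "\<lambda>x h. f' x h + g' x h"])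
      (use f' g' Suc.IH in \<open>auto intro!: has_derivative_add\<close>)
qed

lemma Ck_on_mult:
  assumes "Ck_on k f S" "Ck_on k g S"
  shows "Ck_on k (\<lambda>x. f x * g x) S"
  using assms
proof (induction k arbitrary: f g)
  case 0
  then show ?case by (auto intro: continuous_intros)
next
  case (Suc k)
  from Suc.prems(1) obtain f' where f': "\<And>x. x \<in> S \<Longrightarrow> (f has_derivative f' x) (at x)"
    "\<And>b. b \<in> Basis \<Longrightarrow> Ck_on k (\<lambda>x. f' x b) S" by (rule Ck_on_SucE) blast
  from Suc.prems(2) obtain g' where g': "\<And>x. x \<in> S \<Longrightarrow> (g has_derivative g' x) (at x)"
    "\<And>b. b \<in> Basis \<Longrightarrow> Ck_on k (\<lambda>x. g' x b) S" by (rule Ck_on_SucE) blast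
  have "Ck_on k f S" "Ck_on k g S" using Suc.prems by (auto intro: Ck_on_SucD simp del: Ck_on.simps)
  then show ?case
    by (intro Ck_on_SucI[of S _ "\<lambda>x h. f x * g' x h + f' x h * g x"])
      (use f' g' Suc.IH in \<open>auto intro!: has_derivative_mult Ck_on_add\<close>)
qed

lemma Ck_on_sum:
  assumes "finite I" "\<And>i. i \<in> I \<Longrightarrow> Ck_on k (f i) S"
  shows "Ck_on k (\<lambda>x. \<Sum>i\<in>I. f i x) S"
  using assms by (induction I rule: finite_induct) (auto intro: Ck_on_const Ck_on_add)

text \<open>Regularity is asked of the composition \<phi>' (f x), so the induction hypothesis
  supplies it whenever \<phi>' is expressed through \<phi>, as for exp, inverse and sqrt.\<close>

lemma Ck_on_compose_Suc:
  assumes f: "Ck_on (Suc k) f S" and "\<And>x. x \<in> S \<Longrightarrow> (\<phi> has_real_derivative \<phi>' (f x)) (at (f x))"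
    and "Ck_on k (\<lambda>x. \<phi>' (f x)) S"
  shows "Ck_on (Suc k) (\<lambda>x. \<phi> (f x)) S"
proof -
  from f obtain f' where f': "\<And>x. x \<in> S \<Longrightarrow> (f has_derivative f' x) (at x)"
    "\<And>b. b \<in> Basis \<Longrightarrow> Ck_on k (\<lambda>x. f' x b) S" by (rule Ck_on_SucE) blast
  show ?thesis
  proof (rule Ck_on_SucI[of S _ "\<lambda>x h. \<phi>' (f x) * f' x h"])
    fix x assume "x \<in> S"
    then show "((\<lambda>x. \<phi> (f x)) has_derivative (\<lambda>h. \<phi>' (f x) * f' x h)) (at x)"
      using has_derivative_compose[OF f'(1), of x \<phi> "(*) (\<phi>' (f x))"] assms(2)[of x]
      by (simp add: has_field_derivative_def)
  qed (use f' assms in \<open>auto intro: Ck_on_mult\<close>)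
qed

lemma Ck_on_exp:
  assumes "Ck_on k f S"
  shows "Ck_on k (\<lambda>x. exp (f x)) S"
  using assms
proof (induction k)
  case 0
  then show ?case by (auto intro: continuous_intros)
next
  case (Suc k)
  then show ?case by (intro Ck_on_compose_Suc[of k f S exp exp]) (auto intro: DERIV_exp Ck_on_SucD simp del: Ck_on.simps)
qed

lemma Ck_on_inverse:
  assumes "Ck_on k f S" "\<And>x. x \<in> S \<Longrightarrow> f x \<noteq> 0"
  shows "Ck_on k (\<lambda>x. inverse (f x)) S"
  using assms
proof (induction k)
  case 0
  then show ?case by (auto intro: continuous_intros)
next
  case (Suc k)
  then have "Ck_on k (\<lambda>x. inverse (f x)) S" by (auto intro: Ck_on_SucD simp del: Ck_on.simps)
  from Ck_on_mult[OF Ck_on_const[of k "-1"] Ck_on_mult[OF this this]]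
  have "Ck_on k (\<lambda>x. - (inverse (f x) * inverse (f x))) S" by simp
  then show ?case
    using Suc.prems
    by (intro Ck_on_compose_Suc[of k f S inverse "\<lambda>y. - (inverse y * inverse y)"])
      (auto intro!: derivative_eq_intros simp del: Ck_on.simps)
qed

lemma Ck_on_divide:
  assumes "Ck_on k f S" "Ck_on k g S" "\<And>x. x \<in> S \<Longrightarrow> g x \<noteq> 0"
  shows "Ck_on k (\<lambda>x. f x / g x) S"
  unfolding divide_inverse using assms by (intro Ck_on_mult Ck_on_inverse)

lemma Ck_on_sqrt:
  assumes "Ck_on k f S" "\<And>x. x \<in> S \<Longrightarrow> f x > 0"
  shows "Ck_on k (\<lambda>x. sqrt (f x)) S"
  using assms
proof (induction k)
  case 0
  then show ?case by (auto intro: continuous_intros)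
next
  case (Suc k)
  then have "Ck_on k (\<lambda>x. sqrt (f x)) S" by (auto intro: Ck_on_SucD simp del: Ck_on.simps)
  moreover have "f x \<noteq> 0" if "x \<in> S" for x using Suc.prems(2)[OF that] by simp
  ultimately have "Ck_on k (\<lambda>x. inverse (sqrt (f x)) / 2) S"
    by (intro Ck_on_divide Ck_on_inverse Ck_on_const) auto
  then show ?case
    using Suc.prems
    by (intro Ck_on_compose_Suc[of k f S sqrt "\<lambda>y. inverse (sqrt y) / 2"])
      (auto intro!: DERIV_real_sqrt simp del: Ck_on.simps)
qed

lemma Ck_on_cosh_sinh:
  fixes f :: "'a::euclidean_space \<Rightarrow> real"
  assumes "Ck_on k f S"
  shows "Ck_on k (\<lambda>x. cosh (f x)) S" "Ck_on k (\<lambda>x. sinh (f x)) S"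
proof -
  have minus: "Ck_on k (\<lambda>x. - g x) S" if "Ck_on k g S" for g
    using Ck_on_mult[OF Ck_on_const[of k "-1"] that] by simp
  show "Ck_on k (\<lambda>x. cosh (f x)) S"
    unfolding cosh_field_def using assms minus
    by (intro Ck_on_divide Ck_on_add Ck_on_exp Ck_on_const) auto
  have eq: "(\<lambda>x. sinh (f x)) = (\<lambda>x. (exp (f x) + - exp (- f x)) / 2)" by (simp add: sinh_field_def)
  show "Ck_on k (\<lambda>x. sinh (f x)) S"
    unfolding eq by (intro Ck_on_divide Ck_on_add Ck_on_exp minus Ck_on_const assms) auto
qed

text \<open>Continuity of \<open>u\<close> is assumed, since for \<open>shrink\<close> it comes from
  a sign argument; differentiability of \<open>F\<close> at the single point then suffices. The
  first-order error is at most e1 (r + s), where r and s are the changes of x and u; a small e1 lets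
  s be absorbed, so that s <= K r.\<close>

lemma implicit_function_has_derivative:
  fixes F :: "'a::real_normed_vector \<Rightarrow> real \<Rightarrow> real" and u :: "'a \<Rightarrow> real"
  assumes F: "((\<lambda>(x, y). F x y) has_derivative (\<lambda>(h, k). L h + a * k)) (at (x0, u x0))"
    and a: "a \<noteq> 0" and u: "continuous (at x0) u" and zero: "\<forall>\<^sub>F x in nhds x0. F x (u x) = 0"
  shows "(u has_derivative (\<lambda>h. - L h / a)) (at x0)"
proof -
  have bl: "bounded_linear (\<lambda>(h, k). L h + a * k)" using F by (rule has_derivative_bounded_linear)
  have "bounded_linear (\<lambda>h. (\<lambda>(h, k). L h + a * k) (h, 0))"
    by (rule bounded_linear_compose[OF bl]) (intro bounded_linear_Pair bounded_linear_ident bounded_linear_zero)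
  then have L: "bounded_linear L" by simp
  obtain B where B: "B \<ge> 0" "\<And>h. \<bar>L h\<bar> \<le> norm h * B"
    using bounded_linear.nonneg_bounded[OF L] by auto
  have lin: "bounded_linear (\<lambda>h. - L h / a)"
    using bounded_linear_const_mult[OF L, of "- 1 / a"] by simp
  have zero0: "F x0 (u x0) = 0" using zero by (rule eventually_nhds_x_imp_x)
  have main: "\<exists>d>0. \<forall>x. norm (x - x0) < d \<longrightarrow> norm (u x - u x0 - (- L (x - x0) / a)) \<le> e * norm (x - x0)"
    if e: "e > 0" for e
  proof -
    \<comment> \<open>The Lipschitz constant left after absorbing s, which uses e1 <= |a| / 2. The
      second bound in \<open>e1\<close> makes the final error at most e.\<close>
    define K where "K = 2 * (B + \<bar>a\<bar> / 2) / \<bar>a\<bar>"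
    have K: "K \<ge> 0" using B a by (simp add: K_def)
    define e1 where "e1 = min (\<bar>a\<bar> / 2) (e * \<bar>a\<bar> / (1 + K))"
    have e1: "e1 > 0" "e1 \<le> \<bar>a\<bar> / 2" "e1 * (1 + K) \<le> e * \<bar>a\<bar>"
    proof -
      have "e1 * (1 + K) \<le> e * \<bar>a\<bar> / (1 + K) * (1 + K)"
        using K by (intro mult_right_mono) (auto simp: e1_def)
      then show "e1 * (1 + K) \<le> e * \<bar>a\<bar>" using K by simp
      show "e1 \<le> \<bar>a\<bar> / 2" by (simp only: e1_def min.cobounded1)
    qed (use a e K in \<open>auto simp: e1_def\<close>)
    obtain d1 where d1: "d1 > 0" "\<And>p. norm (p - (x0, u x0)) < d1 \<Longrightarrow>
      norm ((\<lambda>(x, y). F x y) p - (\<lambda>(x, y). F x y) (x0, u x0) - (\<lambda>(h, k). L h + a * k) (p - (x0, u x0)))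
        \<le> e1 * norm (p - (x0, u x0))"
      using F e1(1) unfolding has_derivative_at_alt by blast
    have "\<forall>\<^sub>F x in nhds x0. dist (u x) (u x0) < d1 / 2"
    proof -
      have "\<forall>\<^sub>F x in at x0. dist (u x) (u x0) < d1 / 2"
        by (rule tendstoD[OF u[unfolded continuous_at]]) (use d1(1) in simp)
      then show ?thesis using d1(1) by (simp only: eventually_nhds_conv_at dist_self) simp
    qed
    moreover have "\<forall>\<^sub>F x in nhds x0. dist x x0 < d1 / 2"
      using d1(1) by (intro eventually_nhds_metric[THEN iffD2] exI[of _ "d1 / 2"]) auto
    ultimately have "\<forall>\<^sub>F x in nhds x0. norm (u x - u x0 - (- L (x - x0) / a)) \<le> e * norm (x - x0)"
      using zero
    proof eventually_elim
      case (elim x)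
      define r s where "r = norm (x - x0)" and "s = \<bar>u x - u x0\<bar>"
      have rs: "norm ((x, u x) - (x0, u x0)) \<le> r + s"
        using norm_Pair_le[of "x - x0" "u x - u x0"] by (simp add: r_def s_def)
      then have "norm ((x, u x) - (x0, u x0)) < d1"
        using elim by (simp add: r_def s_def dist_norm)
      from d1(2)[OF this] have "\<bar>L (x - x0) + a * (u x - u x0)\<bar> \<le> e1 * norm ((x, u x) - (x0, u x0))"
        using elim zero0 by simp
      also have "\<dots> \<le> e1 * (r + s)" using rs e1 by (intro mult_left_mono) auto
      finally have est: "\<bar>L (x - x0) + a * (u x - u x0)\<bar> \<le> e1 * (r + s)" .
      have "\<bar>a\<bar> * s \<le> \<bar>L (x - x0) + a * (u x - u x0)\<bar> + \<bar>L (x - x0)\<bar>"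
        unfolding s_def abs_mult[symmetric] by linarith
      also have "\<dots> \<le> e1 * (r + s) + r * B" using est B(2)[of "x - x0"] by (simp add: r_def)
      also have "\<dots> \<le> \<bar>a\<bar> / 2 * (r + s) + r * B"
        using e1 by (intro add_right_mono mult_right_mono) (auto simp: r_def s_def)
      finally have "\<bar>a\<bar> / 2 * s \<le> (B + \<bar>a\<bar> / 2) * r" by (simp add: field_simps)
      then have "s \<le> K * r" using a by (simp add: K_def field_simps)
      then have "e1 * (r + s) \<le> e1 * (1 + K) * r"
        using e1 by (simp add: algebra_simps)
      also have "\<dots> \<le> e * \<bar>a\<bar> * r" using e1 by (intro mult_right_mono) (auto simp: r_def)
      finally have "\<bar>L (x - x0) + a * (u x - u x0)\<bar> \<le> e * r * \<bar>a\<bar>" using est by (simp add: mult_ac)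
      moreover have "u x - u x0 - (- L (x - x0) / a) = (L (x - x0) + a * (u x - u x0)) / a"
        using a by (simp add: field_simps)
      ultimately show ?case using a by (simp add: r_def divide_le_eq)
    qed
    then show ?thesis by (auto simp: eventually_nhds_metric dist_norm)
  qed
  show ?thesis
    unfolding has_derivative_at_alt using lin main by blast
qed

section \<open>Strictly subadditive functions\<close>

lemma strict_subadditive_sum:
  fixes f :: "real \<Rightarrow> real"
  assumes sub: "\<And>x y. x > 0 \<Longrightarrow> y > 0 \<Longrightarrow> f (x + y) < f x + f y"
    and "finite A" "card A \<ge> 2" "\<And>i. i \<in> A \<Longrightarrow> t i > 0"
  shows "f (\<Sum>i\<in>A. t i) < (\<Sum>i\<in>A. f (t i))"
proof -
  have le: "f (\<Sum>i\<in>A. t i) \<le> (\<Sum>i\<in>A. f (t i))" if "finite A" "A \<noteq> {}" "\<And>i. i \<in> A \<Longrightarrow> t i > 0" for A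
    using that
  proof (induction A rule: finite_ne_induct)
    case (insert a A)
    have "f (t a + (\<Sum>i\<in>A. t i)) < f (t a) + f (\<Sum>i\<in>A. t i)"
      using insert by (intro sub sum_pos) auto
    with insert show ?case by simp
  qed simp
  obtain a where a: "a \<in> A" using assms(3) by fastforce
  then have "card (A - {a}) \<ge> 1" using assms(2,3) by simp
  then have ne: "A - {a} \<noteq> {}" by (metis card.empty not_one_le_zero)
  have "f (t a + (\<Sum>i\<in>A - {a}. t i)) < f (t a) + f (\<Sum>i\<in>A - {a}. t i)"
    using assms ne a by (intro sub sum_pos) auto
  also have "\<dots> \<le> f (t a) + (\<Sum>i\<in>A - {a}. f (t i))"
    using le[of "A - {a}"] assms ne by auto
  finally show ?thesis using a assms(2) by (simp add: sum.remove)
qed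

lemma sinh_arsinh_add: "sinh (arsinh x + arsinh y) = x * sqrt (1 + y\<^sup>2) + y * sqrt (1 + x\<^sup>2)" for x y :: real
  by (simp add: sinh_add cosh_arsinh_real add.commute)

lemma arsinh_strict_subadditive:
  fixes x y :: real
  assumes "x > 0" "y > 0"
  shows "arsinh (x + y) < arsinh x + arsinh y"
proof -
  have "x + y < x * sqrt (1 + y\<^sup>2) + y * sqrt (1 + x\<^sup>2)"
    using assms by (intro add_strict_mono) (auto simp: less_eq_real_def)
  then have "sinh (arsinh (x + y)) < sinh (arsinh x + arsinh y)"
    by (simp only: sinh_arsinh_add) simp
  then show ?thesis by (simp only: sinh_real_less_iff)
qed

text \<open>Compare the sinh of both sides by the addition theorem: for r > 1 each factor cosh z is
  replaced by the larger sqrt (1 + (r sinh z)^2).\<close>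

lemma arsinh_sinh_strict_subadditive:
  fixes x y r :: real
  assumes "x > 0" "y > 0" "r > 1"
  shows "arsinh (r * sinh (x + y)) < arsinh (r * sinh x) + arsinh (r * sinh y)"
proof -
  have cosh_less: "cosh z < sqrt (1 + (r * sinh z)\<^sup>2)" if "z > 0" for z
  proof (rule real_less_rsqrt)
    have "(sinh z)\<^sup>2 * 1 < (sinh z)\<^sup>2 * r\<^sup>2"
      using that assms(3) by (intro mult_strict_left_mono) (auto simp: one_less_power)
    then show "(cosh z)\<^sup>2 < 1 + (r * sinh z)\<^sup>2"
      by (simp add: cosh_square_eq power_mult_distrib mult.commute)
  qed
  have "r * sinh (x + y) = r * sinh x * cosh y + r * sinh y * cosh x"
    by (simp add: sinh_add algebra_simps)
  also have "\<dots> < r * sinh x * sqrt (1 + (r * sinh y)\<^sup>2) + r * sinh y * sqrt (1 + (r * sinh x)\<^sup>2)"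
    using assms cosh_less by (intro add_strict_mono mult_strict_left_mono) auto
  finally have "sinh (arsinh (r * sinh (x + y))) < sinh (arsinh (r * sinh x) + arsinh (r * sinh y))"
    by (simp only: sinh_arsinh_add) simp
  then show ?thesis by (simp only: sinh_real_less_iff)
qed

lemma tanh_strict_subadditive:
  fixes x y :: real
  assumes "x > 0" "y > 0"
  shows "tanh (x + y) < tanh x + tanh y"
proof -
  have t: "tanh x > 0" "tanh y > 0" using assms by auto
  have "tanh (x + y) = (tanh x + tanh y) / (1 + tanh x * tanh y)"
    by (rule tanh_add) auto
  also have "\<dots> < tanh x + tanh y"
    using t by (simp add: divide_less_eq add_pos_pos algebra_simps)
  finally show ?thesis .
qed

lemma arctan_strict_subadditive:
  fixes x y :: real
  assumes "x > 0" "y > 0"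
  shows "arctan (x + y) < arctan x + arctan y"
proof -
  define \<phi> where "\<phi> = (\<lambda>t. arctan t + arctan y - arctan (t + y))"
  have "\<phi> 0 < \<phi> x"
  proof (rule DERIV_pos_imp_increasing_open[OF assms(1)])
    fix t assume t: "0 < t" "t < x"
    have "(\<phi> has_real_derivative inverse (1 + t\<^sup>2) - inverse (1 + (t + y)\<^sup>2)) (at t)"
      unfolding \<phi>_def by (auto intro!: derivative_eq_intros)
    moreover have "inverse (1 + t\<^sup>2) - inverse (1 + (t + y)\<^sup>2) > 0"
    proof -
      have "t\<^sup>2 < (t + y)\<^sup>2" using t assms by (intro power_strict_mono) auto
      then show ?thesis by (simp add: less_imp_inverse_less add_pos_nonneg)
    qed
    ultimately show "\<exists>l. (\<phi> has_real_derivative l) (at t) \<and> l > 0" by blast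
  qed (auto simp: \<phi>_def intro!: continuous_intros)
  then show ?thesis by (simp add: \<phi>_def)
qed

text \<open>With k = sinh J these are the areas of Saccheri quadrilaterals with legs J over bases x
  + y, x and y; the difference is the area of the triangle on the three upper vertices.\<close>

lemma saccheri_area_strict_subadditive:
  fixes k x y :: real
  assumes "k > 0" "x > 0" "y > 0"
  shows "2 * arctan (k * tanh ((x + y) / 2)) < 2 * arctan (k * tanh (x / 2)) + 2 * arctan (k * tanh (y / 2))"
proof -
  have "k * tanh ((x + y) / 2) < k * tanh (x / 2) + k * tanh (y / 2)"
    using assms tanh_strict_subadditive[of "x / 2" "y / 2"]
    by (simp add: add_divide_distrib flip: distrib_left)
  then have "arctan (k * tanh ((x + y) / 2)) < arctan (k * tanh (x / 2) + k * tanh (y / 2))"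
    by (simp add: arctan_less_iff)
  also have "\<dots> < arctan (k * tanh (x / 2)) + arctan (k * tanh (y / 2))"
    using assms by (intro arctan_strict_subadditive) auto
  finally show ?thesis by simp
qed

section \<open>The collar radius as a function of the side lengths\<close>

text \<open>The choice is harmless where it is used: under \<open>dominant\<close> the maximum is
  attained only once.\<close>

definition top_index :: "real ^ 'n::finite \<Rightarrow> 'n" where
  "top_index d = (SOME i. \<forall>j. d $ j \<le> d $ i)"

definition side_sign :: "'n \<Rightarrow> 'n \<Rightarrow> real" where
  "side_sign i0 i = (if i = i0 then - 1 else 1)"

text \<open>The weak inequality covers equidistant and horocyclic side lengths together, so that
  limits from one set to the other can be treated uniformly.\<close>

definition dominant :: "'n::finite \<Rightarrow> real ^ 'n \<Rightarrow> bool" where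
  "dominant i0 d \<longleftrightarrow> (\<forall>i. 0 < d $ i) \<and> (\<Sum>i\<in>UNIV - {i0}. sinh (d $ i / 2)) \<le> sinh (d $ i0 / 2)"

text \<open>A polygon with sides \<open>d\<close> and collar radius \<open>J\<close> projects to \<open>\<gamma>\<close> with side lengths
  \<open>2 * arsinh (sinh (d $ i / 2) / cosh J)\<close>, so it closes up iff the excess vanishes at \<open>1 / cosh J\<close>.\<close>

definition excess :: "'n::finite \<Rightarrow> real ^ 'n \<Rightarrow> real \<Rightarrow> real" where
  "excess i0 d v = (\<Sum>i\<in>UNIV. side_sign i0 i * arsinh (v * sinh (d $ i / 2)))"

lemma sum_side_sign:
  fixes f :: "'n::finite \<Rightarrow> real"
  shows "(\<Sum>i\<in>UNIV. side_sign i0 i * f i) = (\<Sum>i\<in>UNIV - {i0}. f i) - f i0"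
proof -
  have "(\<Sum>i\<in>UNIV. side_sign i0 i * f i) = - f i0 + (\<Sum>i\<in>UNIV - {i0}. side_sign i0 i * f i)"
    by (subst sum.remove[of _ i0]) (auto simp: side_sign_def)
  also have "(\<Sum>i\<in>UNIV - {i0}. side_sign i0 i * f i) = (\<Sum>i\<in>UNIV - {i0}. f i)"
    by (intro sum.cong) (auto simp: side_sign_def)
  finally show ?thesis by simp
qed

lemma card_others:
  assumes "CARD('n::finite) \<ge> 3"
  shows "card (UNIV - {i0 :: 'n}) \<ge> 2"
  using assms by simp

lemma sum_strict_member:
  fixes t :: "'n::finite \<Rightarrow> real"
  assumes n: "CARD('n) \<ge> 3" and t: "\<And>i. t i > 0" and j: "j \<noteq> i0"
  shows "t j < (\<Sum>i\<in>UNIV - {i0}. t i)"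
proof -
  have "card (UNIV - {i0} - {j}) \<ge> 1" using n j by simp
  then have "UNIV - {i0} - {j} \<noteq> {}" by (metis card.empty not_one_le_zero)
  then have "(\<Sum>i\<in>UNIV - {i0} - {j}. t i) > 0" using t by (intro sum_pos) auto
  then show ?thesis using j by (subst sum.remove[of _ j]) auto
qed

lemma dominant_less:
  assumes "CARD('n::finite) \<ge> 3" "dominant i0 (d :: real ^ 'n)" "j \<noteq> i0"
  shows "d $ j < d $ i0"
proof -
  have "sinh (d $ j / 2) < sinh (d $ i0 / 2)"
    using sum_strict_member[OF assms(1), of "\<lambda>i. sinh (d $ i / 2)" j i0] assms
    unfolding dominant_def by (metis half_gt_zero less_le_trans sinh_real_pos_iff)
  then show ?thesis by simp
qed

lemma top_index_eqI:
  assumes "\<And>j. j \<noteq> i0 \<Longrightarrow> d $ j < d $ i0"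
  shows "top_index d = i0"
  unfolding top_index_def
proof (rule some_equality)
  show "\<forall>j. d $ j \<le> d $ i0" using assms by (metis less_imp_le order_refl)
  fix i assume "\<forall>j. d $ j \<le> d $ i"
  then show "i = i0" using assms by (metis not_less)
qed

lemma top_index_maximal:
  assumes "CARD('n::finite) \<ge> 3" "dominant (top_index d) (d :: real ^ 'n)" "\<forall>j. d $ j \<le> d $ i0"
  shows "i0 = top_index d"
  using dominant_less[OF assms(1,2), of i0] assms(3) by (metis not_less)

lemma equidistant_set_iff:
  assumes n: "CARD('n::{finite,linorder}) \<ge> 3"
  shows "(d :: real ^ 'n::{finite,linorder}) \<in> equidistant_set \<longleftrightarrow> dominant (top_index d) d \<and>
    (\<Sum>i\<in>UNIV - {top_index d}. sinh (d $ i / 2)) < sinh (d $ top_index d / 2) \<and>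
    d $ top_index d \<le> (\<Sum>i\<in>UNIV - {top_index d}. d $ i)" (is "_ \<longleftrightarrow> ?R")
proof
  assume "d \<in> equidistant_set"
  then obtain i0 where i0: "\<forall>i. d $ i > 0" "sinh (d $ i0 / 2) > (\<Sum>i\<in>UNIV - {i0}. sinh (d $ i / 2))"
    "d $ i0 \<le> (\<Sum>i\<in>UNIV - {i0}. d $ i)" by (auto simp: equidistant_set_def)
  then have "dominant i0 d" by (auto simp: dominant_def)
  then have "top_index d = i0" using dominant_less[OF n] by (intro top_index_eqI) auto
  then show ?R using i0 by (auto simp: dominant_def)
qed (auto simp: equidistant_set_def dominant_def)

lemma horocyclic_set_iff:
  assumes n: "CARD('n::{finite,linorder}) \<ge> 3"
  shows "(d :: real ^ 'n::{finite,linorder}) \<in> horocyclic_set \<longleftrightarrow> dominant (top_index d) d \<and>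
    (\<Sum>i\<in>UNIV - {top_index d}. sinh (d $ i / 2)) = sinh (d $ top_index d / 2)" (is "_ \<longleftrightarrow> ?R")
proof
  assume "d \<in> horocyclic_set"
  then obtain i0 where i0: "\<forall>i. d $ i > 0" "sinh (d $ i0 / 2) = (\<Sum>i\<in>UNIV - {i0}. sinh (d $ i / 2))"
    by (auto simp: horocyclic_set_def)
  then have "dominant i0 d" by (auto simp: dominant_def)
  then have "top_index d = i0" using dominant_less[OF n] by (intro top_index_eqI) auto
  then show ?R using i0 by (auto simp: dominant_def)
next
  assume ?R
  then show "d \<in> horocyclic_set"
    using dominant_less[OF n] unfolding horocyclic_set_def
    by (auto simp: dominant_def intro!: exI[of _ "top_index d"]) (metis less_imp_le order_refl dominant_def)
qed

lemma equidistant_horocyclic_disjoint: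
  assumes n: "CARD('n::{finite,linorder}) \<ge> 3"
  shows "(equidistant_set :: (real ^ 'n::{finite,linorder}) set) \<inter> horocyclic_set = {}"
  using equidistant_set_iff[OF n] horocyclic_set_iff[OF n] by force

text \<open>Passing from v to w applies z -> arsinh (r sinh z), r = w / v, to every term; this map
  is increasing and strictly subadditive. It stands in for monotonicity of the excess and makes the
  positive root unique.\<close>

lemma excess_pos_mono:
  assumes n: "CARD('n::finite) \<ge> 3" and pos: "\<And>i. (d :: real ^ 'n) $ i > 0"
    and v: "0 < v" "v < w" and "excess i0 d v \<ge> 0"
  shows "excess i0 d w > 0"
proof -
  define a where "a = (\<lambda>i. arsinh (v * sinh (d $ i / 2)))"
  have a: "a i > 0" for i using v pos by (simp add: a_def)
  define r where "r = w / v"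
  have r: "r > 1" using v by (simp add: r_def)
  have ra: "r * sinh (a i) = w * sinh (d $ i / 2)" for i
    using v by (simp add: a_def r_def)
  have "a i0 \<le> (\<Sum>i\<in>UNIV - {i0}. a i)"
    using assms(5) unfolding excess_def sum_side_sign by (simp add: a_def)
  then have "arsinh (r * sinh (a i0)) \<le> arsinh (r * sinh (\<Sum>i\<in>UNIV - {i0}. a i))"
    using r by (simp add: not_less[symmetric])
  also have "\<dots> < (\<Sum>i\<in>UNIV - {i0}. arsinh (r * sinh (a i)))"
    using strict_subadditive_sum[of "\<lambda>z. arsinh (r * sinh z)" "UNIV - {i0}" a] arsinh_sinh_strict_subadditive r
      card_others[OF n] a by auto
  finally show ?thesis unfolding excess_def sum_side_sign ra by simp
qed

lemma excess_horocyclic: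
  assumes n: "CARD('n::finite) \<ge> 3" and pos: "\<And>i. (d :: real ^ 'n) $ i > 0"
    and eq: "(\<Sum>i\<in>UNIV - {i0}. sinh (d $ i / 2)) = sinh (d $ i0 / 2)" and "v > 0"
  shows "excess i0 d v > 0"
proof -
  have "arsinh (v * sinh (d $ i0 / 2)) = arsinh (\<Sum>i\<in>UNIV - {i0}. v * sinh (d $ i / 2))"
    by (simp add: eq[symmetric] sum_distrib_left)
  also have "\<dots> < (\<Sum>i\<in>UNIV - {i0}. arsinh (v * sinh (d $ i / 2)))"
    using strict_subadditive_sum[of arsinh "UNIV - {i0}" "\<lambda>i. v * sinh (d $ i / 2)"] arsinh_strict_subadditive
      card_others[OF n] pos assms(4) by auto
  finally show ?thesis unfolding excess_def sum_side_sign by simp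
qed

lemma continuous_excess: "continuous_on UNIV (excess i0 d)"
  unfolding excess_def by (intro continuous_intros)

lemma excess_at_1:
  "excess i0 d 1 = ((\<Sum>i\<in>UNIV - {i0}. d $ i) - d $ i0) / 2"
  unfolding excess_def sum_side_sign
  by (simp add: arsinh_sinh_real sum_divide_distrib[symmetric] diff_divide_distrib)

text \<open>The two hypotheses control the two ends: the first makes the slope at 0 negative, the
  second makes the value at 1 nonnegative.\<close>

lemma excess_root_exists:
  assumes "(\<Sum>i\<in>UNIV - {i0}. sinh (d $ i / 2)) < sinh (d $ i0 / 2)" "d $ i0 \<le> (\<Sum>i\<in>UNIV - {i0}. d $ i)"
  shows "\<exists>v. 0 < v \<and> v \<le> 1 \<and> excess i0 d v = 0"
proof -
  have "(excess i0 d has_real_derivative (\<Sum>i\<in>UNIV. side_sign i0 i * sinh (d $ i / 2))) (at 0)"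
    unfolding excess_def
  proof (intro DERIV_sum DERIV_cmult)
    fix i
    have "((\<lambda>v. v * sinh (d $ i / 2)) has_real_derivative sinh (d $ i / 2)) (at 0)"
      by (auto intro!: derivative_eq_intros)
    from DERIV_chain2[OF arsinh_real_has_field_derivative this]
    show "((\<lambda>v. arsinh (v * sinh (d $ i / 2))) has_real_derivative sinh (d $ i / 2)) (at 0)" by simp
  qed
  moreover have "(\<Sum>i\<in>UNIV. side_sign i0 i * sinh (d $ i / 2)) < 0"
    unfolding sum_side_sign using assms(1) by simp
  ultimately obtain \<delta> where \<delta>: "\<delta> > 0" "\<And>h. 0 < h \<Longrightarrow> h < \<delta> \<Longrightarrow> excess i0 d (0 + h) < excess i0 d 0"
    using DERIV_neg_dec_right by blast
  define v where "v = min (\<delta> / 2) (1 / 2)"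
  have v: "0 < v" "v < \<delta>" "v \<le> 1" using \<delta>(1) by (auto simp: v_def min_def)
  have "excess i0 d 0 = 0" by (simp add: excess_def)
  then have "excess i0 d v \<le> 0" using \<delta>(2)[of v] v by simp
  moreover have "excess i0 d 1 \<ge> 0" using assms(2) by (simp add: excess_at_1)
  ultimately obtain w where "v \<le> w" "w \<le> 1" "excess i0 d w = 0"
    using IVT'[of "excess i0 d" v 0 1] continuous_on_subset[OF continuous_excess] v by auto
  then show ?thesis using v by (intro exI[of _ w]) auto
qed

text \<open>\<open>shrink d\<close> is \<open>1 / cosh J\<close>; on \<open>horocyclic_set\<close>, where the collar radius has become infinite, it is 0.\<close>

definition shrink :: "real ^ 'n::{finite,linorder} \<Rightarrow> real" where
  "shrink d = (if d \<in> horocyclic_set then 0 else THE v. 0 < v \<and> excess (top_index d) d v = 0)"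

lemma shrink_eqI:
  assumes n: "CARD('n::{finite,linorder}) \<ge> 3" and d: "(d :: real ^ 'n::{finite,linorder}) \<in> equidistant_set"
    and v: "v > 0" "excess (top_index d) d v = 0"
  shows "shrink d = v"
proof -
  have pos: "\<And>i. d $ i > 0" using d by (auto simp: equidistant_set_def)
  have "(THE v. 0 < v \<and> excess (top_index d) d v = 0) = v"
  proof (rule the_equality)
    fix w assume w: "0 < w \<and> excess (top_index d) d w = 0"
    then show "w = v"
      using excess_pos_mono[OF n pos, of v w "top_index d"] excess_pos_mono[OF n pos, of w v "top_index d"] v
      by (cases "v < w"; cases "w < v") auto
  qed (use v in auto)
  moreover have "d \<notin> horocyclic_set" using equidistant_horocyclic_disjoint[OF n] d by auto
  ultimately show ?thesis by (simp add: shrink_def)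
qed

lemma shrink_root:
  assumes n: "CARD('n::{finite,linorder}) \<ge> 3" and d: "(d :: real ^ 'n::{finite,linorder}) \<in> equidistant_set"
  shows "0 < shrink d" "shrink d \<le> 1" "excess (top_index d) d (shrink d) = 0"
proof -
  obtain v where v: "0 < v" "v \<le> 1" "excess (top_index d) d v = 0"
    using excess_root_exists[of d "top_index d"] equidistant_set_iff[OF n] d by blast
  then show "0 < shrink d" "shrink d \<le> 1" "excess (top_index d) d (shrink d) = 0"
    using shrink_eqI[OF n d] by auto
qed

lemma shrink_horocyclic: "d \<in> horocyclic_set \<Longrightarrow> shrink d = 0"
  by (simp add: shrink_def)

lemma shrink_bounds:
  assumes "CARD('n::{finite,linorder}) \<ge> 3" "(d :: real ^ 'n::{finite,linorder}) \<in> equidistant_set \<union> horocyclic_set"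
  shows "0 \<le> shrink d" "shrink d \<le> 1"
  using assms shrink_root[OF assms(1), of d] shrink_horocyclic[of d] by auto

lemma excess_sign:
  assumes n: "CARD('n::{finite,linorder}) \<ge> 3" and d: "(d :: real ^ 'n::{finite,linorder}) \<in> equidistant_set \<union> horocyclic_set"
    and v: "v > 0"
  shows "v < shrink d \<Longrightarrow> excess (top_index d) d v < 0" "shrink d < v \<Longrightarrow> excess (top_index d) d v > 0"
proof -
  have pos: "\<And>i. d $ i > 0" using d by (auto simp: equidistant_set_def horocyclic_set_def)
  show "excess (top_index d) d v < 0" if "v < shrink d"
  proof (cases "d \<in> equidistant_set")
    case True
    then show ?thesis
      using excess_pos_mono[OF n pos v that, of "top_index d"] shrink_root[OF n True] by (auto simp: not_less[symmetric])
  next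
    case False
    then show ?thesis using d that v shrink_horocyclic[of d] by auto
  qed
  show "excess (top_index d) d v > 0" if "shrink d < v"
  proof (cases "d \<in> equidistant_set")
    case True
    then show ?thesis using excess_pos_mono[OF n pos _ that, of "top_index d"] shrink_root[OF n True] by auto
  next
    case False
    then have "d \<in> horocyclic_set" using d by auto
    then show ?thesis using excess_horocyclic[OF n pos _ v] horocyclic_set_iff[OF n] by blast
  qed
qed

section \<open>Continuity of the collar parameter and of the area formula\<close>

lemma eventually_top_index:
  assumes n: "CARD('n::finite) \<ge> 3" and d: "dominant (top_index d) (d :: real ^ 'n)"
  shows "\<forall>\<^sub>F e in nhds d. top_index e = top_index d"
proof -
  have "\<forall>\<^sub>F e in nhds d. e $ j < e $ top_index d" if "j \<noteq> top_index d" for j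
  proof -
    have "open {e :: real ^ 'n. e $ j < e $ top_index d}"
      by (intro open_Collect_less continuous_intros)
    then show ?thesis using dominant_less[OF n d that] by (auto simp: eventually_nhds)
  qed
  then have "\<forall>\<^sub>F e in nhds d. \<forall>j. j \<noteq> top_index d \<longrightarrow> e $ j < e $ top_index d"
    by (auto intro!: eventually_all_finite)
  then show ?thesis by (rule eventually_mono) (auto intro: top_index_eqI)
qed

lemma dominant_top_index:
  assumes "CARD('n::{finite,linorder}) \<ge> 3" "(d :: real ^ 'n::{finite,linorder}) \<in> equidistant_set \<union> horocyclic_set"
  shows "dominant (top_index d) d"
  using assms(2) equidistant_set_iff[OF assms(1), of d] horocyclic_set_iff[OF assms(1), of d] by auto

lemma continuous_on_shrink:
  assumes n: "CARD('n::{finite,linorder}) \<ge> 3"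
  shows "continuous_on (equidistant_set \<union> horocyclic_set :: (real ^ 'n::{finite,linorder}) set) shrink"
  unfolding continuous_on_def
proof
  let ?Z = "equidistant_set \<union> horocyclic_set :: (real ^ 'n::{finite,linorder}) set"
  fix d :: "real ^ 'n::{finite,linorder}" assume d: "d \<in> ?Z"
  let ?F = "at d within ?Z"
  have top: "\<forall>\<^sub>F e in ?F. top_index e = top_index d"
    using eventually_top_index[OF n dominant_top_index[OF n d]]
    unfolding eventually_at_filter by (rule eventually_mono) simp
  have Z: "\<forall>\<^sub>F e in ?F. e \<in> ?Z" by (simp add: eventually_at_filter)
  have cont: "((\<lambda>e. excess (top_index d) e v) \<longlongrightarrow> excess (top_index d) d v) ?F" for v
    unfolding excess_def by (intro tendsto_intros) auto
  show "(shrink \<longlongrightarrow> shrink d) ?F"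
  proof (rule order_tendstoI)
    fix a assume a: "a < shrink d"
    show "\<forall>\<^sub>F e in ?F. a < shrink e"
    \<comment> \<open>\<open>excess_sign\<close> speaks of positive arguments only; below 0 the
      bound 0 <= \<open>shrink e\<close> is enough.\<close>
    proof (cases "a < 0")
      case True
      show ?thesis using Z by eventually_elim (use True shrink_bounds(1)[OF n] in \<open>auto intro: less_le_trans\<close>)
    next
      case False
      obtain v where v: "a < v" "v < shrink d" using a dense by blast
      then have "excess (top_index d) d v < 0" using excess_sign(1)[OF n d] False by auto
      from order_tendstoD(2)[OF cont this] show ?thesis using top Z
      proof eventually_elim
        case (elim e)
        have "\<not> shrink e < v" using excess_sign(2)[OF n elim(3), of v] elim False v by auto
        then show ?case using v by simp
      qed
    qed
  next
    fix a assume a: "shrink d < a"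
    obtain v where v: "shrink d < v" "v < a" using a dense by blast
    have v0: "v > 0" using v shrink_bounds(1)[OF n d] by simp
    then have "excess (top_index d) d v > 0" using excess_sign(2)[OF n d] v by auto
    from order_tendstoD(1)[OF cont this] show "\<forall>\<^sub>F e in ?F. shrink e < a" using top Z
    proof eventually_elim
      case (elim e)
      have "\<not> v < shrink e" using excess_sign(1)[OF n elim(3) v0] elim by auto
      then show ?case using v by simp
    qed
  qed
qed

text \<open>The square root is tanh J. This form still makes sense at \<open>shrink d = 0\<close>,
  so the same function provides the extension to the horocyclic set.\<close>

definition area_formula :: "real ^ 'n::{finite,linorder} \<Rightarrow> real" where
  "area_formula d = (\<Sum>i\<in>UNIV. side_sign (top_index d) i * (2 * arcsin (sqrt (1 - (shrink d)\<^sup>2) * tanh (d $ i / 2))))"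

lemma sqrt_mult_tanh_bounds:
  fixes u x :: real
  assumes "0 \<le> u" "u \<le> 1"
  shows "- 1 < sqrt (1 - u\<^sup>2) * tanh x" "sqrt (1 - u\<^sup>2) * tanh x < 1"
proof -
  have "sqrt (1 - u\<^sup>2) \<le> 1" "sqrt (1 - u\<^sup>2) \<ge> 0"
    using assms by (auto simp: power_le_one)
  then have "\<bar>sqrt (1 - u\<^sup>2) * tanh x\<bar> \<le> 1 * \<bar>tanh x\<bar>"
    unfolding abs_mult by (intro mult_right_mono) auto
  also have "\<dots> < 1" using tanh_real_lt_1[of x] tanh_real_gt_neg1[of x] by auto
  finally show "- 1 < sqrt (1 - u\<^sup>2) * tanh x" "sqrt (1 - u\<^sup>2) * tanh x < 1" by auto
qed

lemma continuous_on_area_formula: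
  assumes n: "CARD('n::{finite,linorder}) \<ge> 3"
  shows "continuous_on (equidistant_set \<union> horocyclic_set :: (real ^ 'n::{finite,linorder}) set) area_formula"
  unfolding continuous_on_def
proof
  let ?Z = "equidistant_set \<union> horocyclic_set :: (real ^ 'n::{finite,linorder}) set"
  fix d :: "real ^ 'n::{finite,linorder}" assume d: "d \<in> ?Z"
  let ?F = "at d within ?Z"
  have top: "\<forall>\<^sub>F e in ?F. top_index e = top_index d"
    using eventually_top_index[OF n dominant_top_index[OF n d]]
    unfolding eventually_at_filter by (rule eventually_mono) simp
  have u: "(shrink \<longlongrightarrow> shrink d) ?F" using continuous_on_shrink[OF n] d by (auto simp: continuous_on_def)
  have "((\<lambda>e. \<Sum>i\<in>UNIV. side_sign (top_index d) i * (2 * arcsin (sqrt (1 - (shrink e)\<^sup>2) * tanh (e $ i / 2))))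
    \<longlongrightarrow> area_formula d) ?F"
    unfolding area_formula_def
  proof (intro tendsto_sum tendsto_mult tendsto_const)
    fix i
    have "((\<lambda>e. sqrt (1 - (shrink e)\<^sup>2) * tanh (e $ i / 2)) \<longlongrightarrow> sqrt (1 - (shrink d)\<^sup>2) * tanh (d $ i / 2)) ?F"
      by (intro tendsto_intros u) auto
    moreover have "isCont arcsin (sqrt (1 - (shrink d)\<^sup>2) * tanh (d $ i / 2))"
      using sqrt_mult_tanh_bounds[OF shrink_bounds[OF n d]] by (intro isCont_arcsin)
    ultimately show "((\<lambda>e. arcsin (sqrt (1 - (shrink e)\<^sup>2) * tanh (e $ i / 2))) \<longlongrightarrow>
        arcsin (sqrt (1 - (shrink d)\<^sup>2) * tanh (d $ i / 2))) ?F"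
      by (rule isCont_tendsto_compose[rotated])
  qed
  then show "(area_formula \<longlongrightarrow> area_formula d) ?F"
    by (rule Lim_transform_eventually) (use top in \<open>auto simp: area_formula_def elim!: eventually_mono\<close>)
qed

section \<open>The area as a function of the side lengths\<close>

lemma arctan_eq_arcsin: "arctan y = arcsin (y / sqrt (1 + y\<^sup>2))"
  using arctan_bounded[of y] by (simp add: sin_arctan[symmetric] arcsin_sin)

lemma one_minus_inverse_cosh_sq:
  fixes J :: real
  shows "1 - (1 / cosh J)\<^sup>2 = (tanh J)\<^sup>2"
  by (simp add: tanh_def power_divide sinh_square_eq diff_divide_distrib)

text \<open>With y = sinh J tanh (l/2), the ratio cosh (d/2) / cosh (l/2) equals sqrt (1 + y^2), and
  y divided by it, the sine of arctan y, is tanh J tanh (d/2).\<close>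

lemma saccheri_area_eq:
  fixes J l d :: real
  assumes J: "J \<ge> 0" and eq: "sinh (d / 2) = cosh J * sinh (l / 2)"
  shows "2 * arctan (sinh J * tanh (l / 2)) = 2 * arcsin (sqrt (1 - (1 / cosh J)\<^sup>2) * tanh (d / 2))"
proof -
  define y where "y = sinh J * tanh (l / 2)"
  have "(cosh (d / 2))\<^sup>2 = (cosh (l / 2))\<^sup>2 * (1 + y\<^sup>2)"
  proof -
    have "(cosh (l / 2))\<^sup>2 * (1 + y\<^sup>2) = (cosh (l / 2))\<^sup>2 + (sinh J)\<^sup>2 * (sinh (l / 2))\<^sup>2"
      by (simp add: y_def tanh_def power_mult_distrib power_divide distrib_left)
    also have "\<dots> = 1 + (sinh (d / 2))\<^sup>2"
      unfolding eq power_mult_distrib cosh_square_eq by (simp add: algebra_simps)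
    finally show ?thesis by (simp add: cosh_square_eq)
  qed
  then have "sqrt ((cosh (d / 2))\<^sup>2) = sqrt ((cosh (l / 2))\<^sup>2 * (1 + y\<^sup>2))" by simp
  then have c: "cosh (d / 2) = cosh (l / 2) * sqrt (1 + y\<^sup>2)" by (simp add: real_sqrt_mult)
  have "sqrt (1 - (1 / cosh J)\<^sup>2) * tanh (d / 2) = tanh J * tanh (d / 2)"
    using J by (simp add: one_minus_inverse_cosh_sq)
  also have "\<dots> = y / sqrt (1 + y\<^sup>2)"
    unfolding tanh_def[of "d / 2"] c eq by (simp add: y_def tanh_def)
  finally show ?thesis by (simp add: arctan_eq_arcsin[of y] flip: y_def)
qed

text \<open>The projections of any polygon with these sides close up, so 1 / cosh J is a root of the
  excess, and the root is unique. Hence the sides determine both J and the area, as the definite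
  descriptions require.\<close>

lemma ngon_shrink_area:
  fixes d :: "real ^ 'n::{finite,linorder}"
  assumes n: "CARD('n) \<ge> 3" and d: "d \<in> equidistant_set"
    and ngon: "equidistant_ngon J x" and sides: "side_lengths x = d"
  shows "shrink d = 1 / cosh J" "measure hyp_area (hyp_convex hull (range x)) = area_formula d"
    "area_formula d \<ge> 0" "area_formula d = 0 \<longleftrightarrow> J = 0"
proof -
  have J: "J \<ge> 0" using ngon by (simp add: equidistant_ngon_def)
  have "CARD('n) \<ge> 2" using n by simp
  then obtain i0 l where l: "\<And>i. l i > 0" "l i0 = (\<Sum>i\<in>UNIV - {i0}. l i)"
    "\<And>i. sinh (side_lengths x $ i / 2) = cosh J * sinh (l i / 2)"
    "measure hyp_area (hyp_convex hull (range x)) =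
      \<bar>(\<Sum>i\<in>UNIV - {i0}. 2 * arctan (sinh J * tanh (l i / 2))) - 2 * arctan (sinh J * tanh (l i0 / 2))\<bar>"
    using ngon_geometry[OF ngon] by metis
  have sinh: "sinh (d $ i / 2) = cosh J * sinh (l i / 2)" for i using l(3) sides by simp
  have top: "top_index d = i0"
  proof (rule top_index_eqI)
    fix j assume "j \<noteq> i0"
    then have "l j < l i0" unfolding l(2) by (rule sum_strict_member[OF n l(1)])
    then have "sinh (d $ j / 2) < sinh (d $ i0 / 2)" unfolding sinh by simp
    then show "d $ j < d $ i0" by simp
  qed
  have "excess i0 d (1 / cosh J) = (\<Sum>i\<in>UNIV - {i0}. l i / 2) - l i0 / 2"
    unfolding excess_def sum_side_sign sinh by (simp add: arsinh_sinh_real)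
  also have "\<dots> = 0" using l(2) by (simp add: sum_divide_distrib[symmetric])
  finally show shrink: "shrink d = 1 / cosh J"
    using top by (intro shrink_eqI[OF n d]) auto
  define A where "A = (\<lambda>t. 2 * arctan (sinh J * tanh (t / 2)))"
  have A: "area_formula d = (\<Sum>i\<in>UNIV - {i0}. A (l i)) - A (l i0)"
    unfolding area_formula_def sum_side_sign top shrink A_def saccheri_area_eq[OF J sinh] ..
  \<comment> \<open>Strict subadditivity over the n - 1 shorter sides settles the sign inside the
    absolute value.\<close>
  have pos: "area_formula d > 0" if "J \<noteq> 0"
  proof -
    have "sinh J > 0" using J that by simp
    then have "A (\<Sum>i\<in>UNIV - {i0}. l i) < (\<Sum>i\<in>UNIV - {i0}. A (l i))"
      using card_others[OF n] l(1) saccheri_area_strict_subadditive unfolding A_def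
      by (intro strict_subadditive_sum) auto
    then show ?thesis using A l(2) by simp
  qed
  moreover have zero: "area_formula d = 0" if "J = 0" using A that by (simp add: A_def)
  ultimately show "area_formula d \<ge> 0" "area_formula d = 0 \<longleftrightarrow> J = 0" by fastforce+
  then show "measure hyp_area (hyp_convex hull (range x)) = area_formula d"
    using l(4) A by (simp add: A_def)
qed

lemma ngon_for_sides:
  fixes d :: "real ^ 'n::{finite,linorder}"
  assumes n: "CARD('n) \<ge> 3" and d: "d \<in> equidistant_set"
  obtains x where "equidistant_ngon (arcosh (1 / shrink d)) x" "side_lengths x = d"
proof -
  note u = shrink_root[OF n d]
  define J where "J = arcosh (1 / shrink d)"
  have J: "J \<ge> 0" "cosh J = 1 / shrink d" using u by (auto simp: J_def cosh_arcosh_real)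
  define l where "l = (\<lambda>i. 2 * arsinh (shrink d * sinh (d $ i / 2)))"
  have pos: "d $ i > 0" for i using d by (auto simp: equidistant_set_def)
  have l: "l i > 0" for i using u pos by (simp add: l_def)
  have "(\<Sum>i\<in>UNIV - {top_index d}. arsinh (shrink d * sinh (d $ i / 2))) = arsinh (shrink d * sinh (d $ top_index d / 2))"
    using u(3) unfolding excess_def sum_side_sign by simp
  then have l0: "l (top_index d) = (\<Sum>i\<in>UNIV - {top_index d}. l i)"
    by (simp add: l_def flip: sum_distrib_left)
  have "CARD('n) \<ge> 2" using n by simp
  from ngon_exists[OF J(1) this l l0]
  obtain x where x: "equidistant_ngon J x" "\<And>i. sinh (side_lengths x $ i / 2) = cosh J * sinh (l i / 2)"
    by metis
  have "sinh (side_lengths x $ i / 2) = sinh (d $ i / 2)" for i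
    using u(1) by (simp add: x(2) J(2) l_def)
  then have "side_lengths x = d" by (simp add: vec_eq_iff)
  then show ?thesis using that x(1) by (simp add: J_def)
qed

lemma arcosh_inverse_shrink:
  assumes "CARD('n::{finite,linorder}) \<ge> 3" "(d :: real ^ 'n::{finite,linorder}) \<in> equidistant_set"
    "equidistant_ngon J x" "side_lengths x = d"
  shows "J = arcosh (1 / shrink d)"
proof -
  have "J \<ge> 0" using assms(3) by (simp add: equidistant_ngon_def)
  then show ?thesis using ngon_shrink_area(1)[OF assms] by (simp add: arcosh_cosh_real)
qed

lemma collar_radius_eq:
  assumes n: "CARD('n::{finite,linorder}) \<ge> 3" and d: "(d :: real ^ 'n::{finite,linorder}) \<in> equidistant_set"
  shows "collar_radius d = arcosh (1 / shrink d)"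
proof -
  obtain x where x: "equidistant_ngon (arcosh (1 / shrink d)) x" "side_lengths x = d"
    using ngon_for_sides[OF n d] by blast
  show ?thesis
    unfolding collar_radius_def
  proof (rule the_equality)
    show "\<exists>x. equidistant_ngon (arcosh (1 / shrink d)) x \<and> side_lengths x = d" using x by blast
    show "J = arcosh (1 / shrink d)" if "\<exists>x. equidistant_ngon J x \<and> side_lengths x = d" for J
      using that arcosh_inverse_shrink[OF n d] by blast
  qed
qed

lemma equidistant_area_eq:
  assumes n: "CARD('n::{finite,linorder}) \<ge> 3" and d: "(d :: real ^ 'n::{finite,linorder}) \<in> equidistant_set"
  shows "equidistant_area d = area_formula d"
proof -
  obtain x where x: "equidistant_ngon (arcosh (1 / shrink d)) x" "side_lengths x = d"
    using ngon_for_sides[OF n d] by blast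
  show ?thesis
    unfolding equidistant_area_def
  proof (rule the_equality)
    show "\<exists>J x. equidistant_ngon J x \<and> side_lengths x = d \<and> area_formula d = measure hyp_area (hyp_convex hull (range x))"
      using x ngon_shrink_area(2)[OF n d x, symmetric] by blast
    show "a = area_formula d"
      if "\<exists>J x. equidistant_ngon J x \<and> side_lengths x = d \<and> a = measure hyp_area (hyp_convex hull (range x))" for a
      using that ngon_shrink_area(2)[OF n d] by blast
  qed
qed

lemma shrink_eq_1_iff:
  assumes n: "CARD('n::{finite,linorder}) \<ge> 3" and d: "(d :: real ^ 'n::{finite,linorder}) \<in> equidistant_set"
  shows "shrink d = 1 \<longleftrightarrow> d $ top_index d = (\<Sum>i\<in>UNIV - {top_index d}. d $ i)"
proof
  assume "shrink d = 1"
  then show "d $ top_index d = (\<Sum>i\<in>UNIV - {top_index d}. d $ i)"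
    using shrink_root(3)[OF n d] excess_at_1[of "top_index d" d] by simp
next
  assume "d $ top_index d = (\<Sum>i\<in>UNIV - {top_index d}. d $ i)"
  then show "shrink d = 1"
    by (intro shrink_eqI[OF n d]) (auto simp: excess_at_1)
qed

lemma area_formula_zero_iff:
  assumes n: "CARD('n::{finite,linorder}) \<ge> 3" and d: "(d :: real ^ 'n::{finite,linorder}) \<in> equidistant_set"
  shows "area_formula d \<ge> 0" "area_formula d = 0 \<longleftrightarrow> (\<exists>i0. d $ i0 = (\<Sum>i\<in>UNIV - {i0}. d $ i))"
proof -
  obtain x where x: "equidistant_ngon (arcosh (1 / shrink d)) x" "side_lengths x = d"
    using ngon_for_sides[OF n d] by blast
  note u = shrink_root[OF n d]
  show "area_formula d \<ge> 0" by (rule ngon_shrink_area(3)[OF n d x])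
  have "area_formula d = 0 \<longleftrightarrow> arcosh (1 / shrink d) = 0" by (rule ngon_shrink_area(4)[OF n d x])
  also have "\<dots> \<longleftrightarrow> shrink d = 1"
    using u cosh_arcosh_real[of "1 / shrink d"] by (auto simp: arcosh_1)
  also have "\<dots> \<longleftrightarrow> (\<exists>i0. d $ i0 = (\<Sum>i\<in>UNIV - {i0}. d $ i))"
  proof
    assume "\<exists>i0. d $ i0 = (\<Sum>i\<in>UNIV - {i0}. d $ i)"
    then obtain i0 where i0: "d $ i0 = (\<Sum>i\<in>UNIV - {i0}. d $ i)" ..
    \<comment> \<open>A side that equals the sum of the others exceeds each of them.\<close>
    have "top_index d = i0"
      using d i0 sum_strict_member[OF n, of "\<lambda>i. d $ i" _ i0]
      by (intro top_index_eqI) (auto simp: equidistant_set_def)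
    then show "shrink d = 1" using i0 shrink_eq_1_iff[OF n d] by simp
  qed (use shrink_eq_1_iff[OF n d] in auto)
  finally show "area_formula d = 0 \<longleftrightarrow> (\<exists>i0. d $ i0 = (\<Sum>i\<in>UNIV - {i0}. d $ i))" .
qed

text \<open>No polygon is rearranged: the conditions, the excess and the area are signed sums over
  the sides, and a permutation only moves the negative sign to the index \<open>j\<close> of the
  longest side.\<close>

lemma area_formula_permute:
  assumes n: "CARD('n::{finite,linorder}) \<ge> 3" and d: "(d :: real ^ 'n::{finite,linorder}) \<in> equidistant_set"
    and p: "p permutes (UNIV :: 'n set)"
  defines "e \<equiv> (\<chi> i. d $ p i)"
  shows "e \<in> equidistant_set" "area_formula e = area_formula d"
proof -
  define j where "j = inv p (top_index d)"
  have pj: "p j = top_index d" unfolding j_def using p by (simp add: permutes_inverses)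
  have bij: "bij p" using p by (rule permutes_bij)
  have p_ne: "p i \<noteq> top_index d" if "i \<noteq> j" for i using that pj bij by (metis bij_pointE)
  have "e $ i < e $ j" if "i \<noteq> j" for i
    using dominant_less[OF n dominant_top_index[OF n UnI1[OF d]] p_ne[OF that]] by (simp add: e_def pj)
  then have top: "top_index e = j" by (rule top_index_eqI)
  have sign: "side_sign j i = side_sign (top_index d) (p i)" for i
    using p_ne pj by (auto simp: side_sign_def)
  have sum: "(\<Sum>i\<in>UNIV. side_sign j i * f (e $ i)) = (\<Sum>i\<in>UNIV. side_sign (top_index d) i * f (d $ i))" for f
    unfolding sign e_def using sum.reindex_bij_betw[OF bij, of "\<lambda>i. side_sign (top_index d) i * f (d $ i)"] by simp
  have E: "dominant (top_index d) d"
    "(\<Sum>i\<in>UNIV. side_sign (top_index d) i * sinh (d $ i / 2)) < 0"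
    "(\<Sum>i\<in>UNIV. side_sign (top_index d) i * (d $ i)) \<ge> 0"
    using equidistant_set_iff[OF n, of d] d unfolding sum_side_sign by auto
  have "(\<Sum>i\<in>UNIV. side_sign j i * sinh (e $ i / 2)) < 0" "(\<Sum>i\<in>UNIV. side_sign j i * (e $ i)) \<ge> 0"
    using E(2,3) sum[of "\<lambda>t. sinh (t / 2)"] sum[of "\<lambda>t. t"] by auto
  then show eE: "e \<in> equidistant_set"
    unfolding equidistant_set_iff[OF n] top dominant_def sum_side_sign
    using E(1) by (auto simp: dominant_def e_def)
  have "shrink e = shrink d"
    using shrink_root[OF n d] sum[of "\<lambda>t. arsinh (shrink d * sinh (t / 2))"]
    by (intro shrink_eqI[OF n eE]) (auto simp: excess_def top)
  then show "area_formula e = area_formula d"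
    unfolding area_formula_def top using sum[of "\<lambda>t. 2 * arcsin (sqrt (1 - (shrink d)\<^sup>2) * tanh (t / 2))"] by simp
qed

lemma arcsin_tanh:
  fixes y :: real
  assumes "y > 0"
  shows "arcsin (tanh y) = pi / 2 - arcsin (1 / cosh y)"
proof -
  have c: "0 < 1 / cosh y" "1 / cosh y \<le> 1" using cosh_real_ge_1[of y] by auto
  have "sin (pi / 2 - arcsin (1 / cosh y)) = sqrt (1 - (1 / cosh y)\<^sup>2)"
  proof -
    have "cos (arcsin (1 / cosh y)) = sqrt (1 - (1 / cosh y)\<^sup>2)"
      by (rule cos_arcsin) (use c in linarith)+
    then show ?thesis by (simp add: sin_diff)
  qed
  also have "\<dots> = tanh y" using assms by (simp add: one_minus_inverse_cosh_sq)
  finally have "arcsin (tanh y) = arcsin (sin (pi / 2 - arcsin (1 / cosh y)))" by simp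
  also have "\<dots> = pi / 2 - arcsin (1 / cosh y)"
  proof (rule arcsin_sin)
    have "-1 \<le> 1 / cosh y" using c by linarith
    then have "arcsin (1 / cosh y) \<le> pi / 2" using c(2) arcsin_bounded by blast
    moreover have "0 \<le> arcsin (1 / cosh y)" using c arcsin_le_arcsin[of 0 "1 / cosh y"] by simp
    ultimately show "- (pi / 2) \<le> pi / 2 - arcsin (1 / cosh y)" "pi / 2 - arcsin (1 / cosh y) \<le> pi / 2"
      using pi_gt_zero by linarith+
  qed
  finally show ?thesis .
qed

lemma area_formula_horocyclic:
  assumes n: "CARD('n::{finite,linorder}) \<ge> 3" and d: "(d :: real ^ 'n::{finite,linorder}) \<in> horocyclic_set"
  shows "area_formula d = (real CARD('n) - 2) * pi + 2 * (arcsin (1 / cosh (d $ top_index d / 2))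
    - (\<Sum>i\<in>UNIV - {top_index d}. arcsin (1 / cosh (d $ i / 2))))"
proof -
  have pos: "d $ i > 0" for i using d by (auto simp: horocyclic_set_def)
  have "area_formula d = (\<Sum>i\<in>UNIV. side_sign (top_index d) i * (pi - 2 * arcsin (1 / cosh (d $ i / 2))))"
    unfolding area_formula_def using pos by (simp add: shrink_horocyclic[OF d] arcsin_tanh)
  \<comment> \<open>The n - 1 shorter sides contribute pi each and the longest one - pi, which
    leaves (n - 2) pi.\<close>
  also have "\<dots> = real (card (UNIV - {top_index d})) * pi - 2 * (\<Sum>i\<in>UNIV - {top_index d}. arcsin (1 / cosh (d $ i / 2)))
      - (pi - 2 * arcsin (1 / cosh (d $ top_index d / 2)))"
    unfolding sum_side_sign by (simp add: sum_subtractf sum_distrib_left)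
  also have "real (card (UNIV - {top_index d})) = real CARD('n) - 1" using n by (simp add: of_nat_diff)
  finally show ?thesis by (simp add: algebra_simps)
qed

section \<open>The gradient of the area\<close>

lemma interior_equidistant_set:
  assumes n: "CARD('n::{finite,linorder}) \<ge> 3" and d: "(d :: real ^ 'n::{finite,linorder}) \<in> interior equidistant_set"
  shows "d \<in> equidistant_set" "0 < shrink d" "shrink d < 1"
proof -
  show dE: "d \<in> equidistant_set" using d interior_subset by blast
  show "0 < shrink d" by (rule shrink_root(1)[OF n dE])
  define t where "t = top_index d"
  obtain r where r: "r > 0" "ball d r \<subseteq> equidistant_set" using d mem_interior by blast
  \<comment> \<open>Lengthening only the longest side stays inside the ball, so the inequality d_t
    <= sum of the others has slack at \<open>d\<close>; slack excludes
    \<open>shrink d = 1\<close>.\<close>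
  define e where "e = d + (r / 2) *\<^sub>R axis t 1"
  have e_t: "e $ t = d $ t + r / 2" and e_ne: "\<And>i. i \<noteq> t \<Longrightarrow> e $ i = d $ i"
    by (auto simp: e_def axis_def)
  have "e \<in> ball d r" using r(1) by (simp add: e_def dist_norm norm_axis_1)
  then have eE: "e \<in> equidistant_set" using r(2) by blast
  have "e $ i < e $ t" if "i \<noteq> t" for i
    using dominant_less[OF n dominant_top_index[OF n UnI1[OF dE]], of i] that e_t e_ne r(1) by (simp add: t_def)
  then have "top_index e = t" by (rule top_index_eqI)
  then have "e $ t \<le> (\<Sum>i\<in>UNIV - {t}. e $ i)" using eE unfolding equidistant_set_iff[OF n] by simp
  also have "(\<Sum>i\<in>UNIV - {t}. e $ i) = (\<Sum>i\<in>UNIV - {t}. d $ i)" by (intro sum.cong) (auto simp: e_ne)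
  finally have "d $ t \<noteq> (\<Sum>i\<in>UNIV - {t}. d $ i)" using e_t r(1) by simp
  then have "shrink d \<noteq> 1" using shrink_eq_1_iff[OF n dE] by (simp add: t_def)
  then show "shrink d < 1" using shrink_root(2)[OF n dE] by simp
qed

lemma eventually_interior_equidistant:
  assumes n: "CARD('n::{finite,linorder}) \<ge> 3" and d: "(d :: real ^ 'n::{finite,linorder}) \<in> interior equidistant_set"
  shows "\<forall>\<^sub>F e in nhds d. e \<in> equidistant_set \<and> top_index e = top_index d"
proof -
  have "\<forall>\<^sub>F e in nhds d. e \<in> interior equidistant_set"
    using d by (intro eventually_nhds_in_open) auto
  moreover have "\<forall>\<^sub>F e in nhds d. top_index e = top_index d"
    using interior_equidistant_set(1)[OF n d] by (intro eventually_top_index[OF n] dominant_top_index[OF n]) auto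
  ultimately show ?thesis by eventually_elim (use interior_subset in blast)
qed

text \<open>The value of cosh at half the projected length of side i, whose sinh is
  \<open>shrink d * sinh (d $ i / 2)\<close>.\<close>

definition stretch :: "real ^ 'n::{finite,linorder} \<Rightarrow> 'n \<Rightarrow> real" where
  "stretch d i = sqrt ((shrink d * sinh (d $ i / 2))\<^sup>2 + 1)"

text \<open>The implicit derivative: minus the derivative of the excess in direction
  \<open>h\<close> over its derivative in \<open>v\<close>, both at the root.\<close>

definition shrink_deriv :: "real ^ 'n::{finite,linorder} \<Rightarrow> real ^ 'n::{finite,linorder} \<Rightarrow> real" where
  "shrink_deriv d h =
    - (\<Sum>i\<in>UNIV. side_sign (top_index d) i * (shrink d * (cosh (d $ i / 2) / 2) * h $ i / stretch d i)) /
      (\<Sum>i\<in>UNIV. side_sign (top_index d) i * (sinh (d $ i / 2) / stretch d i))"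

text \<open>Times \<open>shrink d\<close>, the slope is the signed sum of tanh over the half
  projections. The longest half projection is the sum of the others, and tanh is strictly
  subadditive.\<close>

lemma excess_slope_pos:
  assumes n: "CARD('n::{finite,linorder}) \<ge> 3" and d: "(d :: real ^ 'n::{finite,linorder}) \<in> equidistant_set"
  shows "(\<Sum>i\<in>UNIV. side_sign (top_index d) i * (sinh (d $ i / 2) / stretch d i)) > 0"
proof -
  note u = shrink_root[OF n d]
  define a where "a = (\<lambda>i. arsinh (shrink d * sinh (d $ i / 2)))"
  have a: "a i > 0" for i using u d by (auto simp: a_def equidistant_set_def)
  have tanh_a: "tanh (a i) = shrink d * (sinh (d $ i / 2) / stretch d i)" for i
    by (simp add: a_def tanh_def cosh_arsinh_real stretch_def)
  have "a (top_index d) = (\<Sum>i\<in>UNIV - {top_index d}. a i)"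
    using u(3) unfolding excess_def sum_side_sign by (simp add: a_def)
  then have "tanh (a (top_index d)) < (\<Sum>i\<in>UNIV - {top_index d}. tanh (a i))"
    using strict_subadditive_sum[of tanh "UNIV - {top_index d}" a] tanh_strict_subadditive card_others[OF n] a by auto
  then have "0 < (\<Sum>i\<in>UNIV. side_sign (top_index d) i * tanh (a i))"
    unfolding sum_side_sign by simp
  also have "\<dots> = shrink d * (\<Sum>i\<in>UNIV. side_sign (top_index d) i * (sinh (d $ i / 2) / stretch d i))"
    unfolding tanh_a sum_distrib_left by (intro sum.cong) auto
  finally show ?thesis using u(1) by (simp add: zero_less_mult_iff)
qed

lemma DERIV_sinh_real: "(sinh has_real_derivative cosh y) (at (y :: real))"
  by (auto intro!: derivative_eq_intros)

lemma shrink_has_derivative: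
  assumes n: "CARD('n::{finite,linorder}) \<ge> 3" and d: "(d :: real ^ 'n::{finite,linorder}) \<in> interior equidistant_set"
  shows "(shrink has_derivative shrink_deriv d) (at d)"
proof -
  let ?t = "top_index d" and ?u = "shrink d"
  note dE = interior_equidistant_set(1)[OF n d]
  let ?L = "\<lambda>h. \<Sum>i\<in>UNIV. side_sign ?t i * (?u * (cosh (d $ i / 2) / 2) * h $ i / stretch d i)"
  let ?a = "\<Sum>i\<in>UNIV. side_sign ?t i * (sinh (d $ i / 2) / stretch d i)"
  have "(shrink has_derivative (\<lambda>h. - ?L h / ?a)) (at d)"
  proof (rule implicit_function_has_derivative[where F = "excess ?t"])
    have arg: "((\<lambda>p. snd p * sinh (fst p $ i / 2)) has_derivative
        (\<lambda>q. ?u * (cosh (d $ i / 2) * (fst q $ i / 2)) + snd q * sinh (d $ i / 2))) (at (d, ?u))" for i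
    proof -
      have "((\<lambda>p. fst p $ i / 2) has_derivative (\<lambda>q. fst q $ i / 2)) (at (d, ?u))"
        by (intro bounded_linear_imp_has_derivative bounded_linear_compose[OF bounded_linear_divide]
            bounded_linear_compose[OF bounded_linear_vec_nth bounded_linear_fst])
      from has_derivative_compose[OF this, of sinh "(*) (cosh (d $ i / 2))"]
      have "((\<lambda>p. sinh (fst p $ i / 2)) has_derivative (\<lambda>q. cosh (d $ i / 2) * (fst q $ i / 2))) (at (d, ?u))"
        using DERIV_sinh_real[of "d $ i / 2"] by (auto simp: has_field_derivative_def)
      from has_derivative_mult[OF has_derivative_snd[OF has_derivative_ident] this]
      show ?thesis by simp
    qed
    have "((\<lambda>p. arsinh (snd p * sinh (fst p $ i / 2))) has_derivative
        (\<lambda>q. 1 / stretch d i * (?u * (cosh (d $ i / 2) * (fst q $ i / 2)) + snd q * sinh (d $ i / 2))))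
        (at (d, ?u))" for i
      using has_derivative_compose[OF arg, of arsinh "(*) (1 / stretch d i)" i]
        arsinh_real_has_field_derivative[of "?u * sinh (d $ i / 2)" UNIV]
      by (auto simp: has_field_derivative_def stretch_def)
    then have "((\<lambda>p. \<Sum>i\<in>UNIV. side_sign ?t i * arsinh (snd p * sinh (fst p $ i / 2))) has_derivative
        (\<lambda>q. \<Sum>i\<in>UNIV. side_sign ?t i * (1 / stretch d i *
          (?u * (cosh (d $ i / 2) * (fst q $ i / 2)) + snd q * sinh (d $ i / 2))))) (at (d, ?u))"
      by (intro has_derivative_sum has_derivative_mult_right)
    moreover have "(\<lambda>q. \<Sum>i\<in>UNIV. side_sign ?t i * (1 / stretch d i *
          (?u * (cosh (d $ i / 2) * (fst q $ i / 2)) + snd q * sinh (d $ i / 2)))) = (\<lambda>(h, k). ?L h + ?a * k)"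
    proof (intro ext, clarify)
      fix h :: "real ^ 'n::{finite,linorder}" and k :: real
      have "(\<Sum>i\<in>UNIV. side_sign ?t i * (1 / stretch d i *
          (?u * (cosh (d $ i / 2) * (h $ i / 2)) + k * sinh (d $ i / 2)))) =
        (\<Sum>i\<in>UNIV. side_sign ?t i * (?u * (cosh (d $ i / 2) / 2) * h $ i / stretch d i) +
          side_sign ?t i * (sinh (d $ i / 2) / stretch d i) * k)"
        by (intro sum.cong refl) (simp add: algebra_simps add_divide_distrib)
      then show "(\<Sum>i\<in>UNIV. side_sign ?t i * (1 / stretch d i *
          (?u * (cosh (d $ i / 2) * (fst (h, k) $ i / 2)) + snd (h, k) * sinh (d $ i / 2)))) = ?L h + ?a * k"
        by (simp add: sum.distrib sum_distrib_right)
    qed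
    ultimately show "((\<lambda>(e, v). excess ?t e v) has_derivative (\<lambda>(h, k). ?L h + ?a * k)) (at (d, ?u))"
      by (simp add: excess_def case_prod_unfold)
    show "?a \<noteq> 0" using excess_slope_pos[OF n dE] by simp
    have "continuous_on (interior equidistant_set) (shrink :: real ^ 'n::{finite,linorder} \<Rightarrow> real)"
      by (rule continuous_on_subset[OF continuous_on_shrink[OF n]]) (use interior_subset in blast)
    then show "continuous (at d) shrink" using d by (simp add: continuous_on_eq_continuous_at)
    show "\<forall>\<^sub>F e in nhds d. excess ?t e (shrink e) = 0"
      using eventually_interior_equidistant[OF n d]
      by (rule eventually_mono) (metis shrink_root(3)[OF n])
  qed
  then show ?thesis unfolding shrink_deriv_def[abs_def] .
qed

text \<open>By the choice of the factor of the second summand, the derivative with respect to \<open>w\<close> vanishes.\<close>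

lemma corrected_area_has_derivative:
  fixes x w :: "'a::real_normed_vector \<Rightarrow> real"
  assumes x: "(x has_derivative x') (at p)" and w: "(w has_derivative w') (at p)" and u: "w p = u" "0 < u" "u < 1"
  shows "((\<lambda>e. 2 * arcsin (sqrt (1 - (w e)\<^sup>2) * tanh (x e / 2)) + 2 * (u / sqrt (1 - u\<^sup>2)) * arsinh (w e * sinh (x e / 2)))
    has_derivative (\<lambda>h. sqrt (u\<^sup>2 / (1 - u\<^sup>2) + 1 / (cosh (x p / 2))\<^sup>2) * x' h)) (at p)"
proof -
  define T C S q where "T = sqrt (1 - u\<^sup>2)" and "C = cosh (x p / 2)" and "S = sinh (x p / 2)"
    and "q = sqrt ((u * S)\<^sup>2 + 1)"
  have u2: "1 - u\<^sup>2 > 0" using u by (simp add: power_less_one_iff abs_square_less_1)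
  have T: "T > 0" "T\<^sup>2 = 1 - u\<^sup>2" using u2 by (auto simp: T_def)
  have C: "C > 0" "C\<^sup>2 = 1 + S\<^sup>2" by (auto simp: C_def S_def cosh_square_eq)
  have q: "q > 0" "q\<^sup>2 = u\<^sup>2 * S\<^sup>2 + 1" by (auto simp: q_def power_mult_distrib add_nonneg_pos)
  have dx: "((\<lambda>e. x e / 2) has_derivative (\<lambda>h. x' h / 2)) (at p)"
    using has_derivative_mult_left[OF x, of "1 / 2"] by simp
  have dS: "((\<lambda>e. sinh (x e / 2)) has_derivative (\<lambda>h. C * (x' h / 2))) (at p)"
    using has_derivative_compose[OF dx, of sinh "(*) C"] DERIV_sinh_real[of "x p / 2"]
    by (auto simp: has_field_derivative_def C_def)
  have dtanh: "((\<lambda>e. tanh (x e / 2)) has_derivative (\<lambda>h. 1 / C\<^sup>2 * (x' h / 2))) (at p)"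
  proof -
    have "(tanh has_real_derivative 1 - (tanh (x p / 2))\<^sup>2) (at (x p / 2))"
      by (auto intro!: derivative_eq_intros)
    moreover have "1 - (tanh (x p / 2))\<^sup>2 = 1 / C\<^sup>2"
    proof -
      have "1 - (S / C)\<^sup>2 = (C\<^sup>2 - S\<^sup>2) / C\<^sup>2"
        using C(1) by (simp add: power_divide diff_divide_distrib)
      also have "C\<^sup>2 - S\<^sup>2 = 1" using C(2) by simp
      finally show ?thesis by (simp add: tanh_def flip: C_def S_def)
    qed
    ultimately show ?thesis
      using has_derivative_compose[OF dx, of tanh "(*) (1 / C\<^sup>2)"] by (simp add: has_field_derivative_def)
  qed
  have dsqrt: "((\<lambda>e. sqrt (1 - (w e)\<^sup>2)) has_derivative (\<lambda>h. - u / T * w' h)) (at p)"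
  proof -
    have "((\<lambda>v. sqrt (1 - v\<^sup>2)) has_real_derivative - u / T) (at u)"
    proof -
      have "((\<lambda>v. 1 - v\<^sup>2) has_real_derivative - (2 * u)) (at u)"
        by (auto intro!: derivative_eq_intros)
      from DERIV_chain2[where f = sqrt and g = "\<lambda>v. 1 - v\<^sup>2" and x = u, OF DERIV_real_sqrt[OF u2] this]
      show ?thesis unfolding T_def by (rule DERIV_cong) (simp only: divide_inverse mult_ac, simp)
    qed
    then show ?thesis
      using has_derivative_compose[OF w, of "\<lambda>v. sqrt (1 - v\<^sup>2)" "(*) (- u / T)"]
      by (simp add: has_field_derivative_def u(1))
  qed
  have dprod: "((\<lambda>e. sqrt (1 - (w e)\<^sup>2) * tanh (x e / 2)) has_derivative
      (\<lambda>h. T * (1 / C\<^sup>2 * (x' h / 2)) + - u / T * w' h * (S / C))) (at p)"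
    using has_derivative_mult[OF dsqrt dtanh] by (simp add: u(1) tanh_def flip: T_def C_def S_def)
  have darcsin: "((\<lambda>e. arcsin (sqrt (1 - (w e)\<^sup>2) * tanh (x e / 2))) has_derivative
      (\<lambda>h. C / q * (T * (1 / C\<^sup>2 * (x' h / 2)) + - u / T * w' h * (S / C)))) (at p)"
  proof -
    have val: "sqrt (1 - (w p)\<^sup>2) * tanh (x p / 2) = T * (S / C)"
      by (simp add: u(1) tanh_def T_def S_def C_def)
    have "(arcsin has_real_derivative inverse (sqrt (1 - (T * (S / C))\<^sup>2))) (at (T * (S / C)))"
      using sqrt_mult_tanh_bounds[of u "x p / 2"] u by (intro DERIV_arcsin) (simp_all add: tanh_def T_def S_def C_def)
    moreover have "inverse (sqrt (1 - (T * (S / C))\<^sup>2)) = C / q"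
    proof -
      have "1 - (T * (S / C))\<^sup>2 = (C\<^sup>2 - T\<^sup>2 * S\<^sup>2) / C\<^sup>2"
        using C(1) by (simp add: power_mult_distrib power_divide diff_divide_distrib)
      also have "C\<^sup>2 - T\<^sup>2 * S\<^sup>2 = q\<^sup>2" unfolding C(2) T(2) q(2) by (simp add: algebra_simps)
      also have "q\<^sup>2 / C\<^sup>2 = (q / C)\<^sup>2" by (simp add: power_divide)
      finally show ?thesis using q(1) C(1) by simp
    qed
    ultimately show ?thesis
      using has_derivative_compose[OF dprod, of arcsin "(*) (C / q)"] by (simp add: has_field_derivative_def val)
  qed
  have darsinh: "((\<lambda>e. arsinh (w e * sinh (x e / 2))) has_derivative (\<lambda>h. 1 / q * (u * (C * (x' h / 2)) + w' h * S))) (at p)"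
  proof -
    have "((\<lambda>e. w e * sinh (x e / 2)) has_derivative (\<lambda>h. u * (C * (x' h / 2)) + w' h * S)) (at p)"
      using has_derivative_mult[OF w dS] by (simp add: u(1) flip: S_def)
    from has_derivative_compose[OF this, of arsinh "(*) (1 / q)"]
    show ?thesis
      using arsinh_real_has_field_derivative[of "u * S" UNIV]
      by (simp add: has_field_derivative_def u(1) q_def flip: S_def)
  qed
  \<comment> \<open>Brings the coefficient of the theorem into the shape in which the chain rule
    produces it.\<close>
  have G: "sqrt (u\<^sup>2 / (1 - u\<^sup>2) + 1 / C\<^sup>2) = q / (T * C)"
  proof (rule real_sqrt_unique)
    have "u\<^sup>2 * C\<^sup>2 + T\<^sup>2 = q\<^sup>2" unfolding C(2) T(2) q(2) by (simp add: algebra_simps)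
    then have "(q / (T * C))\<^sup>2 = (u\<^sup>2 * C\<^sup>2 + T\<^sup>2) / (T\<^sup>2 * C\<^sup>2)" by (simp add: power_divide power_mult_distrib)
    also have "\<dots> = u\<^sup>2 / T\<^sup>2 + 1 / C\<^sup>2" using T(1) C(1) by (simp add: add_divide_distrib)
    finally show "(q / (T * C))\<^sup>2 = u\<^sup>2 / (1 - u\<^sup>2) + 1 / C\<^sup>2" by (simp add: T(2))
  qed (use T C q in auto)
  have "((\<lambda>e. 2 * arcsin (sqrt (1 - (w e)\<^sup>2) * tanh (x e / 2)) + 2 * (u / T) * arsinh (w e * sinh (x e / 2)))
    has_derivative (\<lambda>h. 2 * (C / q * (T * (1 / C\<^sup>2 * (x' h / 2)) + - u / T * w' h * (S / C))) +
      2 * (u / T) * (1 / q * (u * (C * (x' h / 2)) + w' h * S)))) (at p)"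
    by (intro has_derivative_add has_derivative_mult_right darcsin darsinh)
  \<comment> \<open>The terms in \<open>W\<close> are - 2 u S / (T q) and + 2 u S / (T q); they
    cancel, and the terms in \<open>X\<close> combine by T^2 + u^2 C^2 = q^2.\<close>
  moreover have "2 * (C / q * (T * (1 / C\<^sup>2 * (X / 2)) + - u / T * W * (S / C))) +
      2 * (u / T) * (1 / q * (u * (C * (X / 2)) + W * S)) = q / (T * C) * X" for X W
  proof -
    have "2 * (C / q * (T * (1 / C\<^sup>2 * (X / 2)) + - u / T * W * (S / C))) +
      2 * (u / T) * (1 / q * (u * (C * (X / 2)) + W * S)) = (T\<^sup>2 + u\<^sup>2 * C\<^sup>2) / (q * T * C) * X"
      using T(1) C(1) q(1) by (simp add: field_simps power2_eq_square)
    also have "T\<^sup>2 + u\<^sup>2 * C\<^sup>2 = q\<^sup>2" unfolding C(2) T(2) q(2) by (simp add: algebra_simps)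
    also have "q\<^sup>2 / (q * T * C) = q / (T * C)" using q(1) by (simp add: power2_eq_square)
    finally show ?thesis .
  qed
  ultimately show ?thesis using G by (simp flip: T_def C_def)
qed

definition area_grad :: "real ^ 'n::{finite,linorder} \<Rightarrow> 'n \<Rightarrow> real" where
  "area_grad d i = side_sign (top_index d) i * sqrt ((shrink d)\<^sup>2 / (1 - (shrink d)\<^sup>2) + 1 / (cosh (d $ i / 2))\<^sup>2)"

text \<open>The multiplier \<kappa> = 1 / sinh J is frozen at \<open>d\<close>. The excess at the
  root vanishes for all nearby side lengths, so the corrected sum is still the area, but the
  derivative of \<open>shrink\<close> no longer enters its gradient.\<close>

lemma equidistant_area_has_derivative:
  assumes n: "CARD('n::{finite,linorder}) \<ge> 3" and d: "(d :: real ^ 'n::{finite,linorder}) \<in> interior equidistant_set"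
  shows "(equidistant_area has_derivative (\<lambda>h. \<Sum>i\<in>UNIV. area_grad d i * h $ i)) (at d)"
proof -
  let ?t = "top_index d"
  define \<kappa> where "\<kappa> = shrink d / sqrt (1 - (shrink d)\<^sup>2)"
  let ?\<Psi> = "\<lambda>e. \<Sum>i\<in>UNIV. side_sign ?t i * (2 * arcsin (sqrt (1 - (shrink e)\<^sup>2) * tanh (e $ i / 2)) +
      2 * \<kappa> * arsinh (shrink e * sinh (e $ i / 2)))"
  have "(?\<Psi> has_derivative
      (\<lambda>h. \<Sum>i\<in>UNIV. side_sign ?t i * (sqrt ((shrink d)\<^sup>2 / (1 - (shrink d)\<^sup>2) + 1 / (cosh (d $ i / 2))\<^sup>2) * h $ i))) (at d)"
    unfolding \<kappa>_def using interior_equidistant_set[OF n d]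
    by (intro has_derivative_sum has_derivative_mult_right
        corrected_area_has_derivative[OF _ shrink_has_derivative[OF n d]] bounded_linear_imp_has_derivative bounded_linear_vec_nth) auto
  then have der: "(?\<Psi> has_derivative (\<lambda>h. \<Sum>i\<in>UNIV. area_grad d i * h $ i)) (at d)"
    by (simp add: area_grad_def mult.assoc)
  have ev: "\<forall>\<^sub>F e in nhds d. ?\<Psi> e = equidistant_area e"
    using eventually_interior_equidistant[OF n d]
  proof (rule eventually_mono, elim conjE)
    fix e :: "real ^ 'n::{finite,linorder}" assume e: "e \<in> equidistant_set" "top_index e = ?t"
    have "?\<Psi> e = area_formula e + 2 * \<kappa> * excess ?t e (shrink e)"
      unfolding area_formula_def excess_def e(2) sum_distrib_left sum.distrib[symmetric]
      by (intro sum.cong refl) (simp add: algebra_simps)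
    then show "?\<Psi> e = equidistant_area e"
      using shrink_root(3)[OF n e(1)] e(2) equidistant_area_eq[OF n e(1)] by simp
  qed
  show ?thesis
    by (rule has_derivative_transform_eventually[OF der eventually_nhds_conv_at[THEN iffD1, THEN conjunct1, OF ev]
          eventually_nhds_x_imp_x[OF ev]]) simp
qed

section \<open>Smoothness of the collar parameter and of the area\<close>

lemma Ck_on_side_sign:
  assumes n: "CARD('n::{finite,linorder}) \<ge> 3"
  shows "Ck_on k (\<lambda>d. side_sign (top_index d) i) (interior equidistant_set :: (real ^ 'n::{finite,linorder}) set)"
proof (rule Ck_on_locally_const)
  fix d :: "real ^ 'n::{finite,linorder}" assume "d \<in> interior equidistant_set"
  from eventually_interior_equidistant[OF n this]
  show "\<forall>\<^sub>F e in nhds d. side_sign (top_index e) i = side_sign (top_index d) i"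
    by (rule eventually_mono) simp
qed simp

lemma Ck_on_half_sides:
  "Ck_on k (\<lambda>d :: real ^ 'n::finite. cosh (d $ i / 2)) S" "Ck_on k (\<lambda>d :: real ^ 'n::finite. sinh (d $ i / 2)) S"
  by (intro Ck_on_cosh_sinh Ck_on_divide Ck_on_component Ck_on_const; simp)+

text \<open>Bootstrapping: the derivative of \<open>shrink\<close> is an expression in
  \<open>shrink\<close> and the side lengths, so each order of regularity yields the next.\<close>

lemma Ck_on_shrink:
  assumes n: "CARD('n::{finite,linorder}) \<ge> 3"
  shows "Ck_on k (shrink :: real ^ 'n::{finite,linorder} \<Rightarrow> real) (interior equidistant_set)"
proof (induction k)
  case 0
  show ?case
    using continuous_on_subset[OF continuous_on_shrink[OF n], of "interior equidistant_set"] interior_subset by auto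
next
  case (Suc k)
  show ?case
  proof (rule Ck_on_SucI[OF shrink_has_derivative[OF n]])
    fix b :: "real ^ 'n::{finite,linorder}"
    have q: "Ck_on k (\<lambda>d. stretch d i) (interior equidistant_set :: (real ^ 'n::{finite,linorder}) set)" for i
      unfolding stretch_def power2_eq_square
      by (intro Ck_on_sqrt Ck_on_add Ck_on_mult Suc Ck_on_half_sides Ck_on_const) (simp add: add_nonneg_pos)
    have q_ne: "stretch d i \<noteq> 0" for d :: "real ^ 'n::{finite,linorder}" and i
      by (simp add: stretch_def add_nonneg_eq_0_iff)
    have "Ck_on k (\<lambda>d. (- 1) * (\<Sum>i\<in>UNIV. side_sign (top_index d) i *
        (shrink d * (cosh (d $ i / 2) / 2) * b $ i / stretch d i)) /
        (\<Sum>i\<in>UNIV. side_sign (top_index d) i * (sinh (d $ i / 2) / stretch d i)))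
        (interior equidistant_set)"
    proof (intro Ck_on_divide Ck_on_mult Ck_on_sum Suc Ck_on_half_sides Ck_on_const Ck_on_side_sign[OF n] q)
      fix d :: "real ^ 'n::{finite,linorder}" assume "d \<in> interior equidistant_set"
      then have "d \<in> equidistant_set" using interior_subset by blast
      from excess_slope_pos[OF n this]
      show "(\<Sum>i\<in>UNIV. side_sign (top_index d) i * (sinh (d $ i / 2) / stretch d i)) \<noteq> 0"
        by simp
    qed (use q_ne in auto)
    then show "Ck_on k (\<lambda>d. shrink_deriv d b) (interior equidistant_set)"
      by (simp add: shrink_deriv_def)
  qed
qed

lemma smooth_on_equidistant_area:
  assumes n: "CARD('n::{finite,linorder}) \<ge> 3"
  shows "smooth_on equidistant_area (interior (equidistant_set :: (real ^ 'n::{finite,linorder}) set))"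
  unfolding smooth_on_def
proof
  fix k
  let ?S = "interior (equidistant_set :: (real ^ 'n::{finite,linorder}) set)"
  have sq: "1 - (shrink d)\<^sup>2 > 0" if "d \<in> ?S" for d
    using interior_equidistant_set[OF n that] by (simp add: abs_square_less_1)
  have "Ck_on (Suc k) equidistant_area ?S"
  proof (rule Ck_on_SucI[OF equidistant_area_has_derivative[OF n]])
    fix b :: "real ^ 'n::{finite,linorder}"
    have diff: "Ck_on k (\<lambda>d. 1 - (shrink d)\<^sup>2) ?S"
      using Ck_on_add[OF Ck_on_const[of k 1] Ck_on_mult[OF Ck_on_const[of k "-1"] Ck_on_mult[OF Ck_on_shrink[OF n] Ck_on_shrink[OF n]]]]
      by (simp add: power2_eq_square)
    have "Ck_on k (\<lambda>d. (shrink d * shrink d) / (1 - (shrink d)\<^sup>2) + 1 / (cosh (d $ i / 2) * cosh (d $ i / 2))) ?S" for i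
      by (intro Ck_on_add Ck_on_divide Ck_on_mult Ck_on_shrink[OF n] diff Ck_on_const Ck_on_half_sides)
        (use sq in force)+
    moreover have "(shrink d * shrink d) / (1 - (shrink d)\<^sup>2) + 1 / (cosh (d $ i / 2) * cosh (d $ i / 2)) > 0" if "d \<in> ?S" for d i
      using sq[OF that] by (intro add_nonneg_pos) auto
    ultimately have "Ck_on k (\<lambda>d. sqrt ((shrink d * shrink d) / (1 - (shrink d)\<^sup>2) + 1 / (cosh (d $ i / 2) * cosh (d $ i / 2)))) ?S" for i
      by (intro Ck_on_sqrt)
    then show "Ck_on k (\<lambda>d. \<Sum>i\<in>UNIV. area_grad d i * b $ i) ?S"
      unfolding area_grad_def power2_eq_square[of "cosh _"] power2_eq_square[of "shrink _", abs_def]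
      by (intro Ck_on_sum Ck_on_mult Ck_on_side_sign[OF n] Ck_on_const) (simp_all add: power2_eq_square)
  qed
  then show "Ck_on k equidistant_area ?S" by (rule Ck_on_SucD)
qed

lemma partial_derivative_area:
  assumes n: "CARD('n::{finite,linorder}) \<ge> 3" and d: "(d :: real ^ 'n::{finite,linorder}) \<in> interior equidistant_set"
  shows "((\<lambda>t. equidistant_area (d + t *\<^sub>R axis i 1)) has_real_derivative
    side_sign (top_index d) i * sqrt (1 / (sinh (collar_radius d))\<^sup>2 + 1 / (cosh (d $ i / 2))\<^sup>2)) (at 0)"
proof -
  note u = interior_equidistant_set[OF n d]
  have "((\<lambda>t. d + t *\<^sub>R axis i 1) has_derivative (\<lambda>t. t *\<^sub>R axis i 1)) (at 0)"
    by (auto intro!: derivative_eq_intros)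
  from has_derivative_compose[OF this, of equidistant_area "\<lambda>h. \<Sum>j\<in>UNIV. area_grad d j * h $ j"]
  have "((\<lambda>t. equidistant_area (d + t *\<^sub>R axis i 1)) has_derivative
      (\<lambda>t. \<Sum>j\<in>UNIV. area_grad d j * (t *\<^sub>R axis i 1) $ j)) (at 0)"
    using equidistant_area_has_derivative[OF n d] by simp
  moreover have "(\<Sum>j\<in>UNIV. area_grad d j * (t *\<^sub>R axis i 1) $ j) = area_grad d i * t" for t
  proof -
    have "(\<Sum>j\<in>UNIV. area_grad d j * (t *\<^sub>R axis i 1) $ j) = (\<Sum>j\<in>UNIV. if j = i then area_grad d i * t else 0)"
      by (intro sum.cong) (auto simp: axis_def)
    then show ?thesis by simp
  qed
  \<comment> \<open>With cosh J = 1 / u, the term u^2 / (1 - u^2) is 1 / sinh^2 J.\<close>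
  moreover have "area_grad d i = side_sign (top_index d) i * sqrt (1 / (sinh (collar_radius d))\<^sup>2 + 1 / (cosh (d $ i / 2))\<^sup>2)"
  proof -
    have "cosh (collar_radius d) = 1 / shrink d"
      using u by (simp add: collar_radius_eq[OF n] cosh_arcosh_real)
    then have "(sinh (collar_radius d))\<^sup>2 = (1 - (shrink d)\<^sup>2) / (shrink d)\<^sup>2"
      using u by (simp add: sinh_square_eq power_divide diff_divide_distrib)
    then show ?thesis by (simp add: area_grad_def)
  qed
  ultimately show ?thesis by (simp add: has_field_derivative_def)
qed

theorem proposition4p9:
  assumes "CARD('n::{finite,linorder}) \<ge> 3"
  shows "(\<forall>d \<in> equidistant_set :: (real ^ 'n::{finite,linorder}) set. equidistant_area d \<ge> 0)
    \<and> (\<forall>d \<in> equidistant_set :: (real ^ 'n::{finite,linorder}) set. \<forall>p. p permutes UNIV \<longrightarrow>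
        equidistant_area (\<chi> i. d $ p i) = equidistant_area d)
    \<and> continuous_on (equidistant_set :: (real ^ 'n::{finite,linorder}) set) equidistant_area
    \<and> smooth_on equidistant_area (interior (equidistant_set :: (real ^ 'n::{finite,linorder}) set))
    \<and> (\<forall>d \<in> interior (equidistant_set :: (real ^ 'n::{finite,linorder}) set).
        \<forall>i0. (\<forall>j. d $ j \<le> d $ i0) \<longrightarrow>
        (\<forall>i. ((\<lambda>t. equidistant_area (d + t *\<^sub>R axis i 1)) has_real_derivative
          (if i = i0
           then - sqrt (1 / (sinh (collar_radius d))\<^sup>2 + 1 / (cosh (d $ i0 / 2))\<^sup>2)
           else sqrt (1 / (sinh (collar_radius d))\<^sup>2 + 1 / (cosh (d $ i / 2))\<^sup>2))) (at 0)))
    \<and> (\<forall>d \<in> equidistant_set :: (real ^ 'n::{finite,linorder}) set.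
        equidistant_area d = 0 \<longleftrightarrow> (\<exists>i0. d $ i0 = (\<Sum>i\<in>UNIV - {i0}. d $ i)))
    \<and> (\<exists>F :: real ^ 'n::{finite,linorder} \<Rightarrow> real.
        continuous_on (equidistant_set \<union> horocyclic_set) F \<and>
        (\<forall>d \<in> equidistant_set. F d = equidistant_area d) \<and>
        (\<forall>d \<in> horocyclic_set. \<forall>i0. (\<forall>j. d $ j \<le> d $ i0) \<longrightarrow>
          F d = (real CARD('n) - 2) * pi
            + 2 * (arcsin (1 / cosh (d $ i0 / 2))
                   - (\<Sum>i\<in>UNIV - {i0}. arcsin (1 / cosh (d $ i / 2))))))"
  (is "?nonneg \<and> ?symmetric \<and> ?continuous \<and> ?smooth \<and> ?partial \<and> ?zero \<and> ?extension")
proof (intro conjI)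
  note n = assms
  show ?nonneg using equidistant_area_eq[OF n] area_formula_zero_iff(1)[OF n] by simp
  show ?symmetric using equidistant_area_eq[OF n] area_formula_permute[OF n] by simp
  have "continuous_on equidistant_set (area_formula :: real ^ 'n::{finite,linorder} \<Rightarrow> real)"
    by (rule continuous_on_subset[OF continuous_on_area_formula[OF n]]) auto
  then show ?continuous
    by (rule continuous_on_eq) (simp add: equidistant_area_eq[OF n])
  show ?smooth by (rule smooth_on_equidistant_area[OF n])
  show ?partial
  proof (intro ballI allI impI)
    fix d :: "real ^ 'n::{finite,linorder}" and i0 i
    assume d: "d \<in> interior equidistant_set" and "\<forall>j. d $ j \<le> d $ i0"
    then have top: "i0 = top_index d"
      using dominant_top_index[OF n UnI1[OF interior_equidistant_set(1)[OF n d]]] by (intro top_index_maximal[OF n]) auto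
    have "side_sign (top_index d) i * sqrt (1 / (sinh (collar_radius d))\<^sup>2 + 1 / (cosh (d $ i / 2))\<^sup>2) =
      (if i = i0 then - sqrt (1 / (sinh (collar_radius d))\<^sup>2 + 1 / (cosh (d $ i0 / 2))\<^sup>2)
       else sqrt (1 / (sinh (collar_radius d))\<^sup>2 + 1 / (cosh (d $ i / 2))\<^sup>2))"
      by (simp add: top side_sign_def)
    with partial_derivative_area[OF n d, of i]
    show "((\<lambda>t. equidistant_area (d + t *\<^sub>R axis i 1)) has_real_derivative
      (if i = i0 then - sqrt (1 / (sinh (collar_radius d))\<^sup>2 + 1 / (cosh (d $ i0 / 2))\<^sup>2)
       else sqrt (1 / (sinh (collar_radius d))\<^sup>2 + 1 / (cosh (d $ i / 2))\<^sup>2))) (at 0)" by simp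
  qed
  show ?zero using equidistant_area_eq[OF n] area_formula_zero_iff(2)[OF n] by simp
  show ?extension
  proof (intro exI[of _ area_formula] conjI ballI allI impI)
    show "continuous_on (equidistant_set \<union> horocyclic_set) (area_formula :: real ^ 'n::{finite,linorder} \<Rightarrow> real)"
      by (rule continuous_on_area_formula[OF n])
    show "area_formula d = equidistant_area d" if "d \<in> equidistant_set" for d :: "real ^ 'n::{finite,linorder}"
      using equidistant_area_eq[OF n that] by simp
    fix d :: "real ^ 'n::{finite,linorder}" and i0
    assume d: "d \<in> horocyclic_set" and "\<forall>j. d $ j \<le> d $ i0"
    then have "i0 = top_index d"
      using dominant_top_index[OF n UnI2[OF d]] by (intro top_index_maximal[OF n]) auto
    then show "area_formula d = (real CARD('n) - 2) * pi + 2 * (arcsin (1 / cosh (d $ i0 / 2))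
        - (\<Sum>i\<in>UNIV - {i0}. arcsin (1 / cosh (d $ i / 2))))"
      using area_formula_horocyclic[OF n d] by simp
  qed
qed

end
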